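(* Let $(X,\mathcal B,\mu,T)$ be a spectrally weakly mixing dyadic tower with growth sequence $q$, where $q$ is a super growth sequence, i.e. $q_n>2\sum_{1\le k<n}q_k$ for all $n$. Let $(Y,\mathcal C,\nu,S)$ be a conservative, aperiodic, ergodic renewal process with a recurrent event $A$ whose associated renewal sequence $u(A)=(u_0,u_1,\dots)$ is a null recurrent Kaluza sequence, and such that $S\times T$ is conservative. Then the transformation $(Y\times X,\mathcal C\otimes\mathcal B,\nu\times\mu,S\times T)$ is of zero type, rationally ergodic and spectrally weakly mixing, but it is not subsequence rationally weakly mixing.
   Context: Here $\mathbb N=\{1,2,\dots\}$ and $\mathbb N_0=\{0,1,2,\dots\}$. (For each such $T$, a renewal process $S$ as in the claim is known to exist.) Dyadic towers. Let $\Omega:=\{0,1\}^{\mathbb N}$, let $P=\prod(\tfrac12,\tfrac12)$ be the symmetric product probability measure on $\Omega$, and let $\tau:\Omega\to\Omega$ be the dyadic odometer, defined ($P$-a.e.) by $$\tau(1,\dots,1,0,\omega_{\ell+1},\dots)=(0,\dots,0,1,\omega_{\ell+1},\dots),\qquad \ell=\ell(\omega):=\min\{n\ge 1:\ \omega_n=0\}.$$ An increasing sequence $q\in\mathbb N^{\mathbb N}$ is a growth sequence if $q_n>\sum_{1\le k<n}q_k$ for all $n$. The associated dyadic cocycle $\varphi:\Omega\to\mathbb N$ is $\varphi(\omega):=q_{\ell(\omega)}-\sum_{k=1}^{\ell(\omega)-1}q_k$. The dyadic tower with growth sequence $q$ is the measure preserving transformation $(X,\mathcal B,\mu,T)$ with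 $X:=\{(x,n)\in\Omega\times\mathbb N:\ 1\le n\le\varphi(x)\}$, $\mu(A\times\{n\}):=P(A\cap[\varphi\ge n])$, and $T(x,n)=(x,n+1)$ if $\varphi(x)\ge n+1$, $T(x,n)=(\tau x,1)$ if $\varphi(x)=n$. It is conservative and ergodic. Renewal sequences. A sequence $u=(u_0,u_1,\dots)\in[0,1]^{\mathbb N_0}$ is a renewal sequence if $u_0=1$ and there are $f_1,f_2,\dots\ge0$ with $u_n=\sum_{r=1}^nf_ru_{n-r}$ for all $n\ge1$. It is recurrent if $\sum_{n\ge0}u_n=\infty$, null recurrent if in addition $u_n\to0$, and aperiodic if $\gcd\{n\ge1:u_n>0\}=1$. A Kaluza sequence is a sequence $u\in(0,1]^{\mathbb N_0}$ with $u_0=1$ and $\frac{u_{n+1}}{u_n}$ non-decreasing in $n$. Renewal processes. Given a recurrent renewal sequence $u$, there is an irreducible, recurrent stochastic matrix $p:\mathbb N\times\mathbb N\to[0,1]$ with $p^{(n)}_{1,1}=u_n$ for all $n$; the corresponding renewal process is the two-sided stationary Markov shift $(Y,\mathcal C,\nu,S)=(\mathbb N^{\mathbb Z},\mathcal B(\mathbb N^{\mathbb Z}),\nu,\text{Shift})$, with $\nu$ the ($\sigma$-finite) stationary Markov measure with transition matrix $p$. It is conservative and ergodic. It is called aperiodic if $u$ is aperiodic. A set $A\in\mathcal C$ with $0<\nu(A)<\infty$ is a recurrent event for $S$ if for all $0=n_0\le n_1\le\dots\le n_k$, $$\nu\Big(\bigcap_{j=0}^kS^{-n_j}A\Big)=\nu(A)\prod_{j=1}^ku_{n_j-n_{j-1}},\qquad\text{where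 } u_n:=\frac{\nu(A\cap S^{-n}A)}{\nu(A)};$$ then $u(A):=(u_0,u_1,\dots)$ is a renewal sequence, the renewal sequence associated to $A$. Properties of a conservative, ergodic, measure preserving transformation $(Z,\mathcal D,m,R)$ of a $\sigma$-finite measure space. Let $\mathcal F_+:=\{F\in\mathcal D:0<m(F)<\infty\}$. - $R$ is of zero type if $m(A\cap R^{-n}B)\to0$ as $n\to\infty$ for some (equivalently, all) $A,B\in\mathcal F_+$. - $R$ is spectrally weakly mixing if whenever $f\in L^\infty$ and $\lambda\in\mathbb C$, $|\lambda|=1$, satisfy $f\circ R=\lambda f$ a.e., then $f$ is constant a.e. - $R$ is rationally ergodic if there exist $F\in\mathcal F_+$ and $M>0$ such that $\int_F\big(\sum_{k=0}^{n-1}1_F\circ R^k\big)^2dm\le M\big(\int_F\sum_{k=0}^{n-1}1_F\circ R^k\,dm\big)^2$ for all $n\ge1$. - For $F\in\mathcal F_+$ put $u_k(F):=\frac{m(F\cap R^{-k}F)}{m(F)^2}$ and $a_n(F):=\sum_{k=0}^{n-1}u_k(F)$. For an infinite $K\subset\mathbb N$, $R$ is rationally weakly mixing along $K$ if there exists $F\in\mathcal F_+$ such that $\frac1{a_n(F)}\sum_{k=0}^{n-1}|m(A\cap R^{-k}B)-m(A)m(B)u_k(F)|\to0$ as $n\to\infty$, $n\in K$, for all measurable $A,B\subset F$. $R$ is subsequence rationally weakly mixing if it is rationally weakly mixing along some infinite $K\subset\mathbb N$. *)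

theory Defs
  imports "HOL-Probability.Probability"
begin

text \<open>
  Conventions. The set \<open>{1, 2, \<dots>}\<close> is rendered as \<open>{1..}\<close> of type \<^typ>\<open>nat set\<close>; sequences indexed
  by it are functions on \<^typ>\<open>nat\<close> whose value at 0 is never used, points of products over it are
  extensional. A transformation of a measure space \<open>m\<close> is a function \<open>R\<close>, and \<open>preim m R n A\<close> is
  the preimage of \<open>A\<close> under the \<open>n\<close>-th iterate of \<open>R\<close>, taken inside the space of \<open>m\<close>.
\<close>

definition preim :: "'a measure \<Rightarrow> ('a \<Rightarrow> 'a) \<Rightarrow> nat \<Rightarrow> 'a set \<Rightarrow> 'a set" where
  "preim m R n A = (R ^^ n) -` A \<inter> space m"

definition fin_pos_sets :: "'a measure \<Rightarrow> 'a set set" where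
  "fin_pos_sets m = {F \<in> sets m. 0 < emeasure m F \<and> emeasure m F < \<infinity>}"


section \<open>Properties of transformations\<close>

text \<open>Every wandering set is null.\<close>

definition conservative :: "'a measure \<Rightarrow> ('a \<Rightarrow> 'a) \<Rightarrow> bool" where
  "conservative m R \<longleftrightarrow>
     (\<forall>W\<in>sets m. disjoint_family (\<lambda>n. preim m R n W) \<longrightarrow> emeasure m W = 0)"

definition ergodic :: "'a measure \<Rightarrow> ('a \<Rightarrow> 'a) \<Rightarrow> bool" where
  "ergodic m R \<longleftrightarrow>
     (\<forall>A\<in>sets m. preim m R 1 A = A \<longrightarrow> emeasure m A = 0 \<or> emeasure m (space m - A) = 0)"

text \<open>
  For conservative ergodic measure preserving transformations, the following is equivalent to
  convergence for just one pair of sets; the form with all pairs is the formally stronger one.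
\<close>

definition zero_type :: "'a measure \<Rightarrow> ('a \<Rightarrow> 'a) \<Rightarrow> bool" where
  "zero_type m R \<longleftrightarrow>
     (\<forall>A\<in>fin_pos_sets m. \<forall>B\<in>fin_pos_sets m.
        (\<lambda>n. measure m (A \<inter> preim m R n B)) \<longlonglongrightarrow> 0)"

definition spectrally_weakly_mixing :: "'a measure \<Rightarrow> ('a \<Rightarrow> 'a) \<Rightarrow> bool" where
  "spectrally_weakly_mixing m R \<longleftrightarrow>
     (\<forall>(f :: 'a \<Rightarrow> complex) (z :: complex).
        f \<in> borel_measurable m \<longrightarrow> (\<exists>C. AE x in m. norm (f x) \<le> C) \<longrightarrow>
        norm z = 1 \<longrightarrow> (AE x in m. f (R x) = z * f x) \<longrightarrow>
        (\<exists>c. AE x in m. f x = c))"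

definition visits :: "('a \<Rightarrow> 'a) \<Rightarrow> 'a set \<Rightarrow> nat \<Rightarrow> 'a \<Rightarrow> real" where
  "visits R F n x = (\<Sum>k<n. indicator F ((R ^^ k) x))"

definition rationally_ergodic :: "'a measure \<Rightarrow> ('a \<Rightarrow> 'a) \<Rightarrow> bool" where
  "rationally_ergodic m R \<longleftrightarrow>
     (\<exists>F\<in>fin_pos_sets m. \<exists>M>0. \<forall>n\<ge>1.
        (LINT x:F|m. (visits R F n x)\<^sup>2) \<le> M * (LINT x:F|m. visits R F n x)\<^sup>2)"

definition return_seq :: "'a measure \<Rightarrow> ('a \<Rightarrow> 'a) \<Rightarrow> 'a set \<Rightarrow> nat \<Rightarrow> real" where
  "return_seq m R F k = measure m (F \<inter> preim m R k F) / (measure m F)\<^sup>2"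

definition rationally_weakly_mixing_along ::
  "nat set \<Rightarrow> 'a measure \<Rightarrow> ('a \<Rightarrow> 'a) \<Rightarrow> bool" where
  "rationally_weakly_mixing_along K m R \<longleftrightarrow>
     (\<exists>F\<in>fin_pos_sets m. \<forall>A\<in>sets m. \<forall>B\<in>sets m. A \<subseteq> F \<longrightarrow> B \<subseteq> F \<longrightarrow>
        ((\<lambda>n. (\<Sum>k<n. \<bar>measure m (A \<inter> preim m R k B)
                        - measure m A * measure m B * return_seq m R F k\<bar>)
               / (\<Sum>k<n. return_seq m R F k)) \<longlongrightarrow> 0) (inf sequentially (principal K)))"

definition subsequence_rationally_weakly_mixing :: "'a measure \<Rightarrow> ('a \<Rightarrow> 'a) \<Rightarrow> bool" where
  "subsequence_rationally_weakly_mixing m R \<longleftrightarrow>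
     (\<exists>K\<subseteq>{1..}. infinite K \<and> rationally_weakly_mixing_along K m R)"


section \<open>Renewal sequences\<close>

definition renewal_seq :: "(nat \<Rightarrow> real) \<Rightarrow> bool" where
  "renewal_seq u \<longleftrightarrow> (\<forall>n. 0 \<le> u n \<and> u n \<le> 1) \<and> u 0 = 1 \<and>
     (\<exists>f. (\<forall>r\<ge>1. 0 \<le> f r) \<and> (\<forall>n\<ge>1. u n = (\<Sum>r=1..n. f r * u (n - r))))"

text \<open>The terms are nonnegative, so divergence of the series is non-summability.\<close>

definition recurrent_seq :: "(nat \<Rightarrow> real) \<Rightarrow> bool" where
  "recurrent_seq u \<longleftrightarrow> renewal_seq u \<and> \<not> summable u"

definition null_recurrent_seq :: "(nat \<Rightarrow> real) \<Rightarrow> bool" where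
  "null_recurrent_seq u \<longleftrightarrow> recurrent_seq u \<and> u \<longlonglongrightarrow> 0"

definition aperiodic_seq :: "(nat \<Rightarrow> real) \<Rightarrow> bool" where
  "aperiodic_seq u \<longleftrightarrow> Gcd {n. 1 \<le> n \<and> 0 < u n} = 1"

definition kaluza_seq :: "(nat \<Rightarrow> real) \<Rightarrow> bool" where
  "kaluza_seq u \<longleftrightarrow> (\<forall>n. 0 < u n \<and> u n \<le> 1) \<and> u 0 = 1 \<and> mono (\<lambda>n. u (Suc n) / u n)"


section \<open>Renewal processes\<close>

text \<open>Stochastic matrices over the state space \<open>{1, 2, \<dots>}\<close>.\<close>

definition stochastic_matrix :: "(nat \<Rightarrow> nat \<Rightarrow> real) \<Rightarrow> bool" where
  "stochastic_matrix p \<longleftrightarrow> (\<forall>i\<ge>1. (\<forall>j\<ge>1. 0 \<le> p i j) \<and> (p i has_sum 1) {1..})"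

primrec nstep :: "(nat \<Rightarrow> nat \<Rightarrow> real) \<Rightarrow> nat \<Rightarrow> nat \<Rightarrow> nat \<Rightarrow> real" where
  "nstep p 0 i j = (if i = j then 1 else 0)"
| "nstep p (Suc n) i j = (\<Sum>\<^sub>\<infinity>k\<in>{1..}. p i k * nstep p n k j)"

definition irreducible_matrix :: "(nat \<Rightarrow> nat \<Rightarrow> real) \<Rightarrow> bool" where
  "irreducible_matrix p \<longleftrightarrow> (\<forall>i\<ge>1. \<forall>j\<ge>1. \<exists>n. 0 < nstep p n i j)"

definition recurrent_matrix :: "(nat \<Rightarrow> nat \<Rightarrow> real) \<Rightarrow> bool" where
  "recurrent_matrix p \<longleftrightarrow> (\<forall>i\<ge>1. \<not> summable (\<lambda>n. nstep p n i i))"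

text \<open>
  \<open>\<nu>\<close> is the stationary Markov measure on two-sided sequences of states with transition matrix \<open>p\<close>
  and stationary distribution \<open>\<rho>\<close>. It may be infinite; for an irreducible recurrent \<open>p\<close> it is
  unique up to a positive factor, which is left free.
\<close>

definition stationary_markov_measure ::
  "(nat \<Rightarrow> nat \<Rightarrow> real) \<Rightarrow> (nat \<Rightarrow> real) \<Rightarrow> (int \<Rightarrow> nat) measure \<Rightarrow> bool" where
  "stationary_markov_measure p \<rho> \<nu> \<longleftrightarrow>
     (\<forall>i\<ge>1. 0 < \<rho> i) \<and> (\<forall>j\<ge>1. ((\<lambda>i. \<rho> i * p i j) has_sum \<rho> j) {1..}) \<and>
     sets \<nu> = sets (PiM (UNIV :: int set) (\<lambda>_. count_space {1::nat..})) \<and>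
     (\<forall>(k :: int) (n :: nat) s. (\<forall>j\<le>n. 1 \<le> s j) \<longrightarrow>
        emeasure \<nu> {y \<in> space \<nu>. \<forall>j\<le>n. y (k + int j) = s j}
          = ennreal (\<rho> (s 0) * (\<Prod>j<n. p (s j) (s (Suc j)))))"

definition path_shift :: "(int \<Rightarrow> nat) \<Rightarrow> int \<Rightarrow> nat" where
  "path_shift y = (\<lambda>i. y (i + 1))"

text \<open>
  \<open>\<nu>\<close> is the invariant measure of a renewal process corresponding to the recurrent renewal
  sequence \<open>v\<close>; the transformation is \<^const>\<open>path_shift\<close>.
\<close>

definition renewal_process :: "(nat \<Rightarrow> real) \<Rightarrow> (int \<Rightarrow> nat) measure \<Rightarrow> bool" where
  "renewal_process v \<nu> \<longleftrightarrow> recurrent_seq v \<and>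
     (\<exists>p \<rho>. stochastic_matrix p \<and> irreducible_matrix p \<and> recurrent_matrix p \<and>
        (\<forall>n. nstep p n 1 1 = v n) \<and> stationary_markov_measure p \<rho> \<nu>)"

definition event_seq :: "'a measure \<Rightarrow> ('a \<Rightarrow> 'a) \<Rightarrow> 'a set \<Rightarrow> nat \<Rightarrow> real" where
  "event_seq m R A n = measure m (A \<inter> preim m R n A) / measure m A"

definition recurrent_event :: "'a measure \<Rightarrow> ('a \<Rightarrow> 'a) \<Rightarrow> 'a set \<Rightarrow> bool" where
  "recurrent_event m R A \<longleftrightarrow> A \<in> fin_pos_sets m \<and>
     (\<forall>(k :: nat) (t :: nat \<Rightarrow> nat). t 0 = 0 \<longrightarrow> mono_on {..k} t \<longrightarrow>
        measure m (\<Inter>j\<le>k. preim m R (t j) A)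
          = measure m A * (\<Prod>j=1..k. event_seq m R A (t j - t (j - 1))))"


section \<open>Dyadic towers\<close>

definition dyadic_measure :: "(nat \<Rightarrow> nat) measure" where
  "dyadic_measure = PiM {1..} (\<lambda>_. uniform_count_measure {0, 1})"

definition first_zero :: "(nat \<Rightarrow> nat) \<Rightarrow> nat" where
  "first_zero \<omega> = (LEAST n. 1 \<le> n \<and> \<omega> n = 0)"

text \<open>
  The all-ones sequence is the only point where odometer and cocycle are not determined. It is a
  null set; it is sent to the all-zeros sequence and gets height 1, so that the tower map is
  defined everywhere.
\<close>

definition odometer :: "(nat \<Rightarrow> nat) \<Rightarrow> nat \<Rightarrow> nat" where
  "odometer \<omega> =
     (if \<exists>n\<ge>1. \<omega> n = 0
      then (\<lambda>n. if 1 \<le> n \<and> n < first_zero \<omega> then 0 else if n = first_zero \<omega> then 1 else \<omega> n)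
      else (\<lambda>n\<in>{1..}. 0))"

definition growth_seq :: "(nat \<Rightarrow> nat) \<Rightarrow> bool" where
  "growth_seq q \<longleftrightarrow> strict_mono_on {1..} q \<and> (\<forall>n\<ge>1. (\<Sum>k\<in>{1..<n}. q k) < q n)"

definition super_growth_seq :: "(nat \<Rightarrow> nat) \<Rightarrow> bool" where
  "super_growth_seq q \<longleftrightarrow> growth_seq q \<and> (\<forall>n\<ge>1. 2 * (\<Sum>k\<in>{1..<n}. q k) < q n)"

text \<open>For a growth sequence the natural number subtraction below is not truncated.\<close>

definition dyadic_cocycle :: "(nat \<Rightarrow> nat) \<Rightarrow> (nat \<Rightarrow> nat) \<Rightarrow> nat" where
  "dyadic_cocycle q \<omega> =
     (if \<exists>n\<ge>1. \<omega> n = 0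
      then q (first_zero \<omega>) - (\<Sum>k\<in>{1..<first_zero \<omega>}. q k)
      else 1)"

text \<open>
  The product of \<^const>\<open>dyadic_measure\<close> with counting measure, restricted to the region under the
  graph of the cocycle, gives \<open>A \<times> {n}\<close> the measure of \<open>{\<omega> \<in> A. n \<le> \<phi> \<omega>}\<close>.
\<close>

definition tower_measure :: "(nat \<Rightarrow> nat) \<Rightarrow> ((nat \<Rightarrow> nat) \<times> nat) measure" where
  "tower_measure q =
     restrict_space (dyadic_measure \<Otimes>\<^sub>M count_space {1..})
       {(\<omega>, n). 1 \<le> n \<and> n \<le> dyadic_cocycle q \<omega>}"

definition tower_map :: "(nat \<Rightarrow> nat) \<Rightarrow> (nat \<Rightarrow> nat) \<times> nat \<Rightarrow> (nat \<Rightarrow> nat) \<times> nat" where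
  "tower_map q = (\<lambda>(\<omega>, n).
     if n + 1 \<le> dyadic_cocycle q \<omega> then (\<omega>, n + 1) else (odometer \<omega>, 1))"

end

theory Submission
  imports Defs
begin

text \<open>
  Write \<open>S\<close> for the shift and \<open>T\<close> for the tower map. The cocycle is the coboundary of the formal sum
  \<open>\<Sum>i. q\<^sub>i \<omega>\<^sub>i\<close>, so if \<open>T\<^sup>k\<close> maps \<open>\<omega>\<close> to \<open>\<omega>'\<close> inside one level then \<open>k = \<Sum>i. q\<^sub>i (\<omega>'\<^sub>i - \<omega>\<^sub>i)\<close>, and for a super
  growth sequence \<open>k\<close> determines the signed digits \<open>\<omega>'\<^sub>i - \<omega>\<^sub>i \<in> {-1, 0, 1}\<close>.

  Not subsequence rationally weakly mixing: inside a level, for any set \<open>C\<close> of positive measure there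
  is a digit \<open>s\<close> such that both halves \<open>C\<^sub>0\<close>, \<open>C\<^sub>1\<close> of \<open>C\<close> given by \<open>\<omega>\<^sub>s\<close> are positive. No time \<open>k\<close> takes
  points of \<open>C\<^sub>0\<close> to \<open>C\<^sub>1\<close> and also points of \<open>C\<^sub>1\<close> to \<open>C\<^sub>0\<close>, so one of the two correlations vanishes.

  Rational ergodicity: on \<open>A \<times> (level 1)\<close> the second moment is a sum over triples of digit blocks,
  which is bounded digit by digit by the square of the first moment. For digits below the leading ones
  this is the rearrangement inequality \<open>(a\<^sub>- - a\<^sub>+) (b\<^sub>- - b\<^sub>+) \<ge> 0\<close> for averages of the decreasing
  sequence \<open>u(A)\<close>; a leading digit costs a factor 2.

  Spectral weak mixing: let \<open>f\<close> be a bounded eigenfunction of \<open>S \<times> T\<close>. Composing an approximation of \<open>f\<close>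
  with the map induced on \<open>[y\<^sub>0 = 1] \<times> E\<close> (which exists by conservativity and preserves the \<open>L\<^sup>1\<close> error)
  removes its dependence on the past. Hence the averages of \<open>f\<close> over past events in \<open>[y\<^sub>0 = 1]\<close> all equal
  one function \<open>g\<close> on the tower, and \<open>n \<mapsto> \<lambda>\<^sup>-\<^sup>n g (T\<^sup>n x)\<close> is a bounded harmonic sequence for the renewal
  walk. By the Choquet-Deny argument and aperiodicity it is constant, so \<open>g\<close> is an eigenfunction of \<open>T\<close>.
\<close>

section \<open>Signed digit sums\<close>

text \<open>The factor 2 in super growth enters twice: a difference of two displacements has
  coefficients between -2 and 2, and a displacement with leading index t exceeds t - 1, so up to
  time n only the first n digits matter. The obstacle to the second moment bound is that the renewal
  sequence, extended by 0 to the negative integers, jumps up at 0. Leading digits cope with this: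
  such a \<open>q\<close> exceeds the sum of all smaller ones, so a shift down by it gives 0 and a
  shift up lands where the sequence decreases. For eigenfunctions the renewal structure used is that
  of state 1 of the chain. Past and future are independent given a visit to 1, but an approximation
  in \<open>L\<^sup>1\<close> only limits the past to finitely many coordinates. Each return to the
  inducing set erases at least one of them, because the return takes at least one step and its time
  is itself a function of the future. The walk takes its steps at the first visit to 1 at or after a
  fixed time \<open>a\<close>; its step law charges \<open>a\<close> as soon as a return at time
  \<open>a\<close> is possible, which is all that the Choquet-Deny argument asks for.\<close>

definition qsum :: "(nat \<Rightarrow> nat) \<Rightarrow> nat set \<Rightarrow> int" where
  "qsum q I = (\<Sum>i\<in>I. int (q i))"

text \<open>First moment: the set \<open>I\<close> of ones among the first N digits is uniformly
  distributed, hence a single factor \<open>2 ^ N\<close>; \<open>J\<close> runs through all blocks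
  that can be reached and carries no weight.\<close>

definition pair_avg :: "(nat \<Rightarrow> nat) \<Rightarrow> nat \<Rightarrow> (int \<Rightarrow> real) \<Rightarrow> real" where
  "pair_avg q N U = (\<Sum>I\<in>Pow {1..N}. \<Sum>J\<in>Pow {1..N}. U (qsum q J - qsum q I)) / 2 ^ N"

text \<open>Second moment: \<open>I\<close> is the random starting block, \<open>J\<close> and
  \<open>K\<close> are the blocks at two later visits, and \<open>U\<close> and \<open>V\<close>
  weigh the two successive displacements.\<close>

definition triple_avg :: "(nat \<Rightarrow> nat) \<Rightarrow> nat \<Rightarrow> (int \<Rightarrow> real) \<Rightarrow> (int \<Rightarrow> real) \<Rightarrow> real" where
  "triple_avg q N U V =
     (\<Sum>I\<in>Pow {1..N}. \<Sum>J\<in>Pow {1..N}. \<Sum>K\<in>Pow {1..N}.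
        U (qsum q J - qsum q I) * V (qsum q K - qsum q J)) / 2 ^ N"

lemma sum_Pow_Suc:
  "(\<Sum>I\<in>Pow {1..Suc N}. F I) = (\<Sum>I\<in>Pow {1..N}. F I + F (insert (Suc N) I))"
  for F :: "nat set \<Rightarrow> 'b::comm_monoid_add"
proof -
  have e: "{1..Suc N} = insert (Suc N) {1..N}"
    by auto
  have i: "inj_on (insert (Suc N)) (Pow {1..N})"
  proof (rule inj_onI)
    fix I J assume "I \<in> Pow {1..N}" "J \<in> Pow {1..N}" and eq: "insert (Suc N) I = insert (Suc N) J"
    then have "Suc N \<notin> I" "Suc N \<notin> J"
      by auto
    with eq show "I = J"
      by (simp add: insert_ident)
  qed
  have "(\<Sum>I\<in>Pow {1..Suc N}. F I)
      = (\<Sum>I\<in>Pow {1..N}. F I) + (\<Sum>I\<in>insert (Suc N) ` Pow {1..N}. F I)"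
    unfolding e Pow_insert by (rule sum.union_disjoint) auto
  then show ?thesis
    using i by (simp add: sum.reindex sum.distrib)
qed

lemma qsum_insert:
  assumes "I \<in> Pow {1..N}"
  shows "qsum q (insert (Suc N) I) = qsum q I + int (q (Suc N))"
proof -
  have "finite I" "Suc N \<notin> I"
    using assms finite_subset by auto
  then show ?thesis
    by (simp add: qsum_def)
qed

text \<open>The two choices with equal new digits keep the displacement and together cancel the new
  factor 1/2; the two choices with different digits shift it up or down by the new
  \<open>q\<close>.\<close>

lemma pair_avg_Suc:
  "pair_avg q (Suc N) U = pair_avg q N U
     + pair_avg q N (\<lambda>x. U (x + int (q (Suc N)))) / 2
     + pair_avg q N (\<lambda>x. U (x - int (q (Suc N)))) / 2"
proof -
  let ?Q = "int (q (Suc N))"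
  have "(\<Sum>I\<in>Pow {1..Suc N}. \<Sum>J\<in>Pow {1..Suc N}. U (qsum q J - qsum q I))
      = (\<Sum>I\<in>Pow {1..N}. \<Sum>J\<in>Pow {1..N}. 2 * U (qsum q J - qsum q I)
           + U (qsum q J - qsum q I + ?Q) + U (qsum q J - qsum q I - ?Q))"
    unfolding sum_Pow_Suc sum.distrib[symmetric]
    by (intro sum.cong refl) (simp add: qsum_insert algebra_simps add_divide_distrib)
  also have "\<dots> = 2 * (\<Sum>I\<in>Pow {1..N}. \<Sum>J\<in>Pow {1..N}. U (qsum q J - qsum q I))
      + (\<Sum>I\<in>Pow {1..N}. \<Sum>J\<in>Pow {1..N}. U (qsum q J - qsum q I + ?Q))
      + (\<Sum>I\<in>Pow {1..N}. \<Sum>J\<in>Pow {1..N}. U (qsum q J - qsum q I - ?Q))"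
    by (simp add: sum.distrib sum_distrib_left)
  finally show ?thesis
    unfolding pair_avg_def by (simp add: add_divide_distrib)
qed

text \<open>Of the eight choices of the new digit two keep both displacements. \<open>U\<close> and
  \<open>V\<close> are never shifted in the same direction, since a digit that went up can next only
  stay or go down. The missing terms are what the rearrangement argument lives on.\<close>

lemma triple_avg_Suc:
  fixes q N
  defines "Q \<equiv> int (q (Suc N))"
  shows "triple_avg q (Suc N) U V = triple_avg q N U V
     + (triple_avg q N U (\<lambda>x. V (x + Q)) + triple_avg q N U (\<lambda>x. V (x - Q))
      + triple_avg q N (\<lambda>x. U (x + Q)) V + triple_avg q N (\<lambda>x. U (x - Q)) V
      + triple_avg q N (\<lambda>x. U (x + Q)) (\<lambda>x. V (x - Q))
      + triple_avg q N (\<lambda>x. U (x - Q)) (\<lambda>x. V (x + Q))) / 2"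
proof -
  let ?S = "\<lambda>U V. \<Sum>I\<in>Pow {1..N}. \<Sum>J\<in>Pow {1..N}. \<Sum>K\<in>Pow {1..N}.
        U (qsum q J - qsum q I) * V (qsum q K - qsum q J)"
  let ?t = "\<lambda>U V I J K. U (qsum q J - qsum q I) * V (qsum q K - qsum q J) :: real"
  have "(\<Sum>I\<in>Pow {1..Suc N}. \<Sum>J\<in>Pow {1..Suc N}. \<Sum>K\<in>Pow {1..Suc N}.
           U (qsum q J - qsum q I) * V (qsum q K - qsum q J))
      = (\<Sum>I\<in>Pow {1..N}. \<Sum>J\<in>Pow {1..N}. \<Sum>K\<in>Pow {1..N}. 2 * ?t U V I J K
           + ?t U (\<lambda>x. V (x + Q)) I J K + ?t U (\<lambda>x. V (x - Q)) I J K
           + ?t (\<lambda>x. U (x + Q)) V I J K + ?t (\<lambda>x. U (x - Q)) V I J K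
           + ?t (\<lambda>x. U (x + Q)) (\<lambda>x. V (x - Q)) I J K
           + ?t (\<lambda>x. U (x - Q)) (\<lambda>x. V (x + Q)) I J K)"
    unfolding sum_Pow_Suc sum.distrib[symmetric]
    by (intro sum.cong refl) (simp add: qsum_insert algebra_simps Q_def)
  also have "\<dots> = 2 * ?S U V
      + ?S U (\<lambda>x. V (x + Q)) + ?S U (\<lambda>x. V (x - Q))
      + ?S (\<lambda>x. U (x + Q)) V + ?S (\<lambda>x. U (x - Q)) V
      + ?S (\<lambda>x. U (x + Q)) (\<lambda>x. V (x - Q))
      + ?S (\<lambda>x. U (x - Q)) (\<lambda>x. V (x + Q))"
    by (simp only: sum.distrib sum_distrib_left)
  finally show ?thesis
    unfolding triple_avg_def by (simp add: add_divide_distrib)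
qed

lemma pair_avg_0 [simp]: "pair_avg q 0 U = U 0"
  by (simp add: pair_avg_def)

lemma triple_avg_0 [simp]: "triple_avg q 0 U V = U 0 * V 0"
  by (simp add: triple_avg_def)

lemma triple_avg_commute: "triple_avg q N U V = triple_avg q N V U"
proof (induction N arbitrary: U V)
  case (Suc N)
  show ?case
    unfolding triple_avg_Suc
    by (simp only: Suc[of U] Suc[of "\<lambda>x. U (x + _)"] Suc[of "\<lambda>x. U (x - _)"]) simp
qed (simp add: mult.commute)

lemma qsum_bounds:
  assumes "I \<in> Pow {1..N}"
  shows "0 \<le> qsum q I" "qsum q I \<le> qsum q {1..N}"
  using assms unfolding qsum_def by (auto intro!: sum_nonneg sum_mono2)

lemma qsum_diff_bound:
  assumes "I \<in> Pow {1..N}" "J \<in> Pow {1..N}"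
  shows "\<bar>qsum q J - qsum q I\<bar> \<le> qsum q {1..N}"
  using qsum_bounds[OF assms(1), of q] qsum_bounds[OF assms(2), of q] by linarith

text \<open>Displacements of N digits stay in this range. The functions to be compared later are
  monotone on such a range only.\<close>

lemma pair_avg_mono:
  assumes "\<And>x. \<bar>x\<bar> \<le> qsum q {1..N} \<Longrightarrow> U x \<le> V x"
  shows "pair_avg q N U \<le> pair_avg q N V"
  unfolding pair_avg_def
  by (intro divide_right_mono sum_mono assms qsum_diff_bound) auto

lemma pair_avg_nonneg:
  assumes "\<And>x. 0 \<le> U x"
  shows "0 \<le> pair_avg q N U"
  unfolding pair_avg_def by (intro divide_nonneg_pos sum_nonneg assms) auto

text \<open>Rearrangement: the difference of the two sides is, digit by digit, a product of the form
  \<open>(a\<^sub>- - a\<^sub>+) (b\<^sub>- - b\<^sub>+) / 4\<close> with both factors nonnegative.\<close>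

lemma triple_avg_antimono_le:
  assumes "\<And>x. 0 \<le> U x" "\<And>x. 0 \<le> V x"
    and "\<And>x y. \<bar>x\<bar> \<le> qsum q {1..N} \<Longrightarrow> \<bar>y\<bar> \<le> qsum q {1..N} \<Longrightarrow> x \<le> y \<Longrightarrow> U y \<le> U x"
    and "\<And>x y. \<bar>x\<bar> \<le> qsum q {1..N} \<Longrightarrow> \<bar>y\<bar> \<le> qsum q {1..N} \<Longrightarrow> x \<le> y \<Longrightarrow> V y \<le> V x"
  shows "triple_avg q N U V \<le> pair_avg q N U * pair_avg q N V"
  using assms
proof (induction N arbitrary: U V)
  case (Suc N)
  define Q where "Q = int (q (Suc N))"
  have S: "qsum q {1..Suc N} = qsum q {1..N} + Q" and Q0: "0 \<le> Q"
    by (simp_all add: qsum_def Q_def)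
  define Up Um Vp Vm where "Up = (\<lambda>x. U (x + Q))" and "Um = (\<lambda>x. U (x - Q))"
    and "Vp = (\<lambda>x. V (x + Q))" and "Vm = (\<lambda>x. V (x - Q))"
  let ?A = "pair_avg q N" and ?L = "triple_avg q N"
  have nn: "\<And>x. 0 \<le> Up x" "\<And>x. 0 \<le> Um x" "\<And>x. 0 \<le> Vp x" "\<And>x. 0 \<le> Vm x"
    using Suc.prems(1,2) by (auto simp: Up_def Um_def Vp_def Vm_def)
  \<comment> \<open>Adding the new digit widens the range by exactly \<open>Q\<close>, so both
    shifts stay where monotonicity is assumed.\<close>
  have dec: "W y \<le> W x"
    if "\<bar>x\<bar> \<le> qsum q {1..N}" "\<bar>y\<bar> \<le> qsum q {1..N}" "x \<le> y" "W \<in> {U, Up, Um, V, Vp, Vm}" for W x y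
    using that Q0 unfolding Up_def Um_def Vp_def Vm_def by (auto intro!: Suc.prems(3,4) simp: S simp del: One_nat_def)
  have IH: "?L W W' \<le> ?A W * ?A W'" if "W \<in> {U, Up, Um}" "W' \<in> {V, Vp, Vm}" for W W'
  proof (rule Suc.IH)
    show "0 \<le> W x" "0 \<le> W' x" for x
      using that nn Suc.prems(1,2) by auto
    show "W y \<le> W x" "W' y \<le> W' x"
      if "\<bar>x\<bar> \<le> qsum q {1..N}" "\<bar>y\<bar> \<le> qsum q {1..N}" "x \<le> y" for x y
      by (rule dec[OF that], use \<open>W \<in> _\<close> \<open>W' \<in> _\<close> in auto)+
  qed
  have "?A Up \<le> ?A Um" "?A Vp \<le> ?A Vm"
    unfolding Up_def Um_def Vp_def Vm_def
    by (intro pair_avg_mono Suc.prems(3,4); use Q0 in \<open>simp add: S del: One_nat_def\<close>)+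
  then have "0 \<le> (?A Um - ?A Up) * (?A Vm - ?A Vp)"
    by simp
  also have "\<dots> = ?A Um * ?A Vm + ?A Up * ?A Vp - ?A Um * ?A Vp - ?A Up * ?A Vm"
    by (simp add: algebra_simps add_divide_distrib)
  finally have "0 \<le> ?A Um * ?A Vm + ?A Up * ?A Vp - ?A Um * ?A Vp - ?A Up * ?A Vm" .
  moreover have "triple_avg q (Suc N) U V = ?L U V
     + (?L U Vp + ?L U Vm + ?L Up V + ?L Um V + ?L Up Vm + ?L Um Vp) / 2"
    unfolding triple_avg_Suc Up_def Um_def Vp_def Vm_def Q_def ..
  moreover have "pair_avg q (Suc N) U = ?A U + ?A Up / 2 + ?A Um / 2"
    "pair_avg q (Suc N) V = ?A V + ?A Vp / 2 + ?A Vm / 2"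
    unfolding pair_avg_Suc Up_def Um_def Vp_def Vm_def Q_def by simp_all
  ultimately show ?case
    using IH[of U V] IH[of U Vp] IH[of U Vm] IH[of Up V] IH[of Um V] IH[of Up Vm] IH[of Um Vp]
    by (simp add: algebra_simps add_divide_distrib)
qed simp

lemma triple_avg_zero_left:
  assumes "\<And>x. \<bar>x\<bar> \<le> qsum q {1..N} \<Longrightarrow> U x = 0"
  shows "triple_avg q N U V = 0"
  unfolding triple_avg_def
  by (simp add: assms[OF qsum_diff_bound])

lemma pair_avg_zero:
  assumes "\<And>x. \<bar>x\<bar> \<le> qsum q {1..N} \<Longrightarrow> U x = 0"
  shows "pair_avg q N U = 0"
  unfolding pair_avg_def
  by (simp add: assms[OF qsum_diff_bound])

text \<open>Here only \<open>U\<close> jumps at 0. At each new digit \<open>Um\<close> vanishes on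
  the range, since the new \<open>q\<close> exceeds all smaller displacements, and \<open>Up\<close>
  is decreasing there, so the rearranged bound applies to it. The term with \<open>Up\<close> and
  \<open>Vm\<close> has weight 1/2 in the triple average but 1/4 in the product of the pair
  averages; this is the origin of the factor 2.\<close>

lemma triple_avg_one_sided_le:
  assumes gr: "\<And>n. n \<ge> 1 \<Longrightarrow> qsum q {1..<n} < int (q n)"
    and nn: "\<And>x. 0 \<le> U x" and neg: "\<And>x. x < 0 \<Longrightarrow> U x = 0"
    and dec: "\<And>x y. 0 \<le> x \<Longrightarrow> x \<le> y \<Longrightarrow> U y \<le> U x"
    and "\<And>x. 0 \<le> V x"
    and "\<And>x y. \<bar>x\<bar> \<le> qsum q {1..N} \<Longrightarrow> \<bar>y\<bar> \<le> qsum q {1..N} \<Longrightarrow> x \<le> y \<Longrightarrow> V y \<le> V x"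
  shows "triple_avg q N U V \<le> 2 * pair_avg q N U * pair_avg q N V"
  using assms(5,6)
proof (induction N arbitrary: V)
  case (Suc N)
  define Q where "Q = int (q (Suc N))"
  have S: "qsum q {1..Suc N} = qsum q {1..N} + Q"
    by (simp add: qsum_def Q_def)
  have Q0: "qsum q {1..N} < Q"
    using gr[of "Suc N"] unfolding atLeastLessThanSuc_atLeastAtMost Q_def by simp
  have S0: "0 \<le> qsum q {1..N}"
    by (simp add: qsum_def sum_nonneg)
  define Up Um Vp Vm where "Up = (\<lambda>x. U (x + Q))" and "Um = (\<lambda>x. U (x - Q))"
    and "Vp = (\<lambda>x. V (x + Q))" and "Vm = (\<lambda>x. V (x - Q))"
  let ?A = "pair_avg q N" and ?L = "triple_avg q N"
  have decV: "W y \<le> W x"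
    if "\<bar>x\<bar> \<le> qsum q {1..N}" "\<bar>y\<bar> \<le> qsum q {1..N}" "x \<le> y" "W \<in> {V, Vp, Vm}" for W x y
    using that Q0 S0 unfolding Vp_def Vm_def by (auto intro!: Suc.prems(2) simp: S simp del: One_nat_def)
  have Vnn: "0 \<le> W x" if "W \<in> {V, Vp, Vm}" for W x
    using that Suc.prems(1) by (auto simp: Vp_def Vm_def)
  have IH: "?L U W \<le> 2 * ?A U * ?A W" if "W \<in> {V, Vp, Vm}" for W
    by (rule Suc.IH[OF Vnn[OF that] decV[OF _ _ _ that]])
  have Upd: "?L Up W \<le> ?A Up * ?A W" if "W \<in> {V, Vp, Vm}" for W
  proof (rule triple_avg_antimono_le)
    show "0 \<le> Up x" "0 \<le> W x" for x
      using nn Vnn[OF that] by (auto simp: Up_def)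
    fix x y assume xy: "\<bar>x\<bar> \<le> qsum q {1..N}" "\<bar>y\<bar> \<le> qsum q {1..N}" "x \<le> y"
    show "Up y \<le> Up x"
      unfolding Up_def using xy Q0 by (intro dec) auto
    show "W y \<le> W x"
      by (rule decV[OF xy that])
  qed
  have z: "Um x = 0" if "\<bar>x\<bar> \<le> qsum q {1..N}" for x
    unfolding Um_def using that Q0 by (intro neg) auto
  have zero: "?A Um = 0" "?L Um W = 0" for W
    using z by (auto intro!: pair_avg_zero triple_avg_zero_left)
  \<comment> \<open>The terms that the doubled right side has in excess.\<close>
  have pos: "0 \<le> ?A Up * ?A Vp" "0 \<le> ?A Up * ?A V"
    by (intro mult_nonneg_nonneg pair_avg_nonneg; use nn Suc.prems(1) in \<open>simp add: Up_def Vp_def\<close>)+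
  have "triple_avg q (Suc N) U V = ?L U V
     + (?L U Vp + ?L U Vm + ?L Up V + ?L Um V + ?L Up Vm + ?L Um Vp) / 2"
    unfolding triple_avg_Suc Up_def Um_def Vp_def Vm_def Q_def ..
  moreover have "pair_avg q (Suc N) U = ?A U + ?A Up / 2 + ?A Um / 2"
    "pair_avg q (Suc N) V = ?A V + ?A Vp / 2 + ?A Vm / 2"
    unfolding pair_avg_Suc Up_def Um_def Vp_def Vm_def Q_def by simp_all
  ultimately show ?case
    using IH[of V] IH[of Vp] IH[of Vm] Upd[of V] Upd[of Vm] pos
    by (simp add: zero algebra_simps add_divide_distrib)
qed (use nn in simp)

text \<open>Induction on the top digit. With \<open>Um\<close> gone, the two surviving mixed terms
  coincide and pair the jumping \<open>U\<close> with \<open>Up\<close>, which is decreasing on the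
  range, so the one-sided bound applies. What is missing to the full square is a multiple of the
  square of the average of \<open>Up\<close>.\<close>

lemma triple_avg_le_square:
  assumes gr: "\<And>n. n \<ge> 1 \<Longrightarrow> qsum q {1..<n} < int (q n)"
    and nn: "\<And>x. 0 \<le> U x" and neg: "\<And>x. x < 0 \<Longrightarrow> U x = 0"
    and dec: "\<And>x y. 0 \<le> x \<Longrightarrow> x \<le> y \<Longrightarrow> U y \<le> U x"
  shows "triple_avg q N U U \<le> 2 * (pair_avg q N U)\<^sup>2"
proof (induction N)
  case (Suc N)
  define Q where "Q = int (q (Suc N))"
  have Q0: "qsum q {1..N} < Q"
    using gr[of "Suc N"] unfolding atLeastLessThanSuc_atLeastAtMost Q_def by simp
  define Up Um where "Up = (\<lambda>x. U (x + Q))" and "Um = (\<lambda>x. U (x - Q))"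
  let ?A = "pair_avg q N" and ?L = "triple_avg q N"
  have "Um x = 0" if "\<bar>x\<bar> \<le> qsum q {1..N}" for x
    unfolding Um_def using that Q0 by (intro neg) auto
  then have zero: "?A Um = 0" "?L Um W = 0" "?L W Um = 0" for W
    by (auto intro!: pair_avg_zero triple_avg_zero_left simp: triple_avg_commute[of q N W Um])
  have L: "?L U Up \<le> 2 * ?A U * ?A Up"
  proof (rule triple_avg_one_sided_le[OF gr nn neg dec])
    fix x y assume "\<bar>x\<bar> \<le> qsum q {1..N}" "\<bar>y\<bar> \<le> qsum q {1..N}" "x \<le> y"
    then show "Up y \<le> Up x"
      unfolding Up_def using Q0 by (intro dec) auto
  qed (simp_all add: Up_def nn)
  have "triple_avg q (Suc N) U U = ?L U U
     + (?L U Up + ?L U Um + ?L Up U + ?L Um U + ?L Up Um + ?L Um Up) / 2"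
    unfolding triple_avg_Suc Up_def Um_def Q_def ..
  moreover have "pair_avg q (Suc N) U = ?A U + ?A Up / 2 + ?A Um / 2"
    unfolding pair_avg_Suc Up_def Um_def Q_def by simp_all
  ultimately show ?case
    using L Suc triple_avg_commute[of q N Up U]
    by (simp add: zero power2_eq_square algebra_simps add_divide_distrib)
       (use zero_le_square[of "?A Up"] in linarith)
qed (use nn in \<open>simp add: power2_eq_square\<close>)

section \<open>Orbits of the dyadic tower\<close>

definition ones :: "nat \<Rightarrow> (nat \<Rightarrow> nat) \<Rightarrow> nat set" where
  "ones N \<omega> = {i \<in> {1..N}. \<omega> i = 1}"

text \<open>A set of full measure, invariant under the odometer, on which a carry always stops. Its
  orbits never meet the all-ones point and the convention made there.\<close>

definition inf_zeros :: "(nat \<Rightarrow> nat) set" where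
  "inf_zeros = {\<omega> \<in> space dyadic_measure. \<forall>m. \<exists>n\<ge>m. \<omega> n = 0}"

lemma space_dyadic: "space dyadic_measure = {1..} \<rightarrow>\<^sub>E {0, 1}"
  by (simp add: dyadic_measure_def space_PiM space_uniform_count_measure)

lemma digit_cases:
  assumes "\<omega> \<in> space dyadic_measure" "1 \<le> i"
  shows "\<omega> i = 0 \<or> \<omega> i = 1"
  using assms by (auto simp: space_dyadic PiE_iff)

lemma ones_subset: "ones N \<omega> \<in> Pow {1..N}"
  by (auto simp: ones_def)

lemma growth_seq_qsum:
  assumes "growth_seq q" "1 \<le> n"
  shows "qsum q {1..<n} < int (q n)"
  using assms unfolding growth_seq_def qsum_def by (simp flip: of_nat_sum)

lemma super_growth_seq_qsum:
  assumes "super_growth_seq q" "1 \<le> n"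
  shows "2 * qsum q {1..<n} < int (q n)"
proof -
  have "2 * (\<Sum>k\<in>{1..<n}. q k) < q n"
    using assms unfolding super_growth_seq_def by simp
  then have "int (2 * (\<Sum>k\<in>{1..<n}. q k)) < int (q n)"
    by (simp only: of_nat_less_iff)
  then show ?thesis
    by (simp add: qsum_def)
qed

lemma growth_seq_pos:
  assumes "growth_seq q" "1 \<le> n"
  shows "1 \<le> q n"
  using assms unfolding growth_seq_def by fastforce

lemma first_zero:
  assumes "\<omega> \<in> inf_zeros"
  shows "1 \<le> first_zero \<omega>" "\<omega> (first_zero \<omega>) = 0"
    "\<And>i. 1 \<le> i \<Longrightarrow> i < first_zero \<omega> \<Longrightarrow> \<omega> i = 1" "\<exists>n\<ge>1. \<omega> n = 0"
proof -
  have sp: "\<omega> \<in> space dyadic_measure"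
    using assms by (simp add: inf_zeros_def)
  show ex: "\<exists>n\<ge>1. \<omega> n = 0"
    using assms by (auto simp: inf_zeros_def)
  then have "1 \<le> first_zero \<omega> \<and> \<omega> (first_zero \<omega>) = 0"
    unfolding first_zero_def by (rule LeastI_ex)
  then show "1 \<le> first_zero \<omega>" "\<omega> (first_zero \<omega>) = 0"
    by auto
  show "\<omega> i = 1" if i: "1 \<le> i" "i < first_zero \<omega>" for i
    using digit_cases[OF sp i(1)] not_less_Least[OF i(2)[unfolded first_zero_def]] i(1) by auto
qed

lemma odometer_eq:
  assumes "\<omega> \<in> inf_zeros"
  shows "odometer \<omega> i =
    (if 1 \<le> i \<and> i < first_zero \<omega> then 0 else if i = first_zero \<omega> then 1 else \<omega> i)"
  using first_zero(4)[OF assms] by (simp add: odometer_def)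

lemma odometer_inf_zeros:
  assumes "\<omega> \<in> inf_zeros"
  shows "odometer \<omega> \<in> inf_zeros"
proof -
  have "odometer \<omega> \<in> space dyadic_measure"
    using assms first_zero(1)[OF assms] unfolding inf_zeros_def space_dyadic
    by (auto simp: odometer_eq[OF assms] PiE_iff extensional_def)
  moreover have "\<exists>n\<ge>m. odometer \<omega> n = 0" for m
  proof -
    obtain n where "n \<ge> max m (Suc (first_zero \<omega>))" "\<omega> n = 0"
      using assms unfolding inf_zeros_def by blast
    then show ?thesis
      using odometer_eq[OF assms, of n] by (intro exI[of _ n]) auto
  qed
  ultimately show ?thesis
    by (simp add: inf_zeros_def)
qed

lemma qsum_Un:
  assumes "finite I" "finite J" "I \<inter> J = {}"
  shows "qsum q (I \<union> J) = qsum q I + qsum q J"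
  using assms by (simp add: qsum_def sum.union_disjoint)

lemma qsum_mono:
  assumes "finite J" "I \<subseteq> J"
  shows "qsum q I \<le> qsum q J"
  unfolding qsum_def by (rule sum_mono2) (use assms in auto)

lemma cocycle_inf_zeros:
  assumes "growth_seq q" "\<omega> \<in> inf_zeros"
  shows "int (dyadic_cocycle q \<omega>) = int (q (first_zero \<omega>)) - qsum q {1..<first_zero \<omega>}"
    "1 \<le> dyadic_cocycle q \<omega>"
proof -
  let ?S = "\<Sum>k\<in>{1..<first_zero \<omega>}. q k"
  have "?S < q (first_zero \<omega>)"
    using first_zero(1)[OF assms(2)] assms(1) by (simp add: growth_seq_def)
  moreover have "qsum q {1..<first_zero \<omega>} = int ?S"
    by (simp add: qsum_def)
  moreover have "dyadic_cocycle q \<omega> = q (first_zero \<omega>) - ?S"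
    using first_zero(4)[OF assms(2)] by (simp add: dyadic_cocycle_def)
  ultimately show "int (dyadic_cocycle q \<omega>) = int (q (first_zero \<omega>)) - qsum q {1..<first_zero \<omega>}"
    "1 \<le> dyadic_cocycle q \<omega>"
    by linarith+
qed

lemma ones_first_zero:
  assumes "\<omega> \<in> inf_zeros" "first_zero \<omega> \<le> N"
  shows "ones N \<omega> = {1..<first_zero \<omega>} \<union> (ones N \<omega> \<inter> {first_zero \<omega><..})"
    "ones N (odometer \<omega>) = {first_zero \<omega>} \<union> (ones N \<omega> \<inter> {first_zero \<omega><..})"
proof -
  note fz = first_zero[OF assms(1)]
  have "i \<in> ones N \<omega> \<longleftrightarrow> i \<in> {1..<first_zero \<omega>} \<union> (ones N \<omega> \<inter> {first_zero \<omega><..})" for i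
    using fz(2) fz(3)[of i] assms(2) by (cases i "first_zero \<omega>" rule: linorder_cases) (auto simp: ones_def)
  then show "ones N \<omega> = {1..<first_zero \<omega>} \<union> (ones N \<omega> \<inter> {first_zero \<omega><..})"
    by blast
  have "i \<in> ones N (odometer \<omega>) \<longleftrightarrow> i \<in> {first_zero \<omega>} \<union> (ones N \<omega> \<inter> {first_zero \<omega><..})" for i
    using fz(1) assms(2)
    by (cases i "first_zero \<omega>" rule: linorder_cases) (auto simp: ones_def odometer_eq[OF assms(1)])
  then show "ones N (odometer \<omega>) = {first_zero \<omega>} \<union> (ones N \<omega> \<inter> {first_zero \<omega><..})"
    by blast
qed

lemma qsum_ones_odometer:
  assumes "growth_seq q" "\<omega> \<in> inf_zeros" "first_zero \<omega> \<le> N"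
  shows "qsum q (ones N (odometer \<omega>)) = qsum q (ones N \<omega>) + int (dyadic_cocycle q \<omega>)"
proof -
  let ?R = "ones N \<omega> \<inter> {first_zero \<omega><..}"
  have f: "finite ?R"
    by (simp add: ones_def)
  have "qsum q (ones N \<omega>) = qsum q {1..<first_zero \<omega>} + qsum q ?R"
    by (subst ones_first_zero(1)[OF assms(2,3)], rule qsum_Un) (use f in auto)
  moreover have "qsum q (ones N (odometer \<omega>)) = qsum q {first_zero \<omega>} + qsum q ?R"
    by (subst ones_first_zero(2)[OF assms(2,3)], rule qsum_Un) (use f in auto)
  ultimately show ?thesis
    using cocycle_inf_zeros(1)[OF assms(1,2)] by (simp add: qsum_def)
qed

text \<open>The cocycle is the formal coboundary of \<open>\<omega> \<mapsto> \<Sum>i. q\<^sub>i \<omega>\<^sub>i\<close>, so the time between two points of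
  an orbit can be read off their digits.\<close>

lemma tower_orbit:
  assumes "growth_seq q" "\<omega> \<in> inf_zeros" "(tower_map q ^^ k) (\<omega>, h) = (\<omega>', h')"
    "1 \<le> h" "h \<le> dyadic_cocycle q \<omega>"
  shows "\<omega>' \<in> inf_zeros \<and> 1 \<le> h' \<and> h' \<le> dyadic_cocycle q \<omega>' \<and>
    (\<exists>N0. \<forall>N\<ge>N0. (\<forall>i>N. \<omega>' i = \<omega> i) \<and>
       int k = int h' - int h + qsum q (ones N \<omega>') - qsum q (ones N \<omega>))"
  using assms(3)
proof (induction k arbitrary: \<omega>' h')
  case 0
  then show ?case
    using assms by auto
next
  case (Suc k)
  obtain w l where wl: "(tower_map q ^^ k) (\<omega>, h) = (w, l)"
    by (cases "(tower_map q ^^ k) (\<omega>, h)")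
  from Suc.IH[OF this] obtain N0 where w: "w \<in> inf_zeros" "1 \<le> l" "l \<le> dyadic_cocycle q w"
    and N0: "\<And>N. N \<ge> N0 \<Longrightarrow> (\<forall>i>N. w i = \<omega> i) \<and>
       int k = int l - int h + qsum q (ones N w) - qsum q (ones N \<omega>)"
    by blast
  have step: "tower_map q (w, l) = (\<omega>', h')"
    using Suc.prems wl by simp
  show ?case
  proof (cases "l + 1 \<le> dyadic_cocycle q w")
    case True
    then have "\<omega>' = w" "h' = l + 1"
      using step by (auto simp: tower_map_def)
    then show ?thesis
      using w True N0 by (auto intro!: exI[of _ N0])
  next
    case False
    then have e: "\<omega>' = odometer w" "h' = 1" "l = dyadic_cocycle q w"
      using step w by (auto simp: tower_map_def)
    have "odometer w \<in> inf_zeros"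
      by (rule odometer_inf_zeros[OF w(1)])
    moreover have "(\<forall>i>N. odometer w i = \<omega> i) \<and>
       int (Suc k) = 1 - int h + qsum q (ones N (odometer w)) - qsum q (ones N \<omega>)"
      if "N \<ge> max N0 (first_zero w)" for N
      using N0[of N] that qsum_ones_odometer[OF assms(1) w(1), of N] e(3)
      by (auto simp: odometer_eq[OF w(1)])
    ultimately show ?thesis
      using e cocycle_inf_zeros(2)[OF assms(1)]
      by (intro conjI exI[of _ "max N0 (first_zero w)"]) auto
  qed
qed

section \<open>Leading digits and return times\<close>

text \<open>Above t the digits cancel; below t the worst case is that \<open>I\<close> has all ones
  and \<open>J\<close> has none.\<close>

lemma qsum_top_digit:
  assumes "finite I" "finite J" "I \<subseteq> {1..}" "J \<subseteq> {1..}" "t \<in> J" "t \<notin> I"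
    and "J \<inter> {t<..} = I \<inter> {t<..}"
  shows "int (q t) - qsum q {1..<t} \<le> qsum q J - qsum q I"
proof -
  let ?R = "I \<inter> {t<..}"
  have "I = (I \<inter> {1..<t}) \<union> ?R"
  proof (intro set_eqI iffI)
    fix x assume "x \<in> I"
    moreover from this assms have "1 \<le> x" "x \<noteq> t"
      by auto
    ultimately show "x \<in> (I \<inter> {1..<t}) \<union> ?R"
      by auto
  qed auto
  then have "qsum q I = qsum q (I \<inter> {1..<t}) + qsum q ?R"
    by (metis (no_types, lifting) qsum_Un[of "I \<inter> {1..<t}" ?R q] assms(1) finite_Int Int_assoc
        Int_commute disjoint_iff atLeastLessThan_iff greaterThan_iff Int_iff order_less_asym)
  moreover have "qsum q (I \<inter> {1..<t}) \<le> qsum q {1..<t}"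
    by (rule qsum_mono) auto
  moreover have "qsum q ({t} \<union> ?R) \<le> qsum q J"
    by (rule qsum_mono) (use assms in auto)
  moreover have "qsum q ({t} \<union> ?R) = int (q t) + qsum q ?R"
    by (subst qsum_Un) (use assms in \<open>auto simp: qsum_def\<close>)
  ultimately show ?thesis
    by linarith
qed

lemma top_digit:
  fixes I J :: "nat set"
  assumes "finite I" "finite J" "I \<noteq> J"
  obtains t where "t \<in> J" "t \<notin> I" "J \<inter> {t<..} = I \<inter> {t<..}"
    | t where "t \<in> I" "t \<notin> J" "J \<inter> {t<..} = I \<inter> {t<..}"
proof -
  let ?D = "(I - J) \<union> (J - I)"
  have D: "finite ?D" "?D \<noteq> {}"
    using assms by auto
  have "Max ?D \<in> ?D"
    by (rule Max_in[OF D])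
  moreover have "J \<inter> {Max ?D<..} = I \<inter> {Max ?D<..}"
  proof -
    have "x \<in> J \<longleftrightarrow> x \<in> I" if "Max ?D < x" for x
      using Max_ge[OF D(1), of x] that by (metis DiffI UnCI not_less)
    then show ?thesis
      by auto
  qed
  ultimately show ?thesis
    using that by blast
qed

text \<open>Under growth the leading difference alone decides the sign of a difference of digit
  sums, so it cannot be 0.\<close>

lemma qsum_inj:
  assumes "growth_seq q"
  shows "inj_on (qsum q) (Pow {1..N})"
proof (rule inj_onI, rule ccontr)
  fix I J assume IJ: "I \<in> Pow {1..N}" "J \<in> Pow {1..N}" "qsum q I = qsum q J" "I \<noteq> J"
  then have f: "finite I" "finite J" "I \<subseteq> {1..}" "J \<subseteq> {1..}"
    using finite_subset by auto
  show False
  proof (cases rule: top_digit[OF f(1,2) IJ(4)])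
    case (1 t)
    then show False
      using qsum_top_digit[OF f 1(1-3), of q] growth_seq_qsum[OF assms, of t] f IJ by auto
  next
    case (2 t)
    then show False
      using qsum_top_digit[OF f(2,1,4,3) 2(1,2) 2(3)[symmetric], of q]
        growth_seq_qsum[OF assms, of t] f IJ by auto
  qed
qed

lemma tower_map_to_base:
  assumes "growth_seq q" "\<omega> \<in> inf_zeros"
  shows "(tower_map q ^^ dyadic_cocycle q \<omega>) (\<omega>, 1) = (odometer \<omega>, 1)"
proof -
  have "(tower_map q ^^ j) (\<omega>, 1) = (\<omega>, Suc j)" if "j < dyadic_cocycle q \<omega>" for j
    using that by (induction j) (auto simp: tower_map_def)
  then have "(tower_map q ^^ (dyadic_cocycle q \<omega> - 1)) (\<omega>, 1) = (\<omega>, dyadic_cocycle q \<omega>)"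
    using cocycle_inf_zeros(2)[OF assms] by simp
  then have "(tower_map q ^^ Suc (dyadic_cocycle q \<omega> - 1)) (\<omega>, 1) = (odometer \<omega>, 1)"
    by (simp add: tower_map_def)
  then show ?thesis
    using cocycle_inf_zeros(2)[OF assms] by simp
qed

text \<open>Converse to \<open>tower_orbit\<close>: every nonnegative displacement between blocks is
  a time in the base. The odometer passes through the blocks in increasing order of
  \<open>qsum\<close>, so it never jumps over \<open>J\<close>; each step takes at least one unit
  off the remaining time \<open>d\<close>.\<close>

lemma tower_map_reaches_base:
  assumes gr: "growth_seq q" and J: "J \<in> Pow {1..N}"
  shows "\<omega> \<in> inf_zeros \<Longrightarrow> qsum q J - qsum q (ones N \<omega>) = int d \<Longrightarrow>
    snd ((tower_map q ^^ d) (\<omega>, 1)) = 1"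
proof (induction d arbitrary: \<omega> rule: less_induct)
  case (less d)
  show ?case
  proof (cases "d = 0")
    case False
    let ?l = "first_zero \<omega>" and ?I = "ones N \<omega>"
    note fz = first_zero[OF less.prems(1)]
    have f: "finite ?I" "finite J" "?I \<subseteq> {1..}" "J \<subseteq> {1..}"
      using J finite_subset by (auto simp: ones_def)
    \<comment> \<open>A block consisting of ones only has the largest digit sum, which leaves no
      room for a positive \<open>d\<close>.\<close>
    have l: "?l \<le> N"
    proof (rule ccontr)
      assume "\<not> ?l \<le> N"
      then have "?I = {1..N}"
        using fz(3) by (auto simp: ones_def)
      then show False
        using qsum_bounds(2)[OF J, of q] less.prems(2) False by simp
    qed
    let ?R = "ones N \<omega> \<inter> {?l<..}"
    note on = ones_first_zero[OF less.prems(1) l]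
    have neq: "?I \<noteq> J"
      using less.prems(2) False by auto
    have "qsum q (ones N (odometer \<omega>)) \<le> qsum q J"
    proof (cases rule: top_digit[OF f(1,2) neq])
      case (1 t)
      \<comment> \<open>Below its first zero \<open>\<omega>\<close> has ones only, so no element of
        \<open>J\<close> can be missing there.\<close>
      have "t \<ge> ?l"
        using 1(1,2) f(4) on(1) by (metis UnI1 atLeastLessThan_iff atLeast_iff not_le subsetD)
      show ?thesis
      proof (cases "t = ?l")
        case True
        then have "ones N (odometer \<omega>) \<subseteq> J"
          using 1 on(2) by auto
        then show ?thesis
          by (rule qsum_mono[OF f(2)])
      next
        case False
        then have t: "?l < t"
          using \<open>t \<ge> ?l\<close> by simp
        have o: "finite (ones N (odometer \<omega>))" "ones N (odometer \<omega>) \<subseteq> {1..}"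
          by (auto simp: ones_def)
        \<comment> \<open>The carry does not reach beyond \<open>?l\<close>, so t remains the
          leading difference after the odometer step.\<close>
        have "t \<notin> ones N (odometer \<omega>)"
          using 1(2) on(2) t by auto
        moreover have "J \<inter> {t<..} = ones N (odometer \<omega>) \<inter> {t<..}"
        proof -
          have "ones N (odometer \<omega>) \<inter> {t<..} = ?I \<inter> {t<..}"
            using t by (auto simp: ones_def odometer_eq[OF less.prems(1)])
          then show ?thesis
            using 1(3) by simp
        qed
        ultimately have "int (q t) - qsum q {1..<t} \<le> qsum q J - qsum q (ones N (odometer \<omega>))"
          by (rule qsum_top_digit[OF o(1) f(2) o(2) f(4) 1(1)])
        then show ?thesis
          using growth_seq_qsum[OF gr, of t] t fz(1) by linarith
      qed
    next
      case (2 t)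
      have "t \<ge> 1"
        using 2(1) f(3) by auto
      then show ?thesis
        using qsum_top_digit[OF f(2,1,4,3) 2(1,2) 2(3)[symmetric], of q]
          growth_seq_qsum[OF gr] less.prems(2) by force
    qed
    moreover have c: "qsum q (ones N (odometer \<omega>)) = qsum q ?I + int (dyadic_cocycle q \<omega>)"
      by (rule qsum_ones_odometer[OF gr less.prems(1) l])
    ultimately have le: "dyadic_cocycle q \<omega> \<le> d"
      using less.prems(2) by linarith
    have "snd ((tower_map q ^^ (d - dyadic_cocycle q \<omega>)) (odometer \<omega>, 1)) = 1"
      by (rule less.IH) (use c le less.prems cocycle_inf_zeros(2)[OF gr less.prems(1)]
          odometer_inf_zeros in \<open>auto simp: of_nat_diff\<close>)
    moreover have "tower_map q ^^ d
        = (tower_map q ^^ (d - dyadic_cocycle q \<omega>)) \<circ> (tower_map q ^^ dyadic_cocycle q \<omega>)"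
      using le by (simp flip: funpow_add)
    ultimately show ?thesis
      using tower_map_to_base[OF gr less.prems(1)] by simp
  qed simp
qed

text \<open>A nonzero top coefficient contributes at least \<open>q (Suc N)\<close>, which is more
  than twice the sum of all smaller terms. The bound 2 is the one for a difference of two signed
  digits.\<close>

lemma super_growth_coeffs_zero:
  fixes e :: "nat \<Rightarrow> int"
  assumes "super_growth_seq q" "\<And>i. \<bar>e i\<bar> \<le> 2" "(\<Sum>i\<in>{1..N}. e i * int (q i)) = 0"
  shows "\<forall>i\<in>{1..N}. e i = 0"
  using assms(3)
proof (induction N)
  case (Suc N)
  have "\<bar>\<Sum>i\<in>{1..N}. e i * int (q i)\<bar> \<le> (\<Sum>i\<in>{1..N}. 2 * int (q i))"
    by (rule order_trans[OF sum_abs sum_mono]) (simp add: abs_mult mult_right_mono assms(2))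
  also have "\<dots> = 2 * qsum q {1..<Suc N}"
    by (simp add: qsum_def sum_distrib_left atLeastLessThanSuc_atLeastAtMost)
  also have "\<dots> < int (q (Suc N))"
    by (rule super_growth_seq_qsum[OF assms(1)]) simp
  finally have lt: "\<bar>\<Sum>i\<in>{1..N}. e i * int (q i)\<bar> < int (q (Suc N))" .
  have eq: "(\<Sum>i\<in>{1..N}. e i * int (q i)) + e (Suc N) * int (q (Suc N)) = 0"
    using Suc.prems by simp
  have "e (Suc N) = 0"
  proof (rule ccontr)
    assume "e (Suc N) \<noteq> 0"
    then have "int (q (Suc N)) \<le> \<bar>e (Suc N)\<bar> * int (q (Suc N))"
      by (intro mult_le_cancel_right1[THEN iffD2]) auto
    then show False
      using lt eq by (simp add: abs_mult[symmetric])
  qed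
  moreover from this have "\<forall>i\<in>{1..N}. e i = 0"
    using eq Suc.IH by simp
  ultimately show ?case
    by (auto simp: le_Suc_eq)
qed simp

lemma qsum_ones: "qsum q (ones N \<omega>) = (\<Sum>i\<in>{1..N}. of_bool (\<omega> i = 1) * int (q i))"
  unfolding qsum_def ones_def by (rule sum.mono_neutral_cong_left) auto

text \<open>A displacement \<open>k\<close> has unique signed digits, so it cannot both raise and lower digit \<open>s\<close>.\<close>

lemma tower_orbit_digit:
  assumes sg: "super_growth_seq q" and "1 \<le> s" "1 \<le> h"
    and "\<omega> \<in> inf_zeros" "h \<le> dyadic_cocycle q \<omega>" "(tower_map q ^^ k) (\<omega>, h) = (\<omega>', h)"
    and "\<omega> s = 0" "\<omega>' s = 1"
    and "\<eta> \<in> inf_zeros" "h \<le> dyadic_cocycle q \<eta>" "(tower_map q ^^ k) (\<eta>, h) = (\<eta>', h)"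
    and "\<eta> s = 1" "\<eta>' s = 0"
  shows False
proof -
  have gr: "growth_seq q"
    using sg by (simp add: super_growth_seq_def)
  obtain N1 where N1: "\<And>N. N \<ge> N1 \<Longrightarrow> int k = qsum q (ones N \<omega>') - qsum q (ones N \<omega>)"
    using tower_orbit[OF gr assms(4,6,3,5)] by auto
  obtain N2 where N2: "\<And>N. N \<ge> N2 \<Longrightarrow> int k = qsum q (ones N \<eta>') - qsum q (ones N \<eta>)"
    using tower_orbit[OF gr assms(9,11,3,10)] by auto
  define N where "N = max s (max N1 N2)"
  \<comment> \<open>The difference of the signed digits of the two orbits. Both represent k, so its
    weighted sum is 0, while its value at s is 1 - (-1) = 2.\<close>
  define e :: "nat \<Rightarrow> int" where "e = (\<lambda>i. of_bool (\<omega>' i = 1) - of_bool (\<omega> i = 1)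
     - of_bool (\<eta>' i = 1) + of_bool (\<eta> i = 1))"
  have "qsum q (ones N \<omega>') - qsum q (ones N \<omega>) - qsum q (ones N \<eta>') + qsum q (ones N \<eta>) = 0"
    using N1[of N] N2[of N] unfolding N_def by linarith
  then have "(\<Sum>i\<in>{1..N}. e i * int (q i)) = 0"
    unfolding qsum_ones e_def by (simp add: algebra_simps sum.distrib sum_subtractf)
  moreover have "\<bar>e i\<bar> \<le> 2" for i
    by (simp add: e_def of_bool_def)
  ultimately have "\<forall>i\<in>{1..N}. e i = 0"
    using super_growth_coeffs_zero[OF sg] by blast
  then have "e s = 0"
    using assms(2) by (simp add: N_def)
  then show False
    using assms by (simp add: e_def)
qed

lemma card_le_qsum:
  assumes "growth_seq q" "finite I" "I \<subseteq> {1..}"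
  shows "int (card I) \<le> qsum q I"
proof -
  have "of_nat (card I) * 1 \<le> (\<Sum>i\<in>I. int (q i))"
    by (rule sum_bounded_below) (use growth_seq_pos[OF assms(1)] assms(3) in force)
  then show ?thesis
    by (simp add: qsum_def)
qed

text \<open>If t is the highest digit changed by a return, the return time is larger than the sum of
  the \<open>q\<close> below t, hence at least t. So up to time n no digit beyond n has changed, and
  the return is decided by the first n digits alone.\<close>

lemma tower_return_iff:
  assumes sg: "super_growth_seq q" and w: "\<omega> \<in> inf_zeros" and k: "k \<le> n"
  shows "snd ((tower_map q ^^ k) (\<omega>, 1)) = 1 \<longleftrightarrow>
    (\<exists>J\<in>Pow {1..n}. qsum q J - qsum q (ones n \<omega>) = int k)"
proof
  have gr: "growth_seq q"
    using sg by (simp add: super_growth_seq_def)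
  show "snd ((tower_map q ^^ k) (\<omega>, 1)) = 1"
    if "\<exists>J\<in>Pow {1..n}. qsum q J - qsum q (ones n \<omega>) = int k"
    using that tower_map_reaches_base[OF gr _ w] by blast
  assume "snd ((tower_map q ^^ k) (\<omega>, 1)) = 1"
  then obtain \<omega>' where o: "(tower_map q ^^ k) (\<omega>, 1) = (\<omega>', 1)"
    by (metis prod.collapse)
  have c1: "1 \<le> dyadic_cocycle q \<omega>"
    by (rule cocycle_inf_zeros(2)[OF gr w])
  obtain N0 where N0: "\<And>N. N \<ge> N0 \<Longrightarrow> (\<forall>i>N. \<omega>' i = \<omega> i) \<and>
       int k = qsum q (ones N \<omega>') - qsum q (ones N \<omega>)"
    using tower_orbit[OF gr w o order_refl c1] by auto
  define N where "N = max N0 n"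
  let ?I = "ones N \<omega>" and ?J = "ones N \<omega>'"
  have f: "finite ?I" "finite ?J" "?I \<subseteq> {1..}" "?J \<subseteq> {1..}"
    by (auto simp: ones_def)
  have kN: "int k = qsum q ?J - qsum q ?I"
    using N0[of N] by (simp add: N_def)
  have agree: "?J \<inter> {n<..} = ?I \<inter> {n<..}"
  proof (cases "?I = ?J")
    case False
    show ?thesis
    proof (cases rule: top_digit[OF f(1,2) False])
      case (1 t)
      have t: "t \<ge> 1"
        using 1(1) f by auto
      have "int (t - 1) \<le> qsum q {1..<t}"
        using card_le_qsum[OF gr, of "{1..<t}"] by fastforce
      also have "\<dots> < int (q t) - qsum q {1..<t}"
        using super_growth_seq_qsum[OF sg t] by linarith
      also have "\<dots> \<le> int k"
        using qsum_top_digit[OF f 1(1-3), of q] kN by simp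
      finally have "t \<le> n"
        using k by linarith
      then have sub: "{n<..} = {t<..} \<inter> {n<..}"
        by auto
      show ?thesis
        by (subst (1 2) sub) (simp only: Int_assoc[symmetric] 1(3))
    next
      case (2 t)
      have "t \<ge> 1"
        using 2(1) f by auto
      then show ?thesis
        using qsum_top_digit[OF f(2,1,4,3) 2(1,2) 2(3)[symmetric], of q] kN
          growth_seq_qsum[OF gr, of t] by linarith
    qed
  qed simp
  have split: "qsum q (ones N w) = qsum q (ones n w) + qsum q (ones N w \<inter> {n<..})" for w
  proof -
    have "ones N w = ones n w \<union> (ones N w \<inter> {n<..})"
      by (auto simp: ones_def N_def)
    then have "qsum q (ones N w) = qsum q (ones n w \<union> (ones N w \<inter> {n<..}))"
      by (rule arg_cong)
    also have "\<dots> = qsum q (ones n w) + qsum q (ones N w \<inter> {n<..})"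
      by (rule qsum_Un) (auto simp: ones_def)
    finally show ?thesis .
  qed
  have "qsum q (ones n \<omega>') - qsum q (ones n \<omega>) = int k"
    using kN split[of \<omega>] split[of \<omega>'] agree by simp
  then show "\<exists>J\<in>Pow {1..n}. qsum q J - qsum q (ones n \<omega>) = int k"
    using ones_subset by blast
qed

section \<open>The coin tossing measure\<close>

lemma product_prob_space_coin: "product_prob_space (\<lambda>_::nat. uniform_count_measure {0, 1::nat})"
  by (intro product_prob_spaceI prob_space_uniform_count_measure) auto

lemma prob_space_dyadic: "prob_space dyadic_measure"
  unfolding dyadic_measure_def by (intro prob_space_PiM prob_space_uniform_count_measure) auto

lemma measurable_digit [measurable]: "(\<lambda>\<omega>. \<omega> i) \<in> measurable dyadic_measure (count_space UNIV)"
proof (cases "1 \<le> i")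
  case True
  have "(\<lambda>\<omega>. \<omega> i) \<in> measurable dyadic_measure (uniform_count_measure {0, 1})"
    unfolding dyadic_measure_def by (rule measurable_component_singleton) (use True in simp)
  moreover have "(\<lambda>x. x) \<in> measurable (uniform_count_measure {0, 1::nat}) (count_space UNIV)"
    by (auto simp: measurable_def space_uniform_count_measure sets_uniform_count_measure)
  ultimately show ?thesis
    by (rule measurable_compose)
next
  case False
  have "\<omega> i = undefined" if "\<omega> \<in> space dyadic_measure" for \<omega>
    using that False by (auto simp: space_dyadic PiE_iff extensional_def)
  then show ?thesis
    by (subst measurable_cong[where g = "\<lambda>_. undefined"]) auto
qed

lemma measurable_first_zero [measurable]: "first_zero \<in> measurable dyadic_measure (count_space UNIV)"
  unfolding first_zero_def by measurable

lemma measurable_dyadic_cocycle [measurable]: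
  "dyadic_cocycle q \<in> measurable dyadic_measure (count_space UNIV)"
proof -
  have "(\<lambda>\<omega>. (\<lambda>n. q n - (\<Sum>k\<in>{1..<n}. q k)) (first_zero \<omega>))
      \<in> measurable dyadic_measure (count_space UNIV)"
    by (rule measurable_compose[OF measurable_first_zero]) simp
  moreover have "Measurable.pred dyadic_measure (\<lambda>\<omega>. \<exists>n\<ge>1. \<omega> n = 0)"
    by measurable
  ultimately have "(\<lambda>\<omega>. if \<exists>n\<ge>1. \<omega> n = 0
      then q (first_zero \<omega>) - (\<Sum>k\<in>{1..<first_zero \<omega>}. q k) else 1)
      \<in> measurable dyadic_measure (count_space UNIV)"
    by (intro measurable_If) (simp_all add: pred_def)
  then show ?thesis
    unfolding dyadic_cocycle_def[abs_def] .
qed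

lemma sets_inf_zeros [measurable]: "inf_zeros \<in> sets dyadic_measure"
  unfolding inf_zeros_def by measurable

lemma measurable_into_dyadic:
  assumes "\<And>i. 1 \<le> i \<Longrightarrow> (\<lambda>x. f x i) \<in> measurable M (count_space UNIV)"
    and "\<And>x. x \<in> space M \<Longrightarrow> f x \<in> space dyadic_measure"
  shows "f \<in> measurable M dyadic_measure"
  unfolding dyadic_measure_def
proof (rule measurable_PiM_single')
  show "f \<in> space M \<rightarrow> (\<Pi>\<^sub>E i\<in>{1..}. space (uniform_count_measure {0, 1}))"
    using assms(2) by (auto simp: space_dyadic space_uniform_count_measure)
  fix i :: nat assume i: "i \<in> {1..}"
  have "f x i \<in> {0, 1}" if "x \<in> space M" for x
    using digit_cases[OF assms(2)[OF that], of i] i by auto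
  moreover have "(\<lambda>x. f x i) \<in> measurable M (count_space UNIV)"
    using assms(1) i by simp
  ultimately show "(\<lambda>x. f x i) \<in> measurable M (uniform_count_measure {0, 1})"
    by (auto simp: measurable_def space_uniform_count_measure sets_uniform_count_measure)
qed

lemma odometer_in_space:
  assumes "\<omega> \<in> space dyadic_measure"
  shows "odometer \<omega> \<in> space dyadic_measure"
proof -
  have "1 \<le> first_zero \<omega>" if "\<exists>n\<ge>1. \<omega> n = 0"
    using that unfolding first_zero_def by (rule LeastI2_ex) simp
  then show ?thesis
    using assms unfolding space_dyadic by (auto simp: odometer_def PiE_iff extensional_def)
qed

lemma measurable_odometer [measurable]: "odometer \<in> measurable dyadic_measure dyadic_measure"
proof (rule measurable_into_dyadic[OF _ odometer_in_space])
  fix i :: nat assume i: "1 \<le> i"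
  have "odometer \<omega> i = (if \<exists>n\<ge>1. \<omega> n = 0
      then (if i < first_zero \<omega> then 0 else if i = first_zero \<omega> then 1 else \<omega> i) else 0)" for \<omega>
    using i by (auto simp: odometer_def)
  then show "(\<lambda>\<omega>. odometer \<omega> i) \<in> measurable dyadic_measure (count_space UNIV)"
    by simp
qed

lemma emeasure_dyadic_cylinder:
  assumes "finite J" "J \<subseteq> {1..}" "\<And>i. i \<in> J \<Longrightarrow> c i \<in> {0, 1}"
  shows "emeasure dyadic_measure {\<omega> \<in> space dyadic_measure. \<forall>i\<in>J. \<omega> i = c i} = ennreal ((1 / 2) ^ card J)"
proof -
  interpret product_prob_space "\<lambda>_::nat. uniform_count_measure {0, 1::nat}" "{1..}"
    by (rule product_prob_space_coin)
  have "emeasure dyadic_measure {\<omega> \<in> space dyadic_measure. \<forall>i\<in>J. \<omega> i \<in> {c i}}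
      = (\<Prod>i\<in>J. emeasure (uniform_count_measure {0, 1}) {c i})"
    unfolding dyadic_measure_def
    by (rule emeasure_PiM_Collect) (use assms in \<open>auto simp: sets_uniform_count_measure\<close>)
  also have "\<dots> = (\<Prod>i\<in>J. ennreal (1 / 2))"
    by (intro prod.cong refl, subst emeasure_uniform_count_measure) (use assms in auto)
  also have "\<dots> = ennreal ((1 / 2) ^ card J)"
    unfolding prod_constant by (rule ennreal_power) simp
  finally show ?thesis
    by simp
qed

lemma null_sets_dyadic_tail:
  assumes "\<And>i. c i \<in> {0, 1}"
  shows "{\<omega> \<in> space dyadic_measure. \<forall>i\<ge>N. \<omega> i = c i} \<in> null_sets dyadic_measure"
proof (rule null_setsI)
  let ?A = "{\<omega> \<in> space dyadic_measure. \<forall>i\<ge>N. \<omega> i = c i}"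
  have "emeasure dyadic_measure ?A \<le> ennreal ((1 / 2) ^ k)" for k
  proof -
    \<comment> \<open>N may be 0, which is not a coordinate of the product; hence the start at
      \<open>Suc N\<close>.\<close>
    let ?J = "{Suc N..<Suc N + k}"
    have "emeasure dyadic_measure ?A
        \<le> emeasure dyadic_measure {\<omega> \<in> space dyadic_measure. \<forall>i\<in>?J. \<omega> i = c i}"
      by (rule emeasure_mono) auto
    also have "\<dots> = ennreal ((1 / 2) ^ card ?J)"
      by (rule emeasure_dyadic_cylinder) (use assms in auto)
    finally show ?thesis
      by simp
  qed
  moreover have "(\<lambda>k. ennreal ((1 / 2) ^ k)) \<longlonglongrightarrow> ennreal 0"
    by (intro tendsto_ennrealI LIMSEQ_power_zero) simp
  ultimately have "emeasure dyadic_measure ?A \<le> 0"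
    by (intro LIMSEQ_le_const[of "\<lambda>k. ennreal ((1 / 2) ^ k)"]) auto
  then show "emeasure dyadic_measure ?A = 0"
    by simp
qed measurable

lemma AE_inf_zeros: "AE \<omega> in dyadic_measure. \<omega> \<in> inf_zeros"
proof -
  have "AE \<omega> in dyadic_measure. \<not> (\<forall>i\<ge>N. \<omega> i = 1)" for N
    using null_sets_dyadic_tail[of "\<lambda>_. 1" N] by (auto simp: AE_iff_null)
  then have "AE \<omega> in dyadic_measure. \<forall>N. \<not> (\<forall>i\<ge>Suc N. \<omega> i = 1)"
    by (simp add: AE_all_countable)
  then show ?thesis
  proof (rule AE_mp[OF _ AE_I2], intro impI)
    fix \<omega> assume sp: "\<omega> \<in> space dyadic_measure" and "\<forall>N. \<not> (\<forall>i\<ge>Suc N. \<omega> i = 1)"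
    then have "\<exists>i\<ge>Suc N. \<omega> i = 0" for N
      using digit_cases[OF sp] by (metis Suc_le_D le_add1 le_trans plus_1_eq_Suc)
    then show "\<omega> \<in> inf_zeros"
      using sp by (auto simp: inf_zeros_def dest: Suc_leD)
  qed
qed

section \<open>Invariance of the coin tossing measure under the odometer\<close>

definition flip :: "nat \<Rightarrow> (nat \<Rightarrow> nat) \<Rightarrow> nat \<Rightarrow> nat" where
  "flip n \<omega> = (\<lambda>i. if 1 \<le> i \<and> i \<le> n then 1 - \<omega> i else \<omega> i)"

lemma flip_in_space: "\<omega> \<in> space dyadic_measure \<Longrightarrow> flip n \<omega> \<in> space dyadic_measure"
  by (auto simp: flip_def space_dyadic PiE_iff extensional_def)

lemma measurable_flip [measurable]: "flip n \<in> measurable dyadic_measure dyadic_measure"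
proof (rule measurable_into_dyadic[OF _ flip_in_space])
  fix i :: nat assume "1 \<le> i"
  have "(\<lambda>\<omega>. 1 - \<omega> i) \<in> measurable dyadic_measure (count_space UNIV)"
    by (rule measurable_compose[OF measurable_digit]) simp
  then show "(\<lambda>\<omega>. flip n \<omega> i) \<in> measurable dyadic_measure (count_space UNIV)"
    by (cases "1 \<le> i \<and> i \<le> n") (auto simp: flip_def)
qed

lemma distr_flip: "distr dyadic_measure dyadic_measure (flip n) = dyadic_measure"
proof -
  interpret product_prob_space "\<lambda>_::nat. uniform_count_measure {0, 1::nat}" "{1..}"
    by (rule product_prob_space_coin)
  let ?C = "uniform_count_measure {0, 1::nat}" and ?D = "dyadic_measure"
  have "distr ?D ?D (flip n) = Pi\<^sub>M {1..} (\<lambda>_. ?C)"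
  proof (rule PiM_eq)
    fix J :: "nat set" and F
    assume J: "finite J" "J \<subseteq> {1..}" and F: "\<And>j. j \<in> J \<Longrightarrow> F j \<in> sets ?C"
    \<comment> \<open>On {0, 1} the swap of digits is an involution, so this image is also the
      preimage, and it has as many elements as \<open>F j\<close>.\<close>
    let ?F = "\<lambda>j. if j \<le> n then (\<lambda>x. 1 - x) ` F j else F j"
    let ?E = "prod_emb {1..} (\<lambda>_. ?C) J (Pi\<^sub>E J F)"
    have FS: "F j \<subseteq> {0, 1}" if "j \<in> J" for j
      using F[OF that] by (auto simp: sets_uniform_count_measure)
    have E: "?E \<in> sets ?D"
      unfolding dyadic_measure_def by (rule sets_PiM_I) (use J F in auto)
    have flipF: "1 - w j \<in> F j \<longleftrightarrow> w j \<in> (\<lambda>x. 1 - x) ` F j"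
      if "j \<in> J" "w \<in> space ?D" for j w
    proof
      have "1 \<le> j"
        using J(2) that(1) by auto
      then have w: "1 - (1 - w j) = w j"
        using digit_cases[OF that(2), of j] by auto
      show "w j \<in> (\<lambda>x. 1 - x) ` F j" if "1 - w j \<in> F j"
        using imageI[OF that, of "\<lambda>x. 1 - x"] w by simp
      assume "w j \<in> (\<lambda>x. 1 - x) ` F j"
      then obtain x where x: "x \<in> F j" "w j = 1 - x"
        by blast
      then have "1 - w j = x"
        using FS[OF that(1)] by auto
      then show "1 - w j \<in> F j"
        using x by simp
    qed
    have eq: "flip n -` ?E \<inter> space ?D = {w \<in> space ?D. \<forall>j\<in>J. w j \<in> ?F j}"
    proof (intro set_eqI)
      fix w
      show "w \<in> flip n -` ?E \<inter> space ?D \<longleftrightarrow> w \<in> {w \<in> space ?D. \<forall>j\<in>J. w j \<in> ?F j}"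
      proof (cases "w \<in> space ?D")
        case True
        have "flip n w \<in> ?E \<longleftrightarrow> (\<forall>j\<in>J. flip n w j \<in> F j)"
          using flip_in_space[OF True, of n] by (auto simp: prod_emb_iff PiE_iff space_dyadic
              space_uniform_count_measure)
        also have "\<dots> \<longleftrightarrow> (\<forall>j\<in>J. w j \<in> ?F j)"
          using flipF[OF _ True] J(2) by (intro ball_cong refl) (auto simp: flip_def)
        finally show ?thesis
          using True by simp
      qed simp
    qed
    have "emeasure (distr ?D ?D (flip n)) ?E = emeasure ?D {w \<in> space ?D. \<forall>j\<in>J. w j \<in> ?F j}"
      unfolding eq[symmetric] by (rule emeasure_distr[OF measurable_flip E])
    also have "\<dots> = (\<Prod>j\<in>J. emeasure ?C (?F j))"
      unfolding dyadic_measure_def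
      by (rule emeasure_PiM_Collect) (use J FS in \<open>auto simp: sets_uniform_count_measure\<close>)
    also have "\<dots> = (\<Prod>j\<in>J. emeasure ?C (F j))"
    proof (intro prod.cong refl)
      fix j assume j: "j \<in> J"
      have "inj_on (\<lambda>x. 1 - x) (F j)"
        by (rule inj_on_subset[OF _ FS[OF j]]) (simp add: inj_on_def)
      then have "card (?F j) = card (F j)"
        by (simp add: card_image)
      moreover have "?F j \<subseteq> {0, 1}"
        using FS[OF j] by auto
      ultimately show "emeasure ?C (?F j) = emeasure ?C (F j)"
        using FS[OF j] by (subst (1 2) emeasure_uniform_count_measure) auto
    qed
    finally show "emeasure (distr ?D ?D (flip n)) ?E = (\<Prod>j\<in>J. emeasure ?C (F j))" .
  qed (simp add: dyadic_measure_def)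
  then show ?thesis
    by (simp add: dyadic_measure_def)
qed

text \<open>The image under \<open>flip n\<close> of the points whose first zero is at n. For n from
  1 on these sets partition all points but the all-zeros one.\<close>

definition first_one_at :: "nat \<Rightarrow> (nat \<Rightarrow> nat) set" where
  "first_one_at n = {\<omega> \<in> space dyadic_measure. \<omega> n = 1 \<and> (\<forall>i. 1 \<le> i \<and> i < n \<longrightarrow> \<omega> i = 0)}"

lemma sets_first_one_at [measurable]: "first_one_at n \<in> sets dyadic_measure"
  unfolding first_one_at_def by measurable

lemma odometer_flip:
  assumes "\<omega> \<in> inf_zeros" "first_zero \<omega> = n"
  shows "odometer \<omega> = flip n \<omega>"
  using first_zero[OF assms(1)] assms(2) by (fastforce simp: odometer_eq[OF assms(1)] flip_def)

lemma flip_first_one_at_iff: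
  assumes "\<omega> \<in> inf_zeros" "1 \<le> n"
  shows "flip n \<omega> \<in> first_one_at n \<longleftrightarrow> first_zero \<omega> = n"
proof
  have sp: "\<omega> \<in> space dyadic_measure"
    using assms(1) by (simp add: inf_zeros_def)
  note fz = first_zero[OF assms(1)]
  show "flip n \<omega> \<in> first_one_at n" if "first_zero \<omega> = n"
    using fz that assms(2) flip_in_space[OF sp] by (auto simp: first_one_at_def flip_def)
  assume "flip n \<omega> \<in> first_one_at n"
  then have "1 - \<omega> n = 1" "\<And>i. 1 \<le> i \<Longrightarrow> i < n \<Longrightarrow> 1 - \<omega> i = 0"
    using assms(2) by (auto simp: first_one_at_def flip_def)
  then have "\<omega> n = 0" "\<And>i. 1 \<le> i \<Longrightarrow> i < n \<Longrightarrow> \<omega> i = 1"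
    using digit_cases[OF sp] assms(2) by force+
  then show "first_zero \<omega> = n"
    using fz assms(2) by (metis linorder_neqE_nat zero_neq_one)
qed

text \<open>Where the first zero is at n the odometer is \<open>flip n\<close>, which preserves the
  measure. Up to null sets these pieces partition the domain and their images
  \<open>first_one_at n\<close> partition the range.\<close>

lemma distr_odometer: "distr dyadic_measure dyadic_measure odometer = dyadic_measure"
proof (rule measure_eqI)
  let ?D = dyadic_measure
  show "emeasure (distr ?D ?D odometer) E = emeasure ?D E" if "E \<in> sets (distr ?D ?D odometer)" for E
  proof -
    have E [measurable]: "E \<in> sets ?D"
      using that by simp
    let ?O = "odometer -` E \<inter> space ?D"
    have O: "?O \<in> sets ?D"
      by measurable
    have F [measurable]: "{\<omega> \<in> ?O. first_zero \<omega> = Suc n} \<in> sets ?D" for n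
    proof -
      have "{\<omega> \<in> ?O. first_zero \<omega> = Suc n} = ?O \<inter> {\<omega> \<in> space ?D. first_zero \<omega> = Suc n}"
        by auto
      then show ?thesis
        by simp
    qed
    have "emeasure (distr ?D ?D odometer) E = emeasure ?D ?O"
      by (simp add: emeasure_distr)
    also have "\<dots> = emeasure ?D (\<Union>n. {\<omega> \<in> ?O. first_zero \<omega> = Suc n})"
    proof (rule emeasure_eq_AE)
      show "AE \<omega> in ?D. \<omega> \<in> ?O \<longleftrightarrow> \<omega> \<in> (\<Union>n. {\<omega> \<in> ?O. first_zero \<omega> = Suc n})"
        using AE_inf_zeros
      proof eventually_elim
        case (elim \<omega>)
        then show ?case
          using first_zero(1)[OF elim] Suc_le_D by fastforce
      qed
    qed measurable
    also have "\<dots> = (\<Sum>n. emeasure ?D {\<omega> \<in> ?O. first_zero \<omega> = Suc n})"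
    proof (rule suminf_emeasure[symmetric])
      show "range (\<lambda>n. {\<omega> \<in> ?O. first_zero \<omega> = Suc n}) \<subseteq> sets ?D"
        using F by blast
    qed (auto simp: disjoint_family_on_def)
    also have "\<dots> = (\<Sum>n. emeasure ?D (flip (Suc n) -` (first_one_at (Suc n) \<inter> E) \<inter> space ?D))"
    proof (rule suminf_cong, rule emeasure_eq_AE)
      fix n
      show "AE \<omega> in ?D. \<omega> \<in> {\<omega> \<in> ?O. first_zero \<omega> = Suc n} \<longleftrightarrow>
          \<omega> \<in> flip (Suc n) -` (first_one_at (Suc n) \<inter> E) \<inter> space ?D"
        using AE_inf_zeros
      proof eventually_elim
        case (elim \<omega>)
        then show ?case
          using odometer_flip[OF elim] flip_first_one_at_iff[OF elim, of "Suc n"] by auto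
      qed
    qed measurable
    also have "\<dots> = (\<Sum>n. emeasure ?D (first_one_at (Suc n) \<inter> E))"
    proof (rule suminf_cong)
      fix n
      have "emeasure (distr ?D ?D (flip (Suc n))) (first_one_at (Suc n) \<inter> E)
          = emeasure ?D (flip (Suc n) -` (first_one_at (Suc n) \<inter> E) \<inter> space ?D)"
        by (rule emeasure_distr) measurable
      then show "emeasure ?D (flip (Suc n) -` (first_one_at (Suc n) \<inter> E) \<inter> space ?D)
          = emeasure ?D (first_one_at (Suc n) \<inter> E)"
        by (simp add: distr_flip)
    qed
    also have "\<dots> = emeasure ?D (\<Union>n. first_one_at (Suc n) \<inter> E)"
    proof (rule suminf_emeasure)
      have "\<not> (\<omega> \<in> first_one_at (Suc m) \<and> \<omega> \<in> first_one_at (Suc n))" if "m < n" for \<omega> m n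
        using that by (auto simp: first_one_at_def)
      then show "disjoint_family (\<lambda>n. first_one_at (Suc n) \<inter> E)"
        unfolding disjoint_family_on_def by (metis (no_types, lifting) Int_iff disjoint_iff linorder_neqE_nat)
    qed (auto intro: sets.Int)
    also have "\<dots> = emeasure ?D E"
    proof (rule emeasure_eq_AE)
      have "AE \<omega> in ?D. \<not> (\<forall>i\<ge>1. \<omega> i = 0)"
        using null_sets_dyadic_tail[of "\<lambda>_. 0" 1] by (auto simp: AE_iff_null)
      then show "AE \<omega> in ?D. \<omega> \<in> (\<Union>n. first_one_at (Suc n) \<inter> E) \<longleftrightarrow> \<omega> \<in> E"
      proof (rule AE_mp[OF _ AE_I2], intro impI)
        fix \<omega> assume sp: "\<omega> \<in> space ?D" and nz: "\<not> (\<forall>i\<ge>1. \<omega> i = 0)"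
        define n where "n = (LEAST i. 1 \<le> i \<and> \<omega> i \<noteq> 0)"
        have n: "1 \<le> n \<and> \<omega> n \<noteq> 0"
          unfolding n_def by (rule LeastI_ex) (use nz in auto)
        have "\<omega> i = 0" if "1 \<le> i" "i < n" for i
          using not_less_Least[of i "\<lambda>i. 1 \<le> i \<and> \<omega> i \<noteq> 0"] that by (auto simp: n_def)
        then have "\<omega> \<in> first_one_at (Suc (n - 1))"
          using n digit_cases[OF sp, of n] sp by (auto simp: first_one_at_def)
        then show "\<omega> \<in> (\<Union>n. first_one_at (Suc n) \<inter> E) \<longleftrightarrow> \<omega> \<in> E"
          by blast
      qed
    qed measurable
    finally show ?thesis .
  qed
qed simp

lemma measure_dyadic_ones:
  assumes "I \<in> Pow {1..n}"
  shows "measure dyadic_measure {\<omega> \<in> space dyadic_measure. ones n \<omega> = I} = 1 / 2 ^ n"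
proof -
  let ?c = "\<lambda>i. if i \<in> I then 1 else 0 :: nat"
  have "{\<omega> \<in> space dyadic_measure. ones n \<omega> = I}
      = {\<omega> \<in> space dyadic_measure. \<forall>i\<in>{1..n}. \<omega> i = ?c i}"
    using assms digit_cases by (fastforce simp: ones_def split: if_splits)
  then show ?thesis
    using emeasure_dyadic_cylinder[of "{1..n}" ?c] by (simp add: measure_def power_divide)
qed

lemma sets_ones_eq: "{\<omega> \<in> space dyadic_measure. ones n \<omega> = I} \<in> sets dyadic_measure"
proof -
  have "{\<omega> \<in> space dyadic_measure. ones n \<omega> = I}
     = {\<omega> \<in> space dyadic_measure. I \<subseteq> {1..n} \<and> (\<forall>i\<in>{1..n}. \<omega> i = 1 \<longleftrightarrow> i \<in> I)}"
    by (auto simp: ones_def)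
  then show ?thesis
    by simp
qed

lemma ones_Collect:
  "{\<omega> \<in> space dyadic_measure. Q (ones n \<omega>)}
     = (\<Union>I\<in>{I \<in> Pow {1..n}. Q I}. {\<omega> \<in> space dyadic_measure. ones n \<omega> = I})"
  using ones_subset by blast

lemma sets_ones_Collect: "{\<omega> \<in> space dyadic_measure. Q (ones n \<omega>)} \<in> sets dyadic_measure"
  unfolding ones_Collect by (intro sets.finite_UN sets_ones_eq) auto

lemma measure_dyadic_ones_Collect:
  "measure dyadic_measure {\<omega> \<in> space dyadic_measure. Q (ones n \<omega>)}
     = (\<Sum>I\<in>Pow {1..n}. of_bool (Q I)) / 2 ^ n"
proof -
  interpret prob_space dyadic_measure
    by (rule prob_space_dyadic)
  have "measure dyadic_measure {\<omega> \<in> space dyadic_measure. Q (ones n \<omega>)}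
      = (\<Sum>I\<in>{I \<in> Pow {1..n}. Q I}. measure dyadic_measure {\<omega> \<in> space dyadic_measure. ones n \<omega> = I})"
    unfolding ones_Collect
    by (intro finite_measure_finite_Union) (use sets_ones_eq in \<open>auto simp: disjoint_family_on_def\<close>)
  also have "\<dots> = (\<Sum>I\<in>{I \<in> Pow {1..n}. Q I}. 1 / 2 ^ n)"
    by (intro sum.cong refl) (simp add: measure_dyadic_ones)
  also have "\<dots> = (\<Sum>I\<in>Pow {1..n}. of_bool (Q I)) / 2 ^ n"
    by (simp add: sum.inter_filter[symmetric] of_bool_def sum_divide_distrib if_distrib cong: if_cong)
  finally show ?thesis .
qed

text \<open>The rule matches every function application and would mislead the measurability prover below.\<close>

declare measurable_digit [measurable del]

section \<open>Measure preserving maps and the tower measure\<close>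

definition preserves :: "'a measure \<Rightarrow> ('a \<Rightarrow> 'a) \<Rightarrow> bool" where
  "preserves m R \<longleftrightarrow> R \<in> measurable m m \<and> distr m m R = m"

lemma preserves_measurable: "preserves m R \<Longrightarrow> R \<in> measurable m m"
  by (simp add: preserves_def)

lemma preserves_emeasure:
  assumes "preserves m R" "A \<in> sets m"
  shows "emeasure m (R -` A \<inter> space m) = emeasure m A"
  using emeasure_distr[of R m m A] assms by (simp add: preserves_def)

lemma preserves_funpow:
  assumes "preserves m R"
  shows "preserves m (R ^^ n)"
proof (induction n)
  case 0
  then show ?case
    using distr_id2[of m m] by (simp add: preserves_def id_def)
next
  case (Suc n)
  have "distr m m (R ^^ Suc n) = distr (distr m m (R ^^ n)) m R"
    using Suc assms by (subst distr_distr) (auto simp: preserves_def)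
  then show ?case
    using Suc assms measurable_comp[of "R ^^ n" m m R m] by (simp add: preserves_def comp_def)
qed

lemma sets_preim [measurable (raw)]:
  assumes "preserves m R" "A \<in> sets m"
  shows "preim m R n A \<in> sets m"
  using preserves_measurable[OF preserves_funpow[OF assms(1)]] assms(2)
  unfolding preim_def by (rule measurable_sets)

lemma emeasure_preim:
  assumes "preserves m R" "A \<in> sets m"
  shows "emeasure m (preim m R n A) = emeasure m A"
  unfolding preim_def by (rule preserves_emeasure[OF preserves_funpow[OF assms(1)] assms(2)])

lemma preserves_nn_integral:
  assumes "preserves m R" "f \<in> borel_measurable m"
  shows "(\<integral>\<^sup>+x. f (R x) \<partial>m) = (\<integral>\<^sup>+x. f x \<partial>m)"
  using nn_integral_distr[of R m m f] assms by (simp add: preserves_def)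

lemma preserves_AE:
  assumes "preserves m R" "AE x in m. P x"
  shows "AE x in m. P (R x)"
  using AE_distrD[of R m m P] assms unfolding preserves_def by metis

lemma funpow_map_prod:
  fixes S :: "'a \<Rightarrow> 'a" and T :: "'b \<Rightarrow> 'b"
  shows "map_prod S T ^^ n = map_prod (S ^^ n) (T ^^ n)"
proof (induction n)
  case (Suc n)
  then show ?case
    by (simp add: fun_eq_iff)
qed (simp add: fun_eq_iff)

lemma preserves_map_prod:
  assumes "preserves M S" "preserves N T" "sigma_finite_measure N"
  shows "preserves (M \<Otimes>\<^sub>M N) (map_prod S T)"
proof -
  have [measurable]: "S \<in> measurable M M" "T \<in> measurable N N"
    using assms by (simp_all add: preserves_def)
  have "distr M M S \<Otimes>\<^sub>M distr N N T = distr (M \<Otimes>\<^sub>M N) (M \<Otimes>\<^sub>M N) (\<lambda>(x, y). (S x, T y))"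
    by (rule pair_measure_distr) (use assms in \<open>auto simp: preserves_def\<close>)
  moreover have "map_prod S T = (\<lambda>(x, y). (S x, T y))"
    by (auto simp: fun_eq_iff)
  moreover have "(\<lambda>(x, y). (S x, T y)) \<in> measurable (M \<Otimes>\<^sub>M N) (M \<Otimes>\<^sub>M N)"
    by measurable
  ultimately show ?thesis
    using assms by (simp add: preserves_def)
qed

lemma sets_Collect_le_nat:
  fixes f g :: "'a \<Rightarrow> nat"
  assumes [measurable]: "f \<in> measurable M (count_space UNIV)" "g \<in> measurable M (count_space UNIV)"
  shows "{x \<in> space M. f x \<le> g x} \<in> sets M"
proof -
  have "{x \<in> space M. f x \<le> g x} = {x \<in> space M. \<exists>i. f x = i \<and> (\<exists>j. g x = j \<and> i \<le> j)}"
    by auto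
  also have "\<dots> \<in> sets M"
    by measurable
  finally show ?thesis .
qed

lemma measurable_snd_count_space:
  "snd \<in> measurable (M \<Otimes>\<^sub>M count_space {1::nat..}) (count_space UNIV)"
proof -
  have "(\<lambda>x. x) \<in> measurable (count_space {1::nat..}) (count_space UNIV)"
    by simp
  from measurable_compose[OF measurable_snd this] show ?thesis .
qed

section \<open>The tower as a measure space and its map\<close>

definition tower_region :: "(nat \<Rightarrow> nat) \<Rightarrow> ((nat \<Rightarrow> nat) \<times> nat) set" where
  "tower_region q = {(\<omega>, n). 1 \<le> n \<and> n \<le> dyadic_cocycle q \<omega>}"

lemma tower_measure_eq:
  "tower_measure q = restrict_space (dyadic_measure \<Otimes>\<^sub>M count_space {1..}) (tower_region q)"
  by (simp add: tower_measure_def tower_region_def)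

lemma tower_region_sets:
  "tower_region q \<inter> space (dyadic_measure \<Otimes>\<^sub>M count_space {1..}) \<in> sets (dyadic_measure \<Otimes>\<^sub>M count_space {1..})"
proof -
  have "tower_region q \<inter> space (dyadic_measure \<Otimes>\<^sub>M count_space {1..})
      = {z \<in> space (dyadic_measure \<Otimes>\<^sub>M count_space {1..}). snd z \<le> dyadic_cocycle q (fst z)}"
    by (auto simp: tower_region_def space_pair_measure)
  also have "\<dots> \<in> sets (dyadic_measure \<Otimes>\<^sub>M count_space {1..})"
    by (rule sets_Collect_le_nat[OF measurable_snd_count_space
          measurable_compose[OF measurable_fst measurable_dyadic_cocycle]])
  finally show ?thesis .
qed

lemma space_tower:
  "space (tower_measure q) = {(\<omega>, n). \<omega> \<in> space dyadic_measure \<and> 1 \<le> n \<and> n \<le> dyadic_cocycle q \<omega>}"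
  by (auto simp: tower_measure_eq space_restrict_space space_pair_measure tower_region_def)

lemma measurable_fst_tower [measurable]: "fst \<in> measurable (tower_measure q) dyadic_measure"
  unfolding tower_measure_eq by (rule measurable_restrict_space1) measurable

lemma measurable_snd_tower [measurable]: "snd \<in> measurable (tower_measure q) (count_space UNIV)"
  unfolding tower_measure_eq by (rule measurable_restrict_space1[OF measurable_snd_count_space])

lemma sets_slice:
  assumes "E \<in> sets (tower_measure q)"
  shows "{\<omega> \<in> space dyadic_measure. (\<omega>, Suc n) \<in> E} \<in> sets dyadic_measure"
proof -
  have "E \<in> sets (dyadic_measure \<Otimes>\<^sub>M count_space {1..})"
    using assms unfolding tower_measure_eq
    by (subst (asm) sets_restrict_space_iff[OF tower_region_sets]) simp
  moreover have "(\<lambda>\<omega>. (\<omega>, Suc n)) \<in> measurable dyadic_measure (dyadic_measure \<Otimes>\<^sub>M count_space {1..})"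
    by (intro measurable_Pair) auto
  ultimately have "(\<lambda>\<omega>. (\<omega>, Suc n)) -` E \<inter> space dyadic_measure \<in> sets dyadic_measure"
    by (rule measurable_sets[rotated])
  then show ?thesis
    by (simp add: vimage_def Int_def conj_commute)
qed

lemma emeasure_tower:
  assumes E: "E \<in> sets (tower_measure q)"
  shows "emeasure (tower_measure q) E
    = (\<Sum>n. emeasure dyadic_measure {\<omega> \<in> space dyadic_measure. (\<omega>, Suc n) \<in> E})"
proof -
  let ?M = "dyadic_measure \<Otimes>\<^sub>M count_space {1::nat..}"
  let ?S = "\<lambda>n. {\<omega> \<in> space dyadic_measure. (\<omega>, Suc n) \<in> E}"
  interpret C: sigma_finite_measure "count_space {1::nat..}"
    by (rule sigma_finite_measure_count_space)
  have sp: "E \<subseteq> space (tower_measure q)"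
    by (rule sets.sets_into_space[OF E])
  have "emeasure (tower_measure q) E = emeasure ?M E"
    unfolding tower_measure_eq
    by (rule emeasure_restrict_space[OF tower_region_sets])
       (use sp in \<open>auto simp: space_tower tower_region_def\<close>)
  also have "\<dots> = emeasure ?M (\<Union>n. ?S n \<times> {Suc n})"
  proof (rule arg_cong[where f = "emeasure ?M"])
    show "E = (\<Union>n. ?S n \<times> {Suc n})"
    proof (intro set_eqI iffI)
      fix z assume z: "z \<in> E"
      then obtain \<omega> n where "z = (\<omega>, n)" "\<omega> \<in> space dyadic_measure" "1 \<le> n"
        using sp by (auto simp: space_tower)
      then show "z \<in> (\<Union>n. ?S n \<times> {Suc n})"
        using z by (auto intro!: exI[of _ "n - 1"])
    qed auto
  qed
  also have "emeasure ?M (\<Union>n. ?S n \<times> {Suc n}) = (\<Sum>n. emeasure ?M (?S n \<times> {Suc n}))"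
    by (rule suminf_emeasure[symmetric]) (use sets_slice[OF E] in \<open>auto simp: disjoint_family_on_def\<close>)
  also have "\<dots> = (\<Sum>n. emeasure dyadic_measure (?S n))"
    by (intro suminf_cong, subst C.emeasure_pair_measure_Times)
       (use sets_slice[OF E] in auto)
  finally show ?thesis
    by simp
qed

lemma emeasure_tower_level:
  assumes E: "E \<in> sets (tower_measure q)" and h: "1 \<le> h" "\<And>x. x \<in> E \<Longrightarrow> snd x = h"
  shows "emeasure (tower_measure q) E = emeasure dyadic_measure {\<omega> \<in> space dyadic_measure. (\<omega>, h) \<in> E}"
proof -
  let ?f = "\<lambda>n. emeasure dyadic_measure {\<omega> \<in> space dyadic_measure. (\<omega>, Suc n) \<in> E}"
  have "?f n = 0" if "n \<noteq> h - 1" for n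
  proof -
    have "{\<omega> \<in> space dyadic_measure. (\<omega>, Suc n) \<in> E} = {}"
      using h that by fastforce
    then show ?thesis
      by (simp only: emeasure_empty)
  qed
  then have "(\<Sum>n. ?f n) = (\<Sum>n\<in>{h - 1}. ?f n)"
    by (intro suminf_finite) auto
  then show ?thesis
    using emeasure_tower[OF E] h(1) by simp
qed

lemma dyadic_cocycle_pos:
  assumes "growth_seq q"
  shows "1 \<le> dyadic_cocycle q \<omega>"
proof (cases "\<exists>n\<ge>1. \<omega> n = 0")
  case True
  then have "1 \<le> first_zero \<omega>"
    unfolding first_zero_def by (rule LeastI2_ex) simp
  then have "(\<Sum>k\<in>{1..<first_zero \<omega>}. q k) < q (first_zero \<omega>)"
    using assms by (simp add: growth_seq_def)
  then show ?thesis
    using True by (simp add: dyadic_cocycle_def)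
next
  case False
  then show ?thesis
    by (auto simp: dyadic_cocycle_def)
qed

lemma measurable_tower_map:
  assumes "growth_seq q"
  shows "tower_map q \<in> measurable (tower_measure q) (tower_measure q)"
proof -
  let ?M = "dyadic_measure \<Otimes>\<^sub>M count_space {1::nat..}"
  define c where "c z = dyadic_cocycle q (fst z)" for z :: "(nat \<Rightarrow> nat) \<times> nat"
  define d where "d z = odometer (fst z)" for z :: "(nat \<Rightarrow> nat) \<times> nat"
  define l where "l z = snd z" for z :: "(nat \<Rightarrow> nat) \<times> nat"
  have [measurable]: "c \<in> measurable (tower_measure q) (count_space UNIV)"
      "d \<in> measurable (tower_measure q) dyadic_measure"
      "l \<in> measurable (tower_measure q) (count_space UNIV)"
    unfolding c_def d_def l_def
    using measurable_compose[OF measurable_fst_tower measurable_dyadic_cocycle]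
      measurable_compose[OF measurable_fst_tower measurable_odometer] measurable_snd_tower by auto
  have pred [measurable]: "Measurable.pred (tower_measure q) (\<lambda>z. l z + 1 \<le> c z)"
    unfolding pred_def by (rule sets_Collect_le_nat) measurable
  have "(\<lambda>z. if l z + 1 \<le> c z then fst z else d z) \<in> measurable (tower_measure q) dyadic_measure"
    by (intro measurable_If) (use pred in \<open>simp_all add: pred_def\<close>)
  moreover have "(\<lambda>z. if l z + 1 \<le> c z then l z + 1 else 1)
      \<in> measurable (tower_measure q) (count_space {1..})"
  proof (rule measurable_count_space_eq2_countable[THEN iffD2], intro conjI ballI)
    show "(\<lambda>z. if l z + 1 \<le> c z then l z + 1 else 1)
       -` {a} \<inter> space (tower_measure q) \<in> sets (tower_measure q)" for a
    proof -
      have "(\<lambda>z. if l z + 1 \<le> c z then l z + 1 else 1) -` {a} \<inter> space (tower_measure q)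
        = {z \<in> space (tower_measure q). (if l z + 1 \<le> c z then l z + 1 else 1) = a}"
        by auto
      also have "\<dots> \<in> sets (tower_measure q)"
        by measurable
      finally show ?thesis .
    qed
  qed auto
  ultimately have "(\<lambda>z. (if l z + 1 \<le> c z then fst z else d z,
      if l z + 1 \<le> c z then l z + 1 else 1)) \<in> measurable (tower_measure q) ?M"
    by (rule measurable_Pair)
  moreover have "(\<lambda>z. (if l z + 1 \<le> c z then fst z else d z,
      if l z + 1 \<le> c z then l z + 1 else 1)) = tower_map q"
    by (auto simp: tower_map_def fun_eq_iff c_def d_def l_def)
  ultimately have "tower_map q \<in> measurable (tower_measure q) ?M"
    by simp
  moreover have "tower_map q \<in> space (tower_measure q) \<rightarrow> tower_region q"
    using dyadic_cocycle_pos[OF assms] by (auto simp: tower_map_def tower_region_def space_tower split: if_splits)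
  ultimately show ?thesis
    by (subst (2) tower_measure_eq) (rule measurable_restrict_space2[rotated])
qed

text \<open>Each level of the preimage consists of the points that climb into \<open>E\<close> and
  of the roof points that drop into the base of \<open>E\<close>. The climbing parts account for all
  levels of \<open>E\<close> but the first. The roof parts of all levels together form the odometer
  preimage of the first level.\<close>

lemma preserves_tower_map:
  assumes gr: "growth_seq q"
  shows "preserves (tower_measure q) (tower_map q)"
  unfolding preserves_def
proof (intro conjI measurable_tower_map[OF gr] measure_eqI)
  let ?D = dyadic_measure and ?X = "tower_measure q" and ?T = "tower_map q"
  show "emeasure (distr ?X ?X ?T) E = emeasure ?X E" if "E \<in> sets (distr ?X ?X ?T)" for E
  proof -
    have E: "E \<in> sets ?X"
      using that by simp
    have TE: "?T -` E \<inter> space ?X \<in> sets ?X"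
      by (rule measurable_sets[OF measurable_tower_map[OF gr] E])
    define e where "e n = {\<omega> \<in> space ?D. (\<omega>, Suc n) \<in> E}" for n
    define b where "b n = {\<omega> \<in> space ?D. dyadic_cocycle q \<omega> = Suc n \<and> odometer \<omega> \<in> e 0}" for n
    have e [measurable]: "e n \<in> sets ?D" for n
      unfolding e_def by (rule sets_slice[OF E])
    have b: "b n \<in> sets ?D" for n
      unfolding b_def by measurable
    have slice: "{\<omega> \<in> space ?D. (\<omega>, Suc n) \<in> ?T -` E \<inter> space ?X} = e (Suc n) \<union> b n" for n
    proof (intro set_eqI)
      fix \<omega>
      have "(\<omega>, Suc (Suc n)) \<in> E \<Longrightarrow> Suc (Suc n) \<le> dyadic_cocycle q \<omega>"
        using sets.sets_into_space[OF E] by (auto simp: space_tower)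
      then show "\<omega> \<in> {\<omega> \<in> space ?D. (\<omega>, Suc n) \<in> ?T -` E \<inter> space ?X} \<longleftrightarrow> \<omega> \<in> e (Suc n) \<union> b n"
        using odometer_in_space[of \<omega>] by (auto simp: e_def b_def tower_map_def space_tower)
    qed
    have disj: "e (Suc n) \<inter> b n = {}" for n
      using sets.sets_into_space[OF E] by (auto simp: e_def b_def space_tower)
    have "emeasure (distr ?X ?X ?T) E = emeasure ?X (?T -` E \<inter> space ?X)"
      by (rule emeasure_distr[OF measurable_tower_map[OF gr] E])
    also have "\<dots> = (\<Sum>n. emeasure ?D (e (Suc n) \<union> b n))"
      by (simp only: emeasure_tower[OF TE] slice)
    also have "\<dots> = (\<Sum>n. emeasure ?D (e (Suc n)) + emeasure ?D (b n))"
      by (intro suminf_cong plus_emeasure[symmetric] e b disj)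
    also have "\<dots> = (\<Sum>n. emeasure ?D (e (Suc n))) + (\<Sum>n. emeasure ?D (b n))"
      by (rule suminf_add[symmetric]) auto
    also have "(\<Sum>n. emeasure ?D (b n)) = emeasure ?D (\<Union>n. b n)"
      by (rule suminf_emeasure) (use b in \<open>auto simp: disjoint_family_on_def b_def\<close>)
    also have "(\<Union>n. b n) = odometer -` e 0 \<inter> space ?D"
    proof (intro set_eqI)
      fix \<omega>
      obtain m where "dyadic_cocycle q \<omega> = Suc m"
        using dyadic_cocycle_pos[OF gr, of \<omega>] by (cases "dyadic_cocycle q \<omega>") auto
      then show "\<omega> \<in> (\<Union>n. b n) \<longleftrightarrow> \<omega> \<in> odometer -` e 0 \<inter> space ?D"
        by (auto simp: b_def)
    qed
    also have "emeasure ?D (odometer -` e 0 \<inter> space ?D) = emeasure ?D (e 0)"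
      using emeasure_distr[of odometer ?D ?D "e 0"] by (simp add: distr_odometer)
    also have "(\<Sum>n. emeasure ?D (e (Suc n))) + emeasure ?D (e 0) = (\<Sum>n. emeasure ?D (e n))"
      using suminf_offset[of "\<lambda>n. emeasure ?D (e n)" 1] by simp
    also have "\<dots> = emeasure ?X E"
      by (simp only: emeasure_tower[OF E] e_def)
    finally show ?thesis .
  qed
qed simp

section \<open>Levels of the tower\<close>

definition tower_level :: "(nat \<Rightarrow> nat) \<Rightarrow> nat \<Rightarrow> ((nat \<Rightarrow> nat) \<times> nat) set" where
  "tower_level q h = {x \<in> space (tower_measure q). snd x = h}"

lemma sets_tower_level [measurable]: "tower_level q h \<in> sets (tower_measure q)"
  unfolding tower_level_def by measurable

text \<open>Every column has height at least 1, so the base is a copy of the whole coin tossing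
  space.\<close>

lemma emeasure_tower_base_Collect:
  assumes "growth_seq q" "{\<omega> \<in> space dyadic_measure. Q \<omega>} \<in> sets dyadic_measure"
  shows "{x \<in> tower_level q 1. Q (fst x)} \<in> sets (tower_measure q)"
    "emeasure (tower_measure q) {x \<in> tower_level q 1. Q (fst x)}
      = emeasure dyadic_measure {\<omega> \<in> space dyadic_measure. Q \<omega>}"
proof -
  have "{x \<in> tower_level q 1. Q (fst x)}
      = tower_level q 1 \<inter> (fst -` {\<omega> \<in> space dyadic_measure. Q \<omega>} \<inter> space (tower_measure q))"
    by (auto simp: tower_level_def space_tower)
  also have "\<dots> \<in> sets (tower_measure q)"
    using measurable_sets[OF measurable_fst_tower assms(2)] by auto
  finally show s: "{x \<in> tower_level q 1. Q (fst x)} \<in> sets (tower_measure q)" .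
  have "{\<omega> \<in> space dyadic_measure. (\<omega>, 1) \<in> {x \<in> tower_level q 1. Q (fst x)}}
      = {\<omega> \<in> space dyadic_measure. Q \<omega>}"
    using dyadic_cocycle_pos[OF assms(1)] by (auto simp: tower_level_def space_tower)
  then show "emeasure (tower_measure q) {x \<in> tower_level q 1. Q (fst x)}
      = emeasure dyadic_measure {\<omega> \<in> space dyadic_measure. Q \<omega>}"
    using emeasure_tower_level[OF s, of 1] by (simp add: tower_level_def)
qed

lemma emeasure_tower_level_le:
  assumes "1 \<le> h"
  shows "emeasure (tower_measure q) (tower_level q h) \<le> 1"
proof -
  interpret D: prob_space dyadic_measure
    by (rule prob_space_dyadic)
  show ?thesis
    using emeasure_tower_level[OF sets_tower_level assms] D.measure_le_1 by (simp add: tower_level_def)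
qed

lemma sigma_finite_tower: "sigma_finite_measure (tower_measure q)"
proof
  have "emeasure (tower_measure q) (tower_level q (Suc n)) \<noteq> \<infinity>" for n
    using emeasure_tower_level_le[of "Suc n" q] by (auto simp: top_unique)
  moreover have "(\<Union>n. tower_level q (Suc n)) = space (tower_measure q)"
  proof (intro set_eqI iffI)
    fix x assume "x \<in> space (tower_measure q)"
    then show "x \<in> (\<Union>n. tower_level q (Suc n))"
      by (auto simp: tower_level_def space_tower intro!: exI[of _ "snd x - 1"])
  qed (auto simp: tower_level_def)
  ultimately show "\<exists>A. countable A \<and> A \<subseteq> sets (tower_measure q) \<and>
      \<Union>A = space (tower_measure q) \<and> (\<forall>a\<in>A. emeasure (tower_measure q) a \<noteq> \<infinity>)"
    by (intro exI[of _ "range (\<lambda>n. tower_level q (Suc n))"]) auto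
qed

text \<open>Each of the countably many levels is a copy of a part of the coin tossing space.\<close>

lemma AE_tower_fst:
  assumes "AE \<omega> in dyadic_measure. Q \<omega>"
  shows "AE x in tower_measure q. Q (fst x)"
proof -
  from assms obtain N where N: "{\<omega> \<in> space dyadic_measure. \<not> Q \<omega>} \<subseteq> N" "N \<in> null_sets dyadic_measure"
    by (auto simp: eventually_ae_filter)
  let ?E = "fst -` N \<inter> space (tower_measure q)"
  have E: "?E \<in> sets (tower_measure q)"
    by (rule measurable_sets[OF measurable_fst_tower]) (use N in auto)
  have "emeasure dyadic_measure {\<omega> \<in> space dyadic_measure. (\<omega>, Suc n) \<in> ?E} = 0" for n
  proof -
    have "{\<omega> \<in> space dyadic_measure. (\<omega>, Suc n) \<in> ?E} \<subseteq> N"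
      by auto
    then have "emeasure dyadic_measure {\<omega> \<in> space dyadic_measure. (\<omega>, Suc n) \<in> ?E} \<le> emeasure dyadic_measure N"
      by (rule emeasure_mono) (use N(2) in auto)
    then show ?thesis
      using N(2) by (simp add: null_setsD1)
  qed
  then have "?E \<in> null_sets (tower_measure q)"
    using emeasure_tower[OF E] E by (auto simp: null_sets_def)
  then show ?thesis
    by (rule AE_I') (use N in \<open>auto simp: space_tower\<close>)
qed

section \<open>Failure of rational weak mixing\<close>

lemma AE_pair_snd:
  assumes "sigma_finite_measure N" "AE y in N. P y"
  shows "AE z in M \<Otimes>\<^sub>M N. P (snd z)"
proof -
  obtain B where B: "{y \<in> space N. \<not> P y} \<subseteq> B" "B \<in> null_sets N"
    using assms(2) by (auto simp: eventually_ae_filter)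
  have "emeasure (M \<Otimes>\<^sub>M N) (space M \<times> B) = 0"
    using B(2) by (subst sigma_finite_measure.emeasure_pair_measure_Times[OF assms(1)]) auto
  then have "space M \<times> B \<in> null_sets (M \<Otimes>\<^sub>M N)"
    using B(2) by (auto simp: null_sets_def)
  then show ?thesis
    by (rule AE_I') (use B(1) in \<open>auto simp: space_pair_measure\<close>)
qed

lemma AE_pair_fst:
  assumes "sigma_finite_measure N" "AE x in M. P x"
  shows "AE z in M \<Otimes>\<^sub>M N. P (fst z)"
proof -
  obtain B where B: "{x \<in> space M. \<not> P x} \<subseteq> B" "B \<in> null_sets M"
    using assms(2) by (auto simp: eventually_ae_filter)
  have "emeasure (M \<Otimes>\<^sub>M N) (B \<times> space N) = 0"
    using B(2) by (subst sigma_finite_measure.emeasure_pair_measure_Times[OF assms(1)]) auto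
  then have "B \<times> space N \<in> null_sets (M \<Otimes>\<^sub>M N)"
    using B(2) by (auto simp: null_sets_def)
  then show ?thesis
    by (rule AE_I') (use B(1) in \<open>auto simp: space_pair_measure\<close>)
qed

text \<open>Without this, inequalities would not survive a limit along \<open>K\<close>.\<close>

lemma sequentially_along_nontrivial:
  assumes "infinite K"
  shows "inf sequentially (principal K) \<noteq> bot"
proof
  assume "inf sequentially (principal K) = bot"
  then have "eventually (\<lambda>_. False) (inf sequentially (principal K))"
    by simp
  then obtain N where "\<And>n. n \<ge> N \<Longrightarrow> n \<notin> K"
    by (auto simp: eventually_inf_principal eventually_sequentially)
  then have "K \<subseteq> {..<N}"
    by (meson lessThan_iff not_le subsetI)
  then show False
    using assms finite_subset by blast
qed

lemma not_subsequence_rationally_weakly_mixing: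
  assumes sg: "super_growth_seq q" and S: "preserves \<nu> S" and "sigma_finite_measure \<nu>"
  shows "\<not> subsequence_rationally_weakly_mixing (\<nu> \<Otimes>\<^sub>M tower_measure q) (map_prod S (tower_map q))"
proof
  let ?X = "tower_measure q"
  define M where "M = \<nu> \<Otimes>\<^sub>M ?X"
  define R where "R = map_prod S (tower_map q)"
  have gr: "growth_seq q"
    using sg by (simp add: super_growth_seq_def)
  interpret \<nu>: sigma_finite_measure \<nu> by fact
  interpret X: sigma_finite_measure ?X by (rule sigma_finite_tower)
  have R: "preserves M R"
    unfolding M_def R_def by (rule preserves_map_prod[OF S preserves_tower_map[OF gr] sigma_finite_tower])
  have [measurable]: "snd \<in> measurable M ?X"
    unfolding M_def by measurable
  assume "subsequence_rationally_weakly_mixing (\<nu> \<Otimes>\<^sub>M tower_measure q) (map_prod S (tower_map q))"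
  then have "subsequence_rationally_weakly_mixing M R"
    by (simp add: M_def R_def)
  then obtain K where K: "infinite K" and "rationally_weakly_mixing_along K M R"
    unfolding subsequence_rationally_weakly_mixing_def by (elim exE conjE)
  then obtain F where F: "F \<in> fin_pos_sets M" and
    all: "\<forall>A\<in>sets M. \<forall>B\<in>sets M. A \<subseteq> F \<longrightarrow> B \<subseteq> F \<longrightarrow>
        ((\<lambda>n. (\<Sum>k<n. \<bar>measure M (A \<inter> preim M R k B)
                        - measure M A * measure M B * return_seq M R F k\<bar>)
               / (\<Sum>k<n. return_seq M R F k)) \<longlongrightarrow> 0) (inf sequentially (principal K))"
    unfolding rationally_weakly_mixing_along_def by (elim bexE)
  note conv = all[rule_format]
  have F' [measurable]: "F \<in> sets M" and Fpos: "0 < emeasure M F" and Ffin: "emeasure M F < \<infinity>"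
    using F by (auto simp: fin_pos_sets_def)
  have good: "AE z in M. fst (snd z) \<in> inf_zeros"
    unfolding M_def using AE_pair_snd[OF sigma_finite_tower AE_tower_fst[OF AE_inf_zeros]] .
  have measd [measurable]: "(\<lambda>z. fst (snd z)) \<in> measurable M dyadic_measure"
    by (rule measurable_compose[OF _ measurable_fst_tower]) measurable
  have measl [measurable]: "(\<lambda>z. snd (snd z)) \<in> measurable M (count_space UNIV)"
    by (rule measurable_compose[OF _ measurable_snd_tower]) measurable
  have measi [measurable]: "(\<lambda>z. fst (snd z) s) \<in> measurable M (count_space UNIV)" for s
    by (rule measurable_compose[OF measd measurable_digit])
  \<comment> \<open>Within a single level the heights cancel in the orbit formula, so a time is a
    pure digit displacement.\<close>
  define C where "C h = {z \<in> space M. z \<in> F \<and> snd (snd z) = h \<and> fst (snd z) \<in> inf_zeros}" for h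
  have C [measurable]: "C h \<in> sets M" for h
    unfolding C_def by measurable
  have Csp: "z \<in> C h \<Longrightarrow> snd z \<in> space ?X" for z h
    using measurable_space[of snd M ?X] by (auto simp: C_def)
  have "\<exists>h. emeasure M (C h) \<noteq> 0"
  proof (rule ccontr)
    assume "\<not> ?thesis"
    then have "AE z in M. z \<notin> C h" for h
      by (intro AE_not_in) (auto simp: null_sets_def)
    then have "AE z in M. \<forall>h. z \<notin> C h"
      by (simp add: AE_all_countable)
    with good have "AE z in M. z \<notin> F"
      using AE_space by eventually_elim (auto simp: C_def)
    then have "emeasure M F = 0"
      by (subst emeasure_eq_AE[where B = "{}"]) auto
    then show False
      using Fpos by simp
  qed
  then obtain h where h: "emeasure M (C h) \<noteq> 0" ..
  have "C h \<noteq> {}"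
    using h by auto
  then have h1: "1 \<le> h"
    using Csp by (fastforce simp: C_def space_tower)
  define D where "D s a = {z \<in> space M. z \<in> C h \<and> fst (snd z) s = a}" for s a
  have D [measurable]: "D s a \<in> sets M" for s a
    unfolding D_def by measurable
  have "\<exists>s\<ge>1. emeasure M (D s 0) \<noteq> 0 \<and> emeasure M (D s 1) \<noteq> 0"
  proof (rule ccontr)
    assume "\<not> ?thesis"
    then have "\<exists>b\<in>{0, 1}. 1 \<le> s \<longrightarrow> emeasure M (D s (1 - b)) = 0" for s
      by force
    \<comment> \<open>\<open>b s\<close> is the digit that almost all points of \<open>C h\<close>
      have at s. If it exists for every s, then \<open>C h\<close> lies over a single digit sequence
      up to a null set.\<close>
    then obtain b where b: "\<And>s. b s \<in> {0, 1}" "\<And>s. 1 \<le> s \<Longrightarrow> emeasure M (D s (1 - b s)) = 0"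
      by metis
    have "AE z in M. 1 \<le> s \<longrightarrow> z \<notin> D s (1 - b s)" for s
      using b(2)[of s] D by (cases "1 \<le> s") (auto intro!: AE_not_in simp: null_sets_def)
    then have "AE z in M. \<forall>s. 1 \<le> s \<longrightarrow> z \<notin> D s (1 - b s)"
      by (simp add: AE_all_countable)
    moreover have "AE z in M. \<not> (\<forall>s\<ge>1. fst (snd z) s = b s)"
    proof -
      have "AE \<omega> in dyadic_measure. \<not> (\<forall>s\<ge>1. \<omega> s = b s)"
        by (rule AE_I'[OF null_sets_dyadic_tail[of b 1]]) (use b(1) in simp_all)
      from AE_pair_snd[OF sigma_finite_tower AE_tower_fst[OF this]] show ?thesis
        unfolding M_def .
    qed
    ultimately have "AE z in M. z \<notin> C h"
      using AE_space
    proof eventually_elim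
      case (elim z)
      show ?case
      proof
        assume z: "z \<in> C h"
        then have sp: "fst (snd z) \<in> space dyadic_measure"
          by (simp add: C_def inf_zeros_def)
        have "fst (snd z) s = b s" if "s \<ge> 1" for s
        proof -
          have "fst (snd z) s \<noteq> 1 - b s"
            using elim(1) that z elim(3) by (simp add: D_def)
          then show ?thesis
            using digit_cases[OF sp that] b(1)[of s] by auto
        qed
        then show False
          using elim(2) by blast
      qed
    qed
    then have "emeasure M (C h) = 0"
      by (subst emeasure_eq_AE[where B = "{}"]) auto
    then show False
      using h by simp
  qed
  then obtain s where s: "1 \<le> s" and pos: "emeasure M (D s 0) \<noteq> 0" "emeasure M (D s 1) \<noteq> 0"
    by blast
  have sub: "D s a \<subseteq> F" for a
    by (auto simp: D_def C_def)
  have mpos: "0 < measure M (D s a)" if "a \<in> {0, 1}" for a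
  proof -
    have "emeasure M (D s a) < \<infinity>"
      using emeasure_mono[OF sub[of a] F'] Ffin by (rule le_less_trans)
    moreover have "0 < emeasure M (D s a)"
      using that pos by (auto simp: zero_less_iff_neq_zero)
    ultimately show ?thesis
      by (simp add: measure_def enn2real_positive_iff)
  qed
  have hit: "\<exists>\<omega> \<omega>'. \<omega> \<in> inf_zeros \<and> h \<le> dyadic_cocycle q \<omega> \<and>
      (tower_map q ^^ k) (\<omega>, h) = (\<omega>', h) \<and> \<omega> s = a \<and> \<omega>' s = a'"
    if z: "z \<in> D s a \<inter> preim M R k (D s a')" for z k a a'
  proof -
    have "(R ^^ k) z \<in> D s a'"
      using z by (simp add: preim_def)
    moreover have "snd ((R ^^ k) z) = (tower_map q ^^ k) (snd z)"
      unfolding R_def funpow_map_prod by (simp add: snd_map_prod)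
    moreover obtain \<omega> l where \<omega>: "snd z = (\<omega>, l)"
      by (cases "snd z")
    moreover obtain \<omega>' l' where \<omega>': "(tower_map q ^^ k) (\<omega>, l) = (\<omega>', l')"
      by (cases "(tower_map q ^^ k) (\<omega>, l)")
    ultimately have "l' = h" "\<omega>' s = a'"
      by (auto simp: D_def C_def)
    moreover have "l = h" "\<omega> \<in> inf_zeros" "\<omega> s = a" "h \<le> dyadic_cocycle q \<omega>"
      using z Csp[of z h] \<omega> by (auto simp: D_def C_def space_tower)
    ultimately show ?thesis
      using \<omega>' by blast
  qed
  have empty: "D s 0 \<inter> preim M R k (D s 1) = {} \<or> D s 1 \<inter> preim M R k (D s 0) = {}" for k
  proof (rule ccontr)
    assume "\<not> ?thesis"
    then obtain z z' where "z \<in> D s 0 \<inter> preim M R k (D s 1)" "z' \<in> D s 1 \<inter> preim M R k (D s 0)"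
      by blast
    from hit[OF this(1)] hit[OF this(2)] show False
      using tower_orbit_digit[OF sg s h1] by blast
  qed
  let ?r = "return_seq M R F" and ?d = "measure M (D s 0) * measure M (D s 1)"
  let ?f = "\<lambda>a b k. \<bar>measure M (D s a \<inter> preim M R k (D s b)) - measure M (D s a) * measure M (D s b) * ?r k\<bar>"
  let ?q = "\<lambda>a b n. (\<Sum>k<n. ?f a b k) / (\<Sum>k<n. ?r k)"
  have r0: "0 \<le> ?r k" for k
    by (simp add: return_seq_def)
  \<comment> \<open>One of the two intersections is empty; the summand belonging to it equals the
    left side.\<close>
  have "?d * ?r k \<le> ?f 0 1 k + ?f 1 0 k" for k
    using empty[of k] r0[of k] by (auto simp: mult.commute)
  then have sum: "?d * (\<Sum>k<n. ?r k) \<le> (\<Sum>k<n. ?f 0 1 k) + (\<Sum>k<n. ?f 1 0 k)" for n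
    unfolding sum_distrib_left sum.distrib[symmetric] by (rule sum_mono)
  have rpos: "0 < (\<Sum>k<n. ?r k)" if "n \<ge> 1" for n
  proof -
    have "measure M F > 0"
      using Fpos Ffin by (simp add: measure_def enn2real_positive_iff)
    then have "0 < ?r 0"
      using sets.sets_into_space[OF F'] by (simp add: return_seq_def preim_def Int_absorb2)
    also have "\<dots> \<le> (\<Sum>k<n. ?r k)"
      by (rule member_le_sum) (use that r0 in auto)
    finally show ?thesis .
  qed
  have "((\<lambda>n. ?q 0 1 n + ?q 1 0 n) \<longlongrightarrow> 0 + 0) (inf sequentially (principal K))"
    by (intro tendsto_add conv sub D)
  moreover have "eventually (\<lambda>n. ?d \<le> ?q 0 1 n + ?q 1 0 n) (inf sequentially (principal K))"
  proof -
    have "eventually (\<lambda>n. ?d \<le> ?q 0 1 n + ?q 1 0 n) sequentially"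
      using eventually_ge_at_top[of 1]
    proof eventually_elim
      case (elim n)
      then show ?case
        using rpos[of n] sum[of n] by (simp add: add_divide_distrib[symmetric] pos_le_divide_eq)
    qed
    then show ?thesis
      by (rule filter_leD[rotated]) simp
  qed
  ultimately have "?d \<le> 0 + 0"
    by (rule tendsto_lowerbound) (rule sequentially_along_nontrivial[OF K])
  then show False
    using mult_pos_pos[OF mpos[of 0] mpos[of 1]] by simp
qed

section \<open>The stationary Markov measure\<close>

definition paths :: "(int \<Rightarrow> nat) measure" where
  "paths = PiM (UNIV :: int set) (\<lambda>_. count_space {1::nat..})"

definition zshift :: "int \<Rightarrow> (int \<Rightarrow> nat) \<Rightarrow> int \<Rightarrow> nat" where
  "zshift k y = (\<lambda>i. y (i + k))"

definition window :: "int \<Rightarrow> int \<Rightarrow> (int \<Rightarrow> nat) \<Rightarrow> (int \<Rightarrow> nat) set" where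
  "window a b s = {y \<in> space paths. \<forall>i\<in>{a..b}. y i = s i}"

text \<open>The filler for negative times is a legal state, so the result is again a path. Functions
  of the coordinates from 0 on are those unchanged under composition with this map, which avoids a
  sub-sigma-algebra.\<close>

definition future :: "(int \<Rightarrow> nat) \<Rightarrow> int \<Rightarrow> nat" where
  "future y = (\<lambda>i. if i < 0 then 1 else y i)"

lemma space_paths: "space paths = {y. \<forall>i. 1 \<le> y i}"
  by (auto simp: paths_def space_PiM PiE_iff)

lemma path_shift_funpow: "path_shift ^^ n = zshift (int n)"
proof (induction n)
  case (Suc n)
  then show ?case
    by (auto simp: path_shift_def zshift_def fun_eq_iff algebra_simps)
qed (simp add: zshift_def fun_eq_iff)

lemma path_shift_eq: "path_shift = zshift 1"
  by (simp add: path_shift_def zshift_def fun_eq_iff)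

lemma zshift_zshift: "zshift k (zshift l y) = zshift (k + l) y"
  by (simp add: zshift_def algebra_simps)

lemma zshift_in_paths [simp]: "zshift k y \<in> space paths \<longleftrightarrow> y \<in> space paths"
proof
  assume "zshift k y \<in> space paths"
  then show "y \<in> space paths"
    unfolding space_paths zshift_def by (simp, metis diff_add_cancel)
qed (simp add: space_paths zshift_def)

lemma measurable_coordinate: "(\<lambda>y. y i) \<in> measurable paths (count_space UNIV)"
proof -
  have "(\<lambda>y. y i) \<in> measurable paths (count_space {1..})"
    unfolding paths_def by (rule measurable_component_singleton) simp
  from measurable_compose[OF this, of "\<lambda>x. x" "count_space UNIV"] show ?thesis
    by simp
qed

lemma measurable_into_paths:
  assumes "\<And>i. (\<lambda>x. f x i) \<in> measurable M (count_space UNIV)"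
    and "\<And>x. x \<in> space M \<Longrightarrow> f x \<in> space paths"
  shows "f \<in> measurable M paths"
  unfolding paths_def
proof (rule measurable_PiM_single')
  show "f \<in> space M \<rightarrow> (\<Pi>\<^sub>E i\<in>UNIV. space (count_space {1..}))"
    using assms(2) by (auto simp: space_paths PiE_iff)
  fix i :: int
  have "f x i \<in> {1..}" if "x \<in> space M" for x
    using assms(2)[OF that] by (auto simp: space_paths)
  moreover have "(\<lambda>x. f x i) -` A \<inter> space M \<in> sets M" for A
    using measurable_sets[OF assms(1)[of i], of A] by simp
  ultimately show "(\<lambda>x. f x i) \<in> measurable M (count_space {1..})"
    by (auto intro!: measurableI)
qed

lemma measurable_zshift: "zshift k \<in> measurable paths paths"
proof (rule measurable_into_paths)
  show "(\<lambda>y. zshift k y i) \<in> measurable paths (count_space UNIV)" for i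
    using measurable_coordinate[of "i + k"] by (simp add: zshift_def)
qed simp

lemma measurable_future: "future \<in> measurable paths paths"
proof (rule measurable_into_paths)
  show "(\<lambda>y. future y i) \<in> measurable paths (count_space UNIV)" for i
    using measurable_coordinate[of i] by (cases "i < 0") (simp_all add: future_def)
qed (simp add: space_paths future_def)

lemma sets_coordinate: "{y \<in> space paths. P (y i)} \<in> sets paths"
  using measurable_sets[OF measurable_coordinate[of i], of "{x. P x}"]
  by (simp add: vimage_def Int_def conj_commute)

lemma sets_window: "window a b s \<in> sets paths"
proof -
  have "window a b s = {y \<in> space paths. \<forall>i\<in>{a..b}. y i = s i}"
    by (simp add: window_def)
  also have "\<dots> \<in> sets paths"
    by (rule sets.sets_Collect_finite_All) (use sets_coordinate[of "\<lambda>x. x = _"] in auto)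
  finally show ?thesis .
qed

text \<open>There are countably many words on a finite interval, each stored as a list indexed from
  \<open>a\<close>. This turns statements about all windows into countable ones.\<close>

lemma countable_windows:
  obtains W :: "nat \<Rightarrow> int \<Rightarrow> nat" where "\<And>y :: int \<Rightarrow> nat. \<exists>n. \<forall>i\<in>{a..b}. y i = W n i"
proof
  let ?f = "\<lambda>xs :: nat list. \<lambda>i. xs ! nat (i - a)"
  fix y :: "int \<Rightarrow> nat"
  let ?xs = "map (\<lambda>j. y (a + int j)) [0..<Suc (nat (b - a))]"
  have *: "y i = ?f ?xs i" if "i \<in> {a..b}" for i
  proof -
    have "nat (i - a) < Suc (nat (b - a))"
      using that by auto
    then show ?thesis
      using that by (auto simp del: upt_Suc)
  qed
  show "\<exists>n. \<forall>i\<in>{a..b}. y i = (?f \<circ> from_nat) n i"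
    by (intro exI[of _ "to_nat ?xs"] ballI) (use * in \<open>simp del: upt_Suc\<close>)
qed

lemma sets_paths_eq: "sets paths = sigma_sets (space paths) {window (- int n) (int n) s | n s. True}"
proof
  let ?E = "{window (- int n) (int n) s | n s. True}"
  interpret E: sigma_algebra "space paths" "sigma_sets (space paths) ?E"
    by (rule sigma_algebra_sigma_sets) (auto simp: window_def)
  show "sigma_sets (space paths) ?E \<subseteq> sets paths"
    by (rule sets.sigma_sets_subset) (use sets_window in auto)
  have "{y \<in> space paths. y i \<in> A} \<in> sigma_sets (space paths) ?E" for i A
  proof -
    define n where "n = nat \<bar>i\<bar>"
    have i: "i \<in> {- int n..int n}"
      by (auto simp: n_def)
    obtain W :: "nat \<Rightarrow> int \<Rightarrow> nat" where W: "\<And>y. \<exists>m. \<forall>j\<in>{- int n..int n}. y j = W m j"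
      using countable_windows[of "- int n" "int n"] by blast
    have "{y \<in> space paths. y i \<in> A} = (\<Union>m\<in>{m. W m i \<in> A}. window (- int n) (int n) (W m))"
    proof (intro set_eqI iffI)
      fix y assume y: "y \<in> {y \<in> space paths. y i \<in> A}"
      obtain m where m: "\<forall>j\<in>{- int n..int n}. y j = W m j"
        using W by blast
      then have "y \<in> window (- int n) (int n) (W m)" "W m i \<in> A"
        using y i by (auto simp: window_def)
      then show "y \<in> (\<Union>m\<in>{m. W m i \<in> A}. window (- int n) (int n) (W m))"
        by blast
    next
      fix y assume "y \<in> (\<Union>m\<in>{m. W m i \<in> A}. window (- int n) (int n) (W m))"
      then obtain m where "W m i \<in> A" "y \<in> window (- int n) (int n) (W m)"
        by blast
      then show "y \<in> {y \<in> space paths. y i \<in> A}"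
        using i unfolding window_def by (metis (mono_tags, lifting) mem_Collect_eq)
    qed
    also have "\<dots> \<in> sigma_sets (space paths) ?E"
      by (rule E.countable_UN') auto
    finally show ?thesis .
  qed
  note gen = this
  show "sets paths \<subseteq> sigma_sets (space paths) ?E"
  proof -
    have "sets paths = sigma_sets (space paths)
        {{f \<in> space paths. f i \<in> A} | i A. i \<in> UNIV \<and> A \<in> sets (count_space {1::nat..})}"
      unfolding paths_def sets_PiM_single by (simp add: space_PiM)
    also have "\<dots> \<subseteq> sigma_sets (space paths) ?E"
      by (rule E.sigma_sets_subset) (use gen in blast)
    finally show ?thesis .
  qed
qed

lemma window_empty:
  assumes "i \<in> {a..b}" "s i = 0"
  shows "window a b s = {}"
proof -
  have False if "y \<in> window a b s" for y
  proof -
    have "y i = s i" "1 \<le> y i"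
      using that assms(1) unfolding window_def space_paths by blast+
    then show False
      using assms(2) by simp
  qed
  then show ?thesis
    by blast
qed

text \<open>Of two symmetric windows the longer one is contained in the other or disjoint from it.
  The empty set is itself a window, that of a word using the impossible state 0.\<close>

lemma Int_stable_windows: "Int_stable {window (- int n) (int n) s | n s. True}"
proof -
  have empty: "{} = window (- int 0) (int 0) (\<lambda>_. 0)"
    by (rule window_empty[symmetric, of 0]) auto
  have aux: "\<exists>n s. window (- int k) (int k) t \<inter> window (- int l) (int l) u = window (- int n) (int n) s"
    if "k \<le> l" for k l t u
  proof (cases "\<forall>i\<in>{- int k..int k}. t i = u i")
    case True
    then have "window (- int k) (int k) t \<inter> window (- int l) (int l) u = window (- int l) (int l) u"
      using that by (auto simp: window_def)
    then show ?thesis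
      by blast
  next
    case False
    then obtain i where i: "i \<in> {- int k..int k}" "t i \<noteq> u i"
      by blast
    moreover from this have "i \<in> {- int l..int l}"
      using that by auto
    ultimately have "window (- int k) (int k) t \<inter> window (- int l) (int l) u = {}"
      unfolding window_def by fastforce
    then show ?thesis
      using empty by metis
  qed
  show ?thesis
  proof (rule Int_stableI)
    fix A B assume "A \<in> {window (- int n) (int n) s | n s. True}" "B \<in> {window (- int n) (int n) s | n s. True}"
    then obtain k t l u where "A = window (- int k) (int k) t" "B = window (- int l) (int l) u"
      by blast
    then show "A \<inter> B \<in> {window (- int n) (int n) s | n s. True}"
      using aux[of k l t u] aux[of l k u t] by (cases "k \<le> l") (auto simp: Int_commute)
  qed
qed

lemma measure_eqI_windows:
  assumes M: "sets M = sets paths" and N: "sets N = sets paths"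
    and eq: "\<And>n s. emeasure M (window (- int n) (int n) s) = emeasure N (window (- int n) (int n) s)"
    and fin: "\<And>s. emeasure M (window 0 0 s) \<noteq> \<infinity>"
  shows "M = N"
proof (rule measure_eqI_generator_eq[OF Int_stable_windows])
  let ?E = "{window (- int n) (int n) s | n s. True}" and ?A = "\<lambda>i::nat. window 0 0 (\<lambda>_. i)"
  show "?E \<subseteq> Pow (space paths)"
    by (auto simp: window_def)
  show "emeasure M X = emeasure N X" if "X \<in> ?E" for X
    using that eq by auto
  show "sets M = sigma_sets (space paths) ?E" "sets N = sigma_sets (space paths) ?E"
    using M N sets_paths_eq by simp_all
  have "window 0 0 (\<lambda>_. i) = window (- int 0) (int 0) (\<lambda>_. i)" for i
    by simp
  then show "range ?A \<subseteq> ?E"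
    by blast
  show "(\<Union>i. ?A i) = space paths"
    by (auto simp: window_def)
  show "emeasure M (?A i) \<noteq> \<infinity>" for i
    by (rule fin)
qed

section \<open>Shift invariance and the Markov property\<close>

locale markov_shift =
  fixes p :: "nat \<Rightarrow> nat \<Rightarrow> real" and \<rho> :: "nat \<Rightarrow> real" and \<nu> :: "(int \<Rightarrow> nat) measure"
  assumes stochastic: "stochastic_matrix p" and stationary: "stationary_markov_measure p \<rho> \<nu>"
begin

lemma sets_nu: "sets \<nu> = sets paths"
  using stationary by (simp add: stationary_markov_measure_def paths_def)

lemma space_nu: "space \<nu> = space paths"
  by (rule sets_eq_imp_space_eq[OF sets_nu])

lemma rho_pos: "1 \<le> i \<Longrightarrow> 0 < \<rho> i"
  using stationary by (simp add: stationary_markov_measure_def)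

lemma p_nonneg: "1 \<le> i \<Longrightarrow> 1 \<le> j \<Longrightarrow> 0 \<le> p i j"
  using stochastic by (simp add: stochastic_matrix_def)

definition wt :: "int \<Rightarrow> int \<Rightarrow> (int \<Rightarrow> nat) \<Rightarrow> real" where
  "wt a b s = \<rho> (s a) * (\<Prod>i\<in>{a..<b}. p (s i) (s (i + 1)))"

lemma emeasure_window:
  assumes "a \<le> b" "\<And>i. i \<in> {a..b} \<Longrightarrow> 1 \<le> s i"
  shows "emeasure \<nu> (window a b s) = ennreal (wt a b s)"
proof -
  define n where "n = nat (b - a)"
  have b: "b = a + int n"
    using assms(1) by (simp add: n_def)
  let ?t = "\<lambda>j. s (a + int j)"
  have 1: "{a..b} = (\<lambda>j. a + int j) ` {..n}"
  proof (intro set_eqI iffI)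
    fix i assume "i \<in> {a..b}"
    then show "i \<in> (\<lambda>j. a + int j) ` {..n}"
      by (intro image_eqI[of _ _ "nat (i - a)"]) (auto simp: b)
  qed (auto simp: b)
  have 2: "{a..<b} = (\<lambda>j. a + int j) ` {..<n}"
  proof (intro set_eqI iffI)
    fix i assume "i \<in> {a..<b}"
    then show "i \<in> (\<lambda>j. a + int j) ` {..<n}"
      by (intro image_eqI[of _ _ "nat (i - a)"]) (auto simp: b)
  qed (auto simp: b)
  have "window a b s = {y \<in> space \<nu>. \<forall>j\<le>n. y (a + int j) = ?t j}"
    unfolding window_def 1 space_nu by auto
  moreover have "\<forall>j\<le>n. 1 \<le> ?t j"
    using assms(2) by (auto simp: b)
  ultimately have "emeasure \<nu> (window a b s) = ennreal (\<rho> (?t 0) * (\<Prod>j<n. p (?t j) (?t (Suc j))))"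
    using stationary unfolding stationary_markov_measure_def by auto
  also have "(\<Prod>j<n. p (?t j) (?t (Suc j))) = (\<Prod>i\<in>{a..<b}. p (s i) (s (i + 1)))"
    unfolding 2 by (subst prod.reindex) (auto simp: inj_on_def algebra_simps)
  finally show ?thesis
    by (simp add: wt_def)
qed

lemma wt_nonneg:
  assumes "a \<le> b" "\<And>i. i \<in> {a..b} \<Longrightarrow> 1 \<le> s i"
  shows "0 \<le> wt a b s"
  unfolding wt_def using assms rho_pos[of "s a"]
  by (intro mult_nonneg_nonneg prod_nonneg ballI p_nonneg) auto

text \<open>The Markov property at time b, multiplied by \<open>\<rho> (s b)\<close> instead of
  divided by it.\<close>

lemma wt_split:
  assumes "a \<le> b" "b \<le> c" "1 \<le> s b"
  shows "\<rho> (s b) * wt a c s = wt a b s * wt b c s"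
proof -
  have "{a..<c} = {a..<b} \<union> {b..<c}"
    using assms by auto
  then have "(\<Prod>i\<in>{a..<c}. p (s i) (s (i + 1)))
      = (\<Prod>i\<in>{a..<b}. p (s i) (s (i + 1))) * (\<Prod>i\<in>{b..<c}. p (s i) (s (i + 1)))"
    by (simp only:) (rule prod.union_disjoint, auto)
  then show ?thesis
    by (simp add: wt_def)
qed

lemma wt_zshift: "wt (a + k) (b + k) s = wt a b (zshift k s)"
proof -
  have 1: "{a + k..<b + k} = (\<lambda>i. i + k) ` {a..<b}"
    by simp
  have "(\<Prod>i\<in>{a + k..<b + k}. p (s i) (s (i + 1))) = (\<Prod>i\<in>{a..<b}. p (s (i + k)) (s (i + k + 1)))"
    unfolding 1 by (subst prod.reindex) auto
  then show ?thesis
    by (simp add: wt_def zshift_def algebra_simps)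
qed

lemma emeasure_window_finite: "emeasure \<nu> (window 0 0 s) \<noteq> \<infinity>"
proof (cases "s 0 = 0")
  case True
  then show ?thesis
    by (simp add: window_empty[of 0])
next
  case False
  then show ?thesis
    by (subst emeasure_window) auto
qed

text \<open>The weight of a window depends on its word and not on its position, and windows
  determine the measure.\<close>

lemma preserves_zshift: "preserves \<nu> (zshift k)"
proof -
  have m: "zshift k \<in> measurable \<nu> \<nu>"
    using measurable_zshift[of k] by (simp add: measurable_cong_sets[OF sets_nu sets_nu])
  have "\<nu> = distr \<nu> \<nu> (zshift k)"
  proof (rule measure_eqI_windows)
    fix n s
    let ?a = "- int n" and ?b = "int n"
    have pre: "zshift k -` window ?a ?b s \<inter> space \<nu> = window (?a + k) (?b + k) (zshift (- k) s)"
    proof (intro set_eqI)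
      fix y
      have "(\<forall>i\<in>{?a..?b}. y (i + k) = s i) \<longleftrightarrow> (\<forall>i\<in>{?a + k..?b + k}. y i = s (i - k))"
      proof (intro iffI ballI)
        fix i assume h: "\<forall>i\<in>{?a..?b}. y (i + k) = s i" and i: "i \<in> {?a + k..?b + k}"
        show "y i = s (i - k)"
          using h[rule_format, of "i - k"] i by simp
      next
        fix i assume h: "\<forall>i\<in>{?a + k..?b + k}. y i = s (i - k)" and i: "i \<in> {?a..?b}"
        show "y (i + k) = s i"
          using h[rule_format, of "i + k"] i by simp
      qed
      then show "y \<in> zshift k -` window ?a ?b s \<inter> space \<nu> \<longleftrightarrow> y \<in> window (?a + k) (?b + k) (zshift (- k) s)"
        by (simp add: window_def space_nu) (simp add: zshift_def, blast)
    qed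
    have "emeasure (distr \<nu> \<nu> (zshift k)) (window ?a ?b s)
        = emeasure \<nu> (window (?a + k) (?b + k) (zshift (- k) s))"
      using sets_window sets_nu pre by (subst emeasure_distr[OF m]) auto
    also have "\<dots> = emeasure \<nu> (window ?a ?b s)"
    proof (cases "\<forall>i\<in>{?a..?b}. 1 \<le> s i")
      case True
      then have "1 \<le> zshift (- k) s i" if "i \<in> {?a + k..?b + k}" for i
        using that by (auto simp: zshift_def)
      then show ?thesis
        using True emeasure_window[of "?a + k" "?b + k" "zshift (- k) s"] emeasure_window[of ?a ?b s]
        unfolding wt_zshift zshift_zshift by (simp add: zshift_def)
    next
      case False
      then obtain i where i: "i \<in> {?a..?b}" "s i = 0"
        by force
      then have "window (?a + k) (?b + k) (zshift (- k) s) = {}"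
        by (intro window_empty[of "i + k"]) (auto simp: zshift_def)
      then show ?thesis
        using window_empty[of i ?a ?b s] i by simp
    qed
    finally show "emeasure \<nu> (window ?a ?b s) = emeasure (distr \<nu> \<nu> (zshift k)) (window ?a ?b s)"
      by simp
  qed (use emeasure_window_finite in \<open>simp_all add: sets_nu\<close>)
  then show ?thesis
    using m by (simp add: preserves_def)
qed

lemma preserves_path_shift: "preserves \<nu> path_shift"
  unfolding path_shift_eq by (rule preserves_zshift)

lemma sigma_finite_nu: "sigma_finite_measure \<nu>"
proof
  have "(\<Union>i. window 0 0 (\<lambda>_. i)) = space \<nu>"
    by (auto simp: window_def space_nu)
  then show "\<exists>A. countable A \<and> A \<subseteq> sets \<nu> \<and> \<Union>A = space \<nu> \<and> (\<forall>a\<in>A. emeasure \<nu> a \<noteq> \<infinity>)"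
    using emeasure_window_finite sets_window sets_nu
    by (intro exI[of _ "range (\<lambda>i. window 0 0 (\<lambda>_. i))"]) auto
qed

definition base :: "(int \<Rightarrow> nat) set" where
  "base = window 0 0 (\<lambda>_. 1)"

lemma base_iff: "y \<in> base \<longleftrightarrow> y \<in> space \<nu> \<and> y 0 = 1"
  by (auto simp: base_def window_def space_nu)

lemma sets_base: "base \<in> sets \<nu>"
  unfolding base_def sets_nu by (rule sets_window)

lemma emeasure_base: "emeasure \<nu> base = ennreal (\<rho> 1)"
  unfolding base_def by (subst emeasure_window) (auto simp: wt_def)

lemma wt_cong:
  assumes "a \<le> b" "\<And>i. i \<in> {a..b} \<Longrightarrow> s i = t i"
  shows "wt a b s = wt a b t"
proof -
  have "(\<Prod>i\<in>{a..<b}. p (s i) (s (i + 1))) = (\<Prod>i\<in>{a..<b}. p (t i) (t (i + 1)))"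
    by (intro prod.cong refl) (use assms in auto)
  then show ?thesis
    unfolding wt_def using assms by simp
qed

section \<open>Independence of past and future at state 1\<close>

definition future_vimage :: "(int \<Rightarrow> nat) set \<Rightarrow> (int \<Rightarrow> nat) set" where
  "future_vimage G = future -` G \<inter> space \<nu>"

text \<open>Conditional independence of \<open>H\<close> and the future given
  \<open>y 0 = 1\<close>, cleared of denominators; \<open>\<rho> 1\<close> is the measure of
  \<open>base\<close>.\<close>

definition past_independent :: "(int \<Rightarrow> nat) set \<Rightarrow> bool" where
  "past_independent H \<longleftrightarrow> H \<in> sets \<nu> \<and> H \<subseteq> base \<and> (\<forall>G\<in>sets paths.
     ennreal (\<rho> 1) * emeasure \<nu> (H \<inter> future_vimage G)
       = emeasure \<nu> H * emeasure \<nu> (base \<inter> future_vimage G))"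

lemma measurable_future_nu: "future \<in> measurable \<nu> paths"
  using measurable_future by (simp add: measurable_cong_sets[OF sets_nu refl])

lemma sets_future_vimage: "G \<in> sets paths \<Longrightarrow> future_vimage G \<in> sets \<nu>"
  unfolding future_vimage_def by (rule measurable_sets[OF measurable_future_nu])

text \<open>Turns both sides of the independence identity into measures on paths, so that they need
  to be compared on windows only.\<close>

definition future_law :: "(int \<Rightarrow> nat) set \<Rightarrow> (int \<Rightarrow> nat) measure" where
  "future_law H = distr (density \<nu> (indicator H)) paths future"

lemma sets_future_law: "sets (future_law H) = sets paths"
  by (simp add: future_law_def)

lemma emeasure_future_law:
  assumes "H \<in> sets \<nu>" "G \<in> sets paths"
  shows "emeasure (future_law H) G = emeasure \<nu> (H \<inter> future_vimage G)"
  unfolding future_law_def using assms measurable_future_nu sets_future_vimage[OF assms(2)]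
  by (subst emeasure_distr) (auto simp: emeasure_restricted future_vimage_def)

text \<open>Markov property at time 0. Only a window with the filler state 1 at negative times and
  with state 1 at time 0 can contain the future of a point of \<open>base\<close>; for such a window
  the past word \<open>s\<close> and the future word \<open>t\<close> glue at 0, and the weights
  multiply by \<open>wt_split\<close>.\<close>

lemma past_window_independent:
  assumes a: "a \<le> 0" and s: "s 0 = 1"
  shows "past_independent (window a 0 s)"
proof (cases "\<forall>i\<in>{a..0}. 1 \<le> s i")
  case False
  then have "window a 0 s = {}"
    using window_empty[of _ a 0 s] by force
  then show ?thesis
    by (simp add: past_independent_def)
next
  case s1: True
  let ?H = "window a 0 s"
  have H: "?H \<in> sets \<nu>"
    by (simp add: sets_nu sets_window)
  have sub: "?H \<subseteq> base"
    using a s by (auto simp: window_def base_iff space_nu)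
  have eH: "emeasure \<nu> ?H = ennreal (wt a 0 s)"
    by (rule emeasure_window) (use a s1 in auto)
  have rho: "0 < \<rho> 1"
    by (rule rho_pos) simp
  define M where "M = density (future_law ?H) (\<lambda>_. ennreal (\<rho> 1))"
  define N where "N = density (future_law base) (\<lambda>_. emeasure \<nu> ?H)"
  have eM: "emeasure M G = ennreal (\<rho> 1) * emeasure \<nu> (?H \<inter> future_vimage G)"
    and eN: "emeasure N G = emeasure \<nu> ?H * emeasure \<nu> (base \<inter> future_vimage G)"
    if "G \<in> sets paths" for G
    using that unfolding M_def N_def
    by (simp_all add: emeasure_density_const sets_future_law emeasure_future_law H sets_base)
  have "M = N"
  proof (rule measure_eqI_windows)
    show "sets M = sets paths" "sets N = sets paths"
      by (simp_all add: M_def N_def sets_future_law)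
    show "emeasure M (window 0 0 t) \<noteq> \<infinity>" for t
    proof -
      have "emeasure \<nu> (?H \<inter> future_vimage (window 0 0 t)) \<le> emeasure \<nu> ?H"
        by (rule emeasure_mono) (use H in auto)
      also have "\<dots> < \<infinity>"
        by (simp add: eH)
      finally show ?thesis
        by (simp add: eM sets_window ennreal_mult_eq_top_iff)
    qed
    fix n t
    let ?G = "window (- int n) (int n) t"
    have G: "?G \<in> sets paths"
      by (rule sets_window)
    show "emeasure M ?G = emeasure N ?G"
    proof (cases "(\<forall>i\<in>{- int n..-1}. t i = 1) \<and> t 0 = 1 \<and> (\<forall>i\<in>{0..int n}. 1 \<le> t i)")
      case True
      define u where "u i = (if i < 0 then s i else t i)" for i
      have b: "base \<inter> future_vimage ?G = window 0 (int n) t"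
        using True by (auto simp: base_iff future_vimage_def window_def space_nu future_def space_paths)
      have h: "?H \<inter> future_vimage ?G = window a (int n) u"
      proof (intro set_eqI iffI)
        fix y assume "y \<in> ?H \<inter> future_vimage ?G"
        then show "y \<in> window a (int n) u"
          by (auto simp: future_vimage_def window_def space_nu future_def u_def split: if_splits)
      next
        fix y assume y: "y \<in> window a (int n) u"
        then have "y i = s i" if "i \<in> {a..0}" for i
          using that True s unfolding window_def u_def by (cases "i = 0") auto
        moreover have "future y i = t i" if "i \<in> {- int n..int n}" for i
          using that True y a unfolding window_def u_def future_def by (cases "i < 0") auto
        ultimately show "y \<in> ?H \<inter> future_vimage ?G"
          using y by (auto simp: future_vimage_def window_def space_nu future_def space_paths)
      qed
      have u1: "1 \<le> u i" if "i \<in> {a..int n}" for i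
        using that True s1 by (auto simp: u_def)
      have "\<rho> (u 0) * wt a (int n) u = wt a 0 u * wt 0 (int n) u"
        by (rule wt_split) (use a u1 in auto)
      moreover have "wt a 0 u = wt a 0 s" "wt 0 (int n) u = wt 0 (int n) t"
        by (rule wt_cong; use a True s in \<open>force simp: u_def\<close>)+
      ultimately have eq: "\<rho> 1 * wt a (int n) u = wt a 0 s * wt 0 (int n) t"
        using True by (simp add: u_def)
      have "emeasure M ?G = ennreal (\<rho> 1) * ennreal (wt a (int n) u)"
        unfolding eM[OF G] h by (subst emeasure_window) (use a u1 in auto)
      also have "\<dots> = ennreal (wt a 0 s) * ennreal (wt 0 (int n) t)"
      proof -
        have "ennreal (\<rho> 1) * ennreal (wt a (int n) u) = ennreal (\<rho> 1 * wt a (int n) u)"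
          by (rule ennreal_mult'[symmetric]) (use rho in simp)
        also have "\<dots> = ennreal (wt a 0 s) * ennreal (wt 0 (int n) t)"
          unfolding eq by (rule ennreal_mult'[OF wt_nonneg]) (use a s1 in auto)
        finally show ?thesis .
      qed
      also have "\<dots> = emeasure N ?G"
        unfolding eN[OF G] b eH by (subst emeasure_window) (use True in auto)
      finally show ?thesis .
    next
      case False
      have "base \<inter> future_vimage ?G = {}"
      proof (rule ccontr)
        assume "base \<inter> future_vimage ?G \<noteq> {}"
        then obtain y where y0: "y \<in> base" "y \<in> future_vimage ?G"
          by blast
        then have y: "y \<in> space paths" "y 0 = 1"
          by (simp_all add: base_iff space_nu)
        have fut: "future y i = t i" if "i \<in> {- int n..int n}" for i
          using y0(2) that by (simp add: future_vimage_def window_def)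
        have "t i = 1" if "i \<in> {- int n..-1}" for i
          using fut[of i] that by (simp add: future_def)
        moreover have "t i = y i" if "i \<in> {0..int n}" for i
          using fut[of i] that by (simp add: future_def)
        ultimately show False
          using False y(1,2) by (auto simp: space_paths)
      qed
      moreover from this have "?H \<inter> future_vimage ?G = {}"
        using sub by blast
      ultimately show ?thesis
        by (simp add: eM[OF G] eN[OF G])
    qed
  qed
  then show ?thesis
    unfolding past_independent_def using H sub eM eN by metis
qed

text \<open>With every point \<open>H\<close> contains its whole window on \<open>{a..0}\<close>, so
  it is a countable disjoint union of windows, and the identity is additive in
  \<open>H\<close>.\<close>

lemma past_determined_independent:
  assumes a: "a \<le> 0" and H: "H \<in> sets \<nu>" "H \<subseteq> base"
    and det: "\<And>y y'. y \<in> H \<Longrightarrow> y' \<in> space \<nu> \<Longrightarrow> (\<And>i. i \<in> {a..0} \<Longrightarrow> y' i = y i) \<Longrightarrow> y' \<in> H"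
  shows "past_independent H"
proof -
  obtain W :: "nat \<Rightarrow> int \<Rightarrow> nat" where W: "\<And>y. \<exists>m. \<forall>j\<in>{a..0}. y j = W m j"
    using countable_windows[of a 0] by blast
  let ?A = "\<lambda>n. window a 0 (W n)"
  define B where "B n = H \<inter> disjointed ?A n" for n
  have UA: "(\<Union>n. ?A n) = space \<nu>"
  proof (intro set_eqI iffI)
    fix y assume "y \<in> space \<nu>"
    then show "y \<in> (\<Union>n. ?A n)"
      using W[of y] by (auto simp: window_def space_nu)
  qed (auto simp: window_def space_nu)
  have disj: "disjoint_family B"
    using disjoint_family_disjointed[of ?A] unfolding B_def disjoint_family_on_def by blast
  have HB: "H = (\<Union>n. B n)"
  proof -
    have "(\<Union>n. B n) = H \<inter> (\<Union>n. disjointed ?A n)"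
      by (simp add: B_def)
    then show ?thesis
      using sets.sets_into_space[OF H(1)] by (simp add: UN_disjointed_eq UA Int_absorb2)
  qed
  have indep: "past_independent (B n)" for n
  proof (cases "B n = {}")
    case True
    then show ?thesis
      by (simp add: past_independent_def)
  next
    case False
    then obtain y where "y \<in> B n"
      by blast
    then have y: "y \<in> H" "y \<in> ?A n" "\<And>m. m < n \<Longrightarrow> y \<notin> ?A m"
      by (auto simp: B_def disjointed_def)
    have "B n = ?A n"
    proof
      show "B n \<subseteq> ?A n"
        by (auto simp: B_def disjointed_def)
      show "?A n \<subseteq> B n"
      proof
        fix y' assume y': "y' \<in> ?A n"
        then have eq: "y' i = y i" if "i \<in> {a..0}" for i
          using y(2) that unfolding window_def by simp
        then have "y' \<in> H"
          using det[OF y(1)] y' by (auto simp: window_def space_nu)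
        moreover have "y' \<notin> ?A m" if "m < n" for m
          using y(3)[OF that] eq y(1) sets.sets_into_space[OF H(1)] y(2) unfolding window_def by auto
        ultimately show "y' \<in> B n"
          using y' by (auto simp: B_def disjointed_def)
      qed
    qed
    moreover have "W n 0 = 1"
      using y(1,2) H(2) a by (auto simp: window_def base_iff)
    ultimately show ?thesis
      using past_window_independent[OF a] by simp
  qed
  have B: "B n \<in> sets \<nu>" for n
    using indep by (simp add: past_independent_def)
  show ?thesis
    unfolding past_independent_def
  proof (intro conjI H ballI)
    fix G assume G: "G \<in> sets paths"
    note F = sets_future_vimage[OF G]
    have "emeasure \<nu> (H \<inter> future_vimage G) = emeasure \<nu> (\<Union>n. B n \<inter> future_vimage G)"
      using HB by (intro arg_cong[where f = "emeasure \<nu>"]) blast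
    also have "\<dots> = (\<Sum>n. emeasure \<nu> (B n \<inter> future_vimage G))"
      by (rule suminf_emeasure[symmetric]) (use B F disj in \<open>auto simp: disjoint_family_on_def\<close>)
    finally have "ennreal (\<rho> 1) * emeasure \<nu> (H \<inter> future_vimage G)
        = (\<Sum>n. ennreal (\<rho> 1) * emeasure \<nu> (B n \<inter> future_vimage G))"
      by simp
    also have "\<dots> = (\<Sum>n. emeasure \<nu> (B n) * emeasure \<nu> (base \<inter> future_vimage G))"
      using indep G by (intro suminf_cong) (auto simp: past_independent_def)
    also have "\<dots> = (\<Sum>n. emeasure \<nu> (B n)) * emeasure \<nu> (base \<inter> future_vimage G)"
      by simp
    also have "(\<Sum>n. emeasure \<nu> (B n)) = emeasure \<nu> H"
      by (subst HB, rule suminf_emeasure) (use B disj in auto)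
    finally show "ennreal (\<rho> 1) * emeasure \<nu> (H \<inter> future_vimage G)
        = emeasure \<nu> H * emeasure \<nu> (base \<inter> future_vimage G)" .
  qed
qed

end

section \<open>Recurrence\<close>

text \<open>Choquet-Deny argument: the increments of \<open>h\<close> over \<open>a\<close> are
  again harmonic. If their supremum were positive, one increment near it would force many successive
  increments along multiples of \<open>a\<close> to be near it, and their sum would exceed what the
  bound on \<open>h\<close> allows.\<close>

lemma harmonic_periodic_real:
  fixes h w :: "nat \<Rightarrow> real"
  assumes w: "\<And>r. 0 \<le> w r" "w sums 1" and a: "0 < w a"
    and bd: "\<And>n. \<bar>h n\<bar> \<le> K" and harm: "\<And>n. (\<lambda>r. w r * h (n + r)) sums h n"
  shows "h (n + a) \<le> h n"
proof (rule ccontr)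
  define d where "d n = h (n + a) - h n" for n
  assume "\<not> h (n + a) \<le> h n"
  then have dn: "0 < d n"
    by (simp add: d_def)
  have dbd: "d m \<le> 2 * K" for m
    using bd[of "m + a"] bd[of m] by (simp add: d_def abs_le_iff)
  define D where "D = (SUP m. d m)"
  have bdd: "bdd_above (range d)"
    using dbd by (auto simp: bdd_above_def)
  have dD: "d m \<le> D" for m
    unfolding D_def by (rule cSUP_upper[OF _ bdd]) simp
  have D0: "0 < D"
    using dn dD[of n] by simp
  have dharm: "(\<lambda>r. w r * d (m + r)) sums d m" for m
    using sums_diff[OF harm[of "m + a"] harm[of m]] by (simp add: d_def algebra_simps)
  \<comment> \<open>A value of \<open>d\<close> close to its supremum forces the next value along \<open>a\<close> to be close as well.\<close>
  have step: "D - (D - d m) / w a \<le> d (m + a)" for m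
  proof -
    have "(\<lambda>r. w r * (D - d (m + r))) sums (1 * D - d m)"
      using sums_diff[OF sums_mult2[OF w(2), of D] dharm[of m]] by (simp add: algebra_simps)
    moreover have "0 \<le> w r * (D - d (m + r))" for r
      using w(1) dD by simp
    ultimately have "w a * (D - d (m + a)) \<le> 1 * D - d m"
      using sum_le_suminf[of "\<lambda>r. w r * (D - d (m + r))" "{a}"] by (auto simp: sums_iff)
    then show ?thesis
      using a by (simp add: field_simps)
  qed
  have "\<forall>y. \<exists>n. y < real n * (D / 2)"
    by (rule reals_Archimedean3) (use D0 in simp)
  then obtain N where N: "2 * K < real N * (D / 2)"
    by blast
  \<comment> \<open>Each step along \<open>a\<close> divides the distance from the supremum by
    \<open>w a\<close>; with this start the distance is at most \<open>D / 2\<close> through all N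
    steps.\<close>
  define e where "e = D / 2 * (w a) ^ N"
  have w1: "w a \<le> 1"
    using sum_le_suminf[of w "{a}"] w by (auto simp: sums_iff)
  have e0: "0 < e"
    using D0 a by (simp add: e_def)
  then obtain m where m: "D - e < d m"
    using less_cSUP_iff[OF _ bdd, of "D - e"] by (auto simp: D_def)
  have near: "D - e / (w a) ^ k \<le> d (m + k * a)" for k
  proof (induction k)
    case 0
    then show ?case
      using m by simp
  next
    case (Suc k)
    have "(D - d (m + k * a)) / w a \<le> (e / (w a) ^ k) / w a"
      by (rule divide_right_mono) (use Suc a in simp_all)
    then show ?case
      using step[of "m + k * a"] by (simp add: algebra_simps)
  qed
  have "D / 2 \<le> d (m + k * a)" if "k \<le> N" for k
  proof -
    have "(w a) ^ N \<le> (w a) ^ k"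
      by (rule power_decreasing) (use that a w1 in auto)
    then have "e / (w a) ^ k \<le> D / 2"
      using a D0 by (simp add: e_def divide_le_eq)
    then show ?thesis
      using near[of k] by simp
  qed
  then have "(\<Sum>k<N. D / 2) \<le> (\<Sum>k<N. d (m + k * a))"
    by (intro sum_mono) simp
  also have "\<dots> = (\<Sum>k<N. h (m + Suc k * a) - h (m + k * a))"
    by (simp add: d_def algebra_simps)
  also have "\<dots> = h (m + N * a) - h m"
    by (subst sum_lessThan_telescope[where f = "\<lambda>k. h (m + k * a)"]) simp
  also have "\<dots> \<le> 2 * K"
    using bd[of "m + N * a"] bd[of m] by (simp add: abs_le_iff)
  finally show False
    using N by simp
qed

text \<open>The one-sided real statement, applied to the real and imaginary parts with both signs,
  gives equality.\<close>

lemma harmonic_periodic: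
  fixes h :: "nat \<Rightarrow> complex" and w :: "nat \<Rightarrow> real"
  assumes w: "\<And>r. 0 \<le> w r" "w sums 1" and a: "0 < w a"
    and bd: "\<And>n. norm (h n) \<le> K" and harm: "\<And>n. (\<lambda>r. w r *\<^sub>R h (n + r)) sums h n"
  shows "h (n + a) = h n"
proof -
  have "\<bar>c * L (h n)\<bar> \<le> K" if "c \<in> {1, -1}" "L \<in> {Re, Im}" for c L n
    using that bd[of n] abs_Re_le_cmod[of "h n"] abs_Im_le_cmod[of "h n"] by auto
  moreover have "(\<lambda>r. w r * (c * L (h (n + r)))) sums (c * L (h n))" if "L \<in> {Re, Im}" for c L n
    using that sums_mult[OF sums_Re[OF harm[of n]], of c] sums_mult[OF sums_Im[OF harm[of n]], of c]
    by (auto simp: mult_ac)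
  ultimately have "c * L (h (n + a)) \<le> c * L (h n)" if "c \<in> {1, -1}" "L \<in> {Re, Im}" for c L
    using harmonic_periodic_real[OF w a, of "\<lambda>n. c * L (h n)" K n] that by blast
  from this[of 1 Re] this[of "-1" Re] this[of 1 Im] this[of "-1" Im] show ?thesis
    by (simp add: complex_eq_iff)
qed

text \<open>Euclid's argument with forward shifts only: the remainder of a period modulo the least
  positive period d is again a period, hence 0, so d divides every element of
  \<open>V\<close>.\<close>

lemma periods_Gcd:
  fixes h :: "nat \<Rightarrow> 'a"
  assumes "\<And>a n. a \<in> V \<Longrightarrow> h (n + a) = h n" "Gcd V = 1"
  shows "h n = h 0"
proof -
  define P where "P = {a. \<forall>n. h (n + a) = h n}"
  have VP: "V \<subseteq> P"
    using assms(1) by (auto simp: P_def)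
  have "\<exists>a\<in>V. a \<noteq> 0"
  proof (rule ccontr)
    assume "\<not> ?thesis"
    then have "V \<subseteq> {0}"
      by auto
    then have "Gcd V = 0"
      by (simp add: Gcd_0_iff)
    then show False
      using assms(2) by simp
  qed
  then have ex: "\<exists>a. 0 < a \<and> a \<in> P"
    using VP by blast
  define d where "d = (LEAST a. 0 < a \<and> a \<in> P)"
  have d: "0 < d" "d \<in> P"
    using LeastI_ex[OF ex] by (auto simp: d_def)
  have mult: "h (n + k * d) = h n" for n k
  proof (induction k)
    case (Suc k)
    have "h (n + Suc k * d) = h ((n + k * d) + d)"
      by (simp add: algebra_simps)
    then show ?case
      using Suc d(2) by (simp add: P_def)
  qed simp
  have "d dvd a" if "a \<in> V" for a
  proof -
    have "h (n + a mod d) = h n" for n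
    proof -
      have "h (n + a mod d) = h ((n + a mod d) + (a div d) * d)"
        by (rule mult[symmetric])
      also have "(n + a mod d) + (a div d) * d = n + a"
        by (simp add: algebra_simps)
      finally show ?thesis
        using assms(1)[OF that] by simp
    qed
    then have "a mod d \<in> P"
      by (simp add: P_def)
    moreover have "a mod d < d"
      using d(1) by simp
    ultimately have "\<not> 0 < a mod d"
      using not_less_Least[of "a mod d" "\<lambda>a. 0 < a \<and> a \<in> P"] by (auto simp: d_def)
    then show ?thesis
      by (simp add: dvd_eq_mod_eq_0)
  qed
  then have "d dvd Gcd V"
    by (rule Gcd_greatest)
  then have "d = 1"
    using assms(2) by simp
  then show ?thesis
    using mult[of 0 n] by simp
qed

section \<open>Returns and the induced map\<close>

text \<open>The points of \<open>D\<close> that never return form a wandering set.\<close>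

lemma conservative_return:
  assumes R: "preserves m R" and "conservative m R" and D: "D \<in> sets m"
  shows "AE z in m. z \<in> D \<longrightarrow> (\<exists>n\<ge>1. (R ^^ n) z \<in> D)"
proof -
  define W where "W = D - (\<Union>n. preim m R (Suc n) D)"
  have W: "W \<in> sets m"
    unfolding W_def using D sets_preim[OF R D] by auto
  have "preim m R i W \<inter> preim m R j W = {}" if "i < j" for i j
  proof -
    have False if z: "z \<in> preim m R i W" "z \<in> preim m R j W" for z
    proof -
      obtain n where n: "j = Suc n + i"
        using \<open>i < j\<close> less_iff_Suc_add[of i j] by (auto simp: ac_simps)
      have "(R ^^ i) z \<in> W" "(R ^^ j) z \<in> D"
        using z by (auto simp: preim_def W_def)
      moreover have "(R ^^ j) z = (R ^^ Suc n) ((R ^^ i) z)"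
        by (simp only: n funpow_add comp_apply)
      ultimately show False
        using sets.sets_into_space[OF W] by (auto simp: W_def preim_def)
    qed
    then show ?thesis
      by blast
  qed
  then have "disjoint_family (\<lambda>n. preim m R n W)"
    unfolding disjoint_family_on_def by (metis Int_commute linorder_neqE_nat)
  then have "W \<in> null_sets m"
    using assms(2) W by (auto simp: conservative_def null_sets_def)
  from AE_not_in[OF this] show ?thesis
    using AE_space
  proof eventually_elim
    case (elim z)
    show ?case
    proof
      assume "z \<in> D"
      then obtain n where "z \<in> preim m R (Suc n) D"
        using elim(1) by (auto simp: W_def)
      then show "\<exists>n\<ge>1. (R ^^ n) z \<in> D"
        by (intro exI[of _ "Suc n"]) (simp add: preim_def)
    qed
  qed
qed

definition first_return :: "('a \<Rightarrow> 'a) \<Rightarrow> 'a set \<Rightarrow> nat \<Rightarrow> 'a set" where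
  "first_return R D n = {z. z \<in> D \<and> (\<forall>i. 1 \<le> i \<and> i < n \<longrightarrow> (R ^^ i) z \<notin> D) \<and> (R ^^ n) z \<in> D}"

text \<open>By invariance, \<open>G\<close> may be replaced by \<open>G \<circ> R\<close> in the integral; iterate this until the first visit to \<open>D\<close>.\<close>

lemma nn_integral_first_return_le:
  assumes R: "preserves m R" and D [measurable]: "D \<in> sets m" and G [measurable]: "G \<in> borel_measurable m"
  shows "(\<integral>\<^sup>+z. (\<Sum>n. indicator (first_return R D (Suc n)) z * G ((R ^^ Suc n) z)) \<partial>m)
    \<le> (\<integral>\<^sup>+z. indicator D z * G z \<partial>m)"
proof -
  have Rn [measurable]: "(R ^^ n) \<in> measurable m m" for n
    using preserves_measurable[OF preserves_funpow[OF R]] .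
  \<comment> \<open>\<open>b n\<close> weighs points whose first visit at a time from 0 on is at n,
    \<open>a n\<close> points of \<open>D\<close> whose first visit at a time from 1 on is at n.
    Composing \<open>b n\<close> with \<open>R\<close> splits, according to whether \<open>z\<close>
    is in \<open>D\<close>, into \<open>a (Suc n)\<close> and \<open>b (Suc n)\<close>; by
    invariance the integrals telescope down from \<open>b 0\<close>.\<close>
  define a where "a n z = indicator (first_return R D n) z * G ((R ^^ n) z)" for n z
  define b where "b n z = indicator {z. (\<forall>i<n. (R ^^ i) z \<notin> D) \<and> (R ^^ n) z \<in> D} z * G ((R ^^ n) z)" for n z
  have pred: "Measurable.pred m (\<lambda>z. (R ^^ n) z \<in> D)" for n
    by measurable
  have a [measurable]: "a n \<in> borel_measurable m" for n
  proof -
    have "{z \<in> space m. z \<in> first_return R D n} \<in> sets m"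
      unfolding first_return_def mem_Collect_eq using pred by measurable
    then show ?thesis
      unfolding a_def by (intro borel_measurable_times_ennreal borel_measurable_indicator') auto
  qed
  have b [measurable]: "b n \<in> borel_measurable m" for n
  proof -
    have "{z \<in> space m. z \<in> {z. (\<forall>i<n. (R ^^ i) z \<notin> D) \<and> (R ^^ n) z \<in> D}} \<in> sets m"
      unfolding mem_Collect_eq using pred by measurable
    then show ?thesis
      unfolding b_def by (intro borel_measurable_times_ennreal borel_measurable_indicator') auto
  qed
  have step: "b n (R z) = a (Suc n) z + b (Suc n) z" for n z
  proof -
    have Rz: "(R ^^ i) (R z) = (R ^^ Suc i) z" for i
      by (simp add: funpow_swap1)
    let ?P = "\<forall>i. 1 \<le> i \<and> i < Suc n \<longrightarrow> (R ^^ i) z \<notin> D" and ?w = "(R ^^ Suc n) z"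
    have e1: "(\<forall>i<n. (R ^^ i) (R z) \<notin> D) \<longleftrightarrow> (\<forall>i. 1 \<le> i \<and> i < Suc n \<longrightarrow> (R ^^ i) z \<notin> D)"
    proof (intro iffI allI impI)
      fix i assume h: "\<forall>i<n. (R ^^ i) (R z) \<notin> D" and i: "1 \<le> i \<and> i < Suc n"
      then obtain j where "i = Suc j" "j < n"
        by (cases i) auto
      moreover from this h have "(R ^^ j) (R z) \<notin> D"
        by blast
      ultimately show "(R ^^ i) z \<notin> D"
        using Rz[of j] by simp
    next
      fix i assume h: "\<forall>i. 1 \<le> i \<and> i < Suc n \<longrightarrow> (R ^^ i) z \<notin> D" and i: "i < n"
      show "(R ^^ i) (R z) \<notin> D"
        using h[rule_format, of "Suc i"] i Rz[of i] by simp
    qed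
    have e2: "(\<forall>i<Suc n. (R ^^ i) z \<notin> D) \<longleftrightarrow> z \<notin> D \<and> (\<forall>i. 1 \<le> i \<and> i < Suc n \<longrightarrow> (R ^^ i) z \<notin> D)"
    proof (intro iffI allI impI conjI)
      fix i assume h: "z \<notin> D \<and> (\<forall>i. 1 \<le> i \<and> i < Suc n \<longrightarrow> (R ^^ i) z \<notin> D)" and i: "i < Suc n"
      then show "(R ^^ i) z \<notin> D"
        by (cases "i = 0") auto
    qed (auto dest: spec[of _ 0])
    have split: "(if P \<and> W then g else 0) = (if d \<and> P \<and> W then g else 0) + (if \<not> d \<and> P \<and> W then g else 0)"
      for d P W and g :: ennreal
      by simp
    have 1: "b n (R z) = (if ?P \<and> ?w \<in> D then G ?w else 0)"
      unfolding b_def Rz indicator_def mem_Collect_eq e1[unfolded Rz] by (simp del: funpow.simps)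
    have 2: "a (Suc n) z = (if z \<in> D \<and> ?P \<and> ?w \<in> D then G ?w else 0)"
      unfolding a_def first_return_def indicator_def mem_Collect_eq by (simp del: funpow.simps)
    have 3: "b (Suc n) z = (if z \<notin> D \<and> ?P \<and> ?w \<in> D then G ?w else 0)"
      unfolding b_def indicator_def mem_Collect_eq e2 by (simp del: funpow.simps)
    show ?thesis
      unfolding 1 2 3 by (rule split)
  qed
  have ind: "(\<Sum>n<N. \<integral>\<^sup>+z. a (Suc n) z \<partial>m) + (\<integral>\<^sup>+z. b N z \<partial>m) = (\<integral>\<^sup>+z. b 0 z \<partial>m)" for N
  proof (induction N)
    case (Suc N)
    have "(\<integral>\<^sup>+z. b N z \<partial>m) = (\<integral>\<^sup>+z. a (Suc N) z + b (Suc N) z \<partial>m)"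
      using preserves_nn_integral[OF R b[of N]] by (simp add: step)
    also have "\<dots> = (\<integral>\<^sup>+z. a (Suc N) z \<partial>m) + (\<integral>\<^sup>+z. b (Suc N) z \<partial>m)"
      by (rule nn_integral_add) auto
    finally show ?case
      using Suc by (simp add: add.assoc)
  qed simp
  have "(\<integral>\<^sup>+z. (\<Sum>n. a (Suc n) z) \<partial>m) = (\<Sum>n. \<integral>\<^sup>+z. a (Suc n) z \<partial>m)"
    by (rule nn_integral_suminf) auto
  also have "\<dots> \<le> (\<integral>\<^sup>+z. b 0 z \<partial>m)"
  proof (rule suminf_le_const)
    show "(\<Sum>n<N. \<integral>\<^sup>+z. a (Suc n) z \<partial>m) \<le> (\<integral>\<^sup>+z. b 0 z \<partial>m)" for N
      unfolding ind[of N, symmetric] by simp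
  qed simp
  finally show ?thesis
    by (simp add: a_def b_def)
qed

section \<open>Visits of the chain to state 1\<close>

lemma nstep_pos_path:
  assumes "stochastic_matrix p" "0 < nstep p n i j" "1 \<le> i" "1 \<le> j"
  shows "\<exists>s. s 0 = i \<and> s n = j \<and> (\<forall>k\<le>n. 1 \<le> s k) \<and> (\<forall>k<n. 0 < p (s k) (s (Suc k)))"
  using assms(2,3)
proof (induction n arbitrary: i)
  case 0
  then show ?case
    by (intro exI[of _ "\<lambda>_. i"]) (auto split: if_splits)
next
  case (Suc n)
  \<comment> \<open>Otherwise every summand, and with it the infinite sum, would be at most
    0.\<close>
  have "\<exists>k\<ge>1. 0 < p i k * nstep p n k j"
  proof (rule ccontr)
    assume "\<not> ?thesis"
    then have "0 \<le> - (p i k * nstep p n k j)" if "k \<in> {1..}" for k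
      using that by force
    then have "0 \<le> (\<Sum>\<^sub>\<infinity>k\<in>{1..}. - (p i k * nstep p n k j))"
      by (rule infsum_nonneg)
    then show False
      using Suc.prems by (simp add: infsum_uminus)
  qed
  then obtain k where k: "1 \<le> k" "0 < p i k * nstep p n k j"
    by blast
  have "0 \<le> p i k"
    using assms(1) k(1) Suc.prems(2) by (simp add: stochastic_matrix_def)
  then have "0 < p i k" "0 < nstep p n k j"
    using k(2) by (auto simp: zero_less_mult_iff)
  from Suc.IH[OF this(2) k(1)] obtain s where s: "s 0 = k" "s n = j" "\<forall>k\<le>n. 1 \<le> s k"
    "\<forall>k<n. 0 < p (s k) (s (Suc k))"
    by blast
  show ?case
  proof (intro exI[of _ "case_nat i s"] conjI allI impI)
    fix l
    show "1 \<le> (case l of 0 \<Rightarrow> i | Suc x \<Rightarrow> s x)" if "l \<le> Suc n"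
      using that s(3) Suc.prems(2) by (cases l) auto
    show "0 < p (case l of 0 \<Rightarrow> i | Suc x \<Rightarrow> s x) (case Suc l of 0 \<Rightarrow> i | Suc x \<Rightarrow> s x)" if "l < Suc n"
      using that s \<open>0 < p i k\<close> by (cases l) auto
  qed (use s in auto)
qed

context markov_shift
begin

lemma emeasure_return_pos:
  assumes "0 < nstep p n 1 1"
  shows "0 < emeasure \<nu> (base \<inter> {y \<in> space \<nu>. y (int n) = 1})"
proof -
  obtain s where s: "s 0 = 1" "s n = 1" "\<forall>k\<le>n. 1 \<le> s k" "\<forall>k<n. 0 < p (s k) (s (Suc k))"
    using nstep_pos_path[OF stochastic assms] by auto
  let ?t = "\<lambda>i. s (nat i)"
  have "0 < wt 0 (int n) ?t"
    unfolding wt_def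
  proof (intro mult_pos_pos prod_pos ballI)
    fix i assume "i \<in> {0..<int n}"
    then show "0 < p (?t i) (?t (i + 1))"
      using s(4) by (auto simp: nat_add_distrib)
  qed (use s rho_pos in simp)
  moreover have "emeasure \<nu> (window 0 (int n) ?t) = ennreal (wt 0 (int n) ?t)"
    by (rule emeasure_window) (use s in auto)
  moreover have "emeasure \<nu> (window 0 (int n) ?t) \<le> emeasure \<nu> (base \<inter> {y \<in> space \<nu>. y (int n) = 1})"
  proof (rule emeasure_mono)
    show "window 0 (int n) ?t \<subseteq> base \<inter> {y \<in> space \<nu>. y (int n) = 1}"
      using s by (auto simp: window_def base_iff space_nu)
    show "base \<inter> {y \<in> space \<nu>. y (int n) = 1} \<in> sets \<nu>"
      using sets_base sets_coordinate[of "\<lambda>x. x = 1" "int n"] by (auto simp: sets_nu space_nu)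
  qed
  ultimately have "ennreal (wt 0 (int n) ?t) \<le> emeasure \<nu> (base \<inter> {y \<in> space \<nu>. y (int n) = 1})"
    "0 < ennreal (wt 0 (int n) ?t)"
    by simp_all
  then show ?thesis
    by (rule less_le_trans[rotated])
qed

text \<open>Conservativity yields infinitely many visits for almost all paths that start in
  \<open>base\<close>. The set of paths with infinitely many visits is shift invariant, and
  ergodicity extends the claim to almost all paths.\<close>

lemma AE_visits:
  assumes cons: "conservative \<nu> path_shift" and erg: "ergodic \<nu> path_shift"
  shows "AE y in \<nu>. \<forall>m::nat. \<exists>n\<ge>m. y (int n) = 1"
proof -
  define I where "I = {y \<in> space \<nu>. \<forall>m::nat. \<exists>n\<ge>m. y (int n) = 1}"
  have meas: "{y \<in> space \<nu>. y i = 1} \<in> sets \<nu>" for i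
    using sets_coordinate[of "\<lambda>x. x = 1" i] by (simp add: sets_nu space_nu)
  have I: "I \<in> sets \<nu>"
    unfolding I_def by (intro sets.sets_Collect_countable_All sets.sets_Collect_countable_Ex sets.sets_Collect_conj meas)
      auto
  have inv: "preim \<nu> path_shift 1 I = I"
  proof -
    have eq: "(\<forall>m::nat. \<exists>n\<ge>m. y (int n + 1) = 1) \<longleftrightarrow> (\<forall>m::nat. \<exists>n\<ge>m. y (int n) = 1)" for y :: "int \<Rightarrow> nat"
    proof (intro iffI allI)
      fix m :: nat assume "\<forall>m::nat. \<exists>n\<ge>m. y (int n + 1) = 1"
      then obtain n where "n \<ge> m" "y (int n + 1) = 1"
        by blast
      then show "\<exists>n\<ge>m. y (int n) = 1"
        by (intro exI[of _ "Suc n"]) (auto simp: algebra_simps)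
    next
      fix m :: nat assume "\<forall>m::nat. \<exists>n\<ge>m. y (int n) = 1"
      then obtain n where "n \<ge> Suc m" "y (int n) = 1"
        by blast
      then show "\<exists>n\<ge>m. y (int n + 1) = 1"
        by (intro exI[of _ "n - 1"]) (auto simp: of_nat_diff)
    qed
    have z: "zshift 1 y (int n) = y (int n + 1)" for y n
      by (simp add: zshift_def)
    have f1: "(zshift 1 ^^ 1) y = zshift 1 y" for y
      by simp
    have "y \<in> preim \<nu> path_shift 1 I \<longleftrightarrow> y \<in> space \<nu> \<and> (\<forall>m::nat. \<exists>n\<ge>m. zshift 1 y (int n) = 1)" for y
      unfolding preim_def I_def path_shift_eq space_nu
      by (simp only: vimage_eq Int_iff mem_Collect_eq f1 zshift_in_paths conj_ac conj_absorb conj_left_absorb)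
    then have "y \<in> preim \<nu> path_shift 1 I \<longleftrightarrow> y \<in> I" for y
      unfolding z eq by (simp only: I_def mem_Collect_eq)
    then show ?thesis
      by (simp only: set_eq_iff simp_thms)
  qed
  have "AE y in \<nu>. zshift (int t) y \<in> base \<longrightarrow> (\<exists>n\<ge>1. zshift (int (n + t)) y \<in> base)" for t
    using preserves_AE[OF preserves_zshift conservative_return[OF preserves_path_shift cons sets_base], of "int t"]
    by (simp add: path_shift_funpow zshift_zshift)
  then have "AE y in \<nu>. \<forall>t. zshift (int t) y \<in> base \<longrightarrow> (\<exists>n\<ge>1. zshift (int (n + t)) y \<in> base)"
    by (simp add: AE_all_countable)
  then have base: "AE y in \<nu>. y \<in> base \<longrightarrow> y \<in> I"
    using AE_space
  proof eventually_elim
    case (elim y)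
    have b: "zshift (int t) y \<in> base \<longleftrightarrow> y (int t) = 1" for t
      using elim(2) by (simp add: base_iff space_nu) (simp add: zshift_def)
    have nxt: "\<exists>n>t. y (int n) = 1" if t: "y (int t) = 1" for t
    proof -
      obtain n where "n \<ge> 1" "zshift (int (n + t)) y \<in> base"
        using elim(1) t b[of t] by blast
      then show ?thesis
        using b[of "n + t"] by (intro exI[of _ "n + t"]) auto
    qed
    show ?case
    proof
      assume y: "y \<in> base"
      have "\<exists>n\<ge>m. y (int n) = 1" for m
      proof (induction m)
        case 0
        then show ?case
          using y by (intro exI[of _ 0]) (simp add: base_iff)
      next
        case (Suc m)
        then obtain n where "n \<ge> m" "y (int n) = 1"
          by blast
        then show ?case
          using nxt[of n] by (meson Suc_leI le_less_trans)
      qed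
      then show "y \<in> I"
        using elim(2) by (simp add: I_def)
    qed
  qed
  have "emeasure \<nu> I \<noteq> 0"
  proof
    assume "emeasure \<nu> I = 0"
    then have "AE y in \<nu>. y \<notin> I"
      using I by (intro AE_not_in) (auto simp: null_sets_def)
    with base have "AE y in \<nu>. y \<notin> base"
      by eventually_elim auto
    then have "emeasure \<nu> base = 0"
      using sets_base by (subst emeasure_eq_AE[where B = "{}"]) auto
    then show False
      using rho_pos[of 1] by (simp add: emeasure_base)
  qed
  then have "emeasure \<nu> (space \<nu> - I) = 0"
    using erg I inv unfolding ergodic_def by blast
  then have "AE y in \<nu>. y \<notin> space \<nu> - I"
    using I by (intro AE_not_in) (auto simp: null_sets_def)
  then show ?thesis
    using AE_space by eventually_elim (auto simp: I_def)
qed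

text \<open>The independence identity says that two multiples of future laws are the same measure;
  here \<open>g\<close> is integrated against both.\<close>

lemma integral_future:
  fixes g :: "(int \<Rightarrow> nat) \<Rightarrow> complex"
  assumes "past_independent H" and g: "g \<in> borel_measurable paths" and fin: "emeasure \<nu> H < \<infinity>"
  shows "\<rho> 1 *\<^sub>R (LINT y:H|\<nu>. g (future y)) = measure \<nu> H *\<^sub>R (LINT y:base|\<nu>. g (future y))"
proof -
  have H: "H \<in> sets \<nu>"
    using assms(1) by (simp add: past_independent_def)
  have law: "(LINT y:K|\<nu>. g (future y)) = (\<integral>y. g y \<partial>future_law K)" if K: "K \<in> sets \<nu>" for K
  proof -
    have gf: "(\<lambda>y. g (future y)) \<in> borel_measurable \<nu>"
      by (rule measurable_compose[OF measurable_future_nu g])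
    have "density \<nu> (indicator K) = density \<nu> (\<lambda>y. ennreal (indicator K y))"
      by (simp add: ennreal_indicator)
    then have "(\<integral>y. g y \<partial>future_law K) = (\<integral>y. g (future y) \<partial>density \<nu> (\<lambda>y. ennreal (indicator K y)))"
      unfolding future_law_def using measurable_future_nu g by (subst integral_distr) auto
    also have "\<dots> = (LINT y:K|\<nu>. g (future y))"
      unfolding set_lebesgue_integral_def using K gf by (intro integral_density) auto
    finally show ?thesis ..
  qed
  have g': "g \<in> borel_measurable (future_law K)" for K
    using g by (simp add: measurable_cong_sets[OF sets_future_law refl])
  have "density (future_law H) (\<lambda>_. ennreal (\<rho> 1)) = density (future_law base) (\<lambda>_. ennreal (measure \<nu> H))"
  proof (rule measure_eqI)
    fix G assume "G \<in> sets (density (future_law H) (\<lambda>_. ennreal (\<rho> 1)))"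
    then have "G \<in> sets paths"
      by (simp add: sets_future_law)
    then show "emeasure (density (future_law H) (\<lambda>_. ennreal (\<rho> 1))) G
        = emeasure (density (future_law base) (\<lambda>_. ennreal (measure \<nu> H))) G"
      using assms(1) fin
      by (simp add: emeasure_density_const sets_future_law emeasure_future_law H sets_base
          past_independent_def emeasure_eq_ennreal_measure less_top)
  qed (simp add: sets_future_law)
  then have "(\<integral>y. g y \<partial>density (future_law H) (\<lambda>_. ennreal (\<rho> 1)))
      = (\<integral>y. g y \<partial>density (future_law base) (\<lambda>_. ennreal (measure \<nu> H)))"
    by simp
  then show ?thesis
    unfolding law[OF H] law[OF sets_base] using g' rho_pos[of 1]
    by (simp add: integral_density)
qed

end

section \<open>Eigenfunctions of the product\<close>

locale product_eigenfunction = markov_shift p \<rho> \<nu>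
  for p :: "nat \<Rightarrow> nat \<Rightarrow> real" and \<rho> :: "nat \<Rightarrow> real" and \<nu> :: "(int \<Rightarrow> nat) measure" +
  fixes \<mu> :: "'b measure" and T :: "'b \<Rightarrow> 'b" and f :: "(int \<Rightarrow> nat) \<times> 'b \<Rightarrow> complex"
    and l :: complex and K :: real
  assumes sigma_finite_mu: "sigma_finite_measure \<mu>" and preserves_T: "preserves \<mu> T"
    and conservative_prod: "conservative (\<nu> \<Otimes>\<^sub>M \<mu>) (map_prod path_shift T)"
    and f_meas [measurable]: "f \<in> borel_measurable (\<nu> \<Otimes>\<^sub>M \<mu>)"
    and f_bound: "\<And>z. norm (f z) \<le> K"
    and norm_l: "norm l = 1"
    and f_eigen: "AE z in \<nu> \<Otimes>\<^sub>M \<mu>. f (map_prod path_shift T z) = l * f z"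
begin

abbreviation "M \<equiv> \<nu> \<Otimes>\<^sub>M \<mu>"
abbreviation "R \<equiv> map_prod path_shift T"

section \<open>Approximation by functions of a finite past\<close>

definition depends_from :: "nat \<Rightarrow> ((int \<Rightarrow> nat) \<times> 'b \<Rightarrow> complex) \<Rightarrow> bool" where
  "depends_from k h \<longleftrightarrow> (\<forall>y\<in>space \<nu>. \<forall>y'\<in>space \<nu>. \<forall>x. (\<forall>i\<ge>- int k. y i = y' i) \<longrightarrow> h (y, x) = h (y', x))"

lemma depends_from_mono: "depends_from k h \<Longrightarrow> k \<le> k' \<Longrightarrow> depends_from k' h"
  unfolding depends_from_def by (meson dual_order.trans neg_le_iff_le of_nat_le_iff)

text \<open>\<open>N\<close> will be \<open>M\<close> restricted to a set of finite measure, on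
  which the bounded \<open>f\<close> is integrable; measurability always refers to
  \<open>M\<close>.\<close>

definition approximable :: "((int \<Rightarrow> nat) \<times> 'b) measure \<Rightarrow> ((int \<Rightarrow> nat) \<times> 'b \<Rightarrow> complex) \<Rightarrow> bool" where
  "approximable N \<phi> \<longleftrightarrow> (\<forall>\<epsilon>>0. \<exists>k h. h \<in> borel_measurable M \<and> depends_from k h \<and>
     (\<integral>\<^sup>+z. ennreal (norm (\<phi> z - h z)) \<partial>N) < ennreal \<epsilon>)"

lemma approximable_refl:
  assumes "h \<in> borel_measurable M" "depends_from k h"
  shows "approximable N h"
  unfolding approximable_def using assms by (intro allI impI exI[of _ k] exI[of _ h]) auto

lemma approximable_add:
  assumes N [measurable_cong]: "sets N = sets M" and [measurable]: "\<phi> \<in> borel_measurable M" "\<psi> \<in> borel_measurable M"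
    and "approximable N \<phi>" "approximable N \<psi>" and c: "c \<in> {1, -1}"
  shows "approximable N (\<lambda>z. \<phi> z + c * \<psi> z)"
  unfolding approximable_def
proof (intro allI impI)
  fix \<epsilon> :: real assume \<epsilon>: "\<epsilon> > 0"
  obtain k h where h [measurable]: "h \<in> borel_measurable M" "depends_from k h"
    "(\<integral>\<^sup>+z. ennreal (norm (\<phi> z - h z)) \<partial>N) < ennreal (\<epsilon> / 2)"
    using assms(4) \<epsilon> unfolding approximable_def by (meson half_gt_zero)
  obtain k' h' where h' [measurable]: "h' \<in> borel_measurable M" "depends_from k' h'"
    "(\<integral>\<^sup>+z. ennreal (norm (\<psi> z - h' z)) \<partial>N) < ennreal (\<epsilon> / 2)"
    using assms(5) \<epsilon> unfolding approximable_def by (meson half_gt_zero)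
  have "depends_from (max k k') h" "depends_from (max k k') h'"
    using h(2) h'(2) by (auto intro: depends_from_mono)
  then have "depends_from (max k k') (\<lambda>z. h z + c * h' z)"
    unfolding depends_from_def by metis
  moreover have "(\<integral>\<^sup>+z. ennreal (norm (\<phi> z + c * \<psi> z - (h z + c * h' z))) \<partial>N) < ennreal \<epsilon>"
  proof -
    have nc: "norm c = 1"
      using c by auto
    have "(\<integral>\<^sup>+z. ennreal (norm (\<phi> z + c * \<psi> z - (h z + c * h' z))) \<partial>N)
        \<le> (\<integral>\<^sup>+z. ennreal (norm (\<phi> z - h z)) + ennreal (norm (\<psi> z - h' z)) \<partial>N)"
    proof (rule nn_integral_mono)
      fix z
      have "norm ((\<phi> z - h z) + c * (\<psi> z - h' z)) \<le> norm (\<phi> z - h z) + norm (\<psi> z - h' z)"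
        using norm_triangle_ineq[of "\<phi> z - h z" "c * (\<psi> z - h' z)"] by (simp add: norm_mult nc)
      then show "ennreal (norm (\<phi> z + c * \<psi> z - (h z + c * h' z)))
          \<le> ennreal (norm (\<phi> z - h z)) + ennreal (norm (\<psi> z - h' z))"
        by (simp add: ennreal_plus[symmetric] algebra_simps del: ennreal_plus)
    qed
    also have "\<dots> = (\<integral>\<^sup>+z. ennreal (norm (\<phi> z - h z)) \<partial>N) + (\<integral>\<^sup>+z. ennreal (norm (\<psi> z - h' z)) \<partial>N)"
      by (rule nn_integral_add) measurable
    also have "\<dots> < ennreal (\<epsilon> / 2) + ennreal (\<epsilon> / 2)"
      by (rule add_strict_mono[OF h(3) h'(3)])
    also have "\<dots> = ennreal \<epsilon>"
      using \<epsilon> by (simp add: ennreal_plus[symmetric] del: ennreal_plus)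
    finally show ?thesis .
  qed
  ultimately show "\<exists>k h. h \<in> borel_measurable M \<and> depends_from k h \<and>
      (\<integral>\<^sup>+z. ennreal (norm (\<phi> z + c * \<psi> z - h z)) \<partial>N) < ennreal \<epsilon>"
    by (intro exI[of _ "max k k'"] exI[of _ "\<lambda>z. h z + c * h' z"]) auto
qed

lemma approximable_lim:
  assumes N [measurable_cong]: "sets N = sets M" and [measurable]: "\<phi> \<in> borel_measurable M"
    "\<And>i. s i \<in> borel_measurable M" and appr: "\<And>i. approximable N (s i)"
    and lim: "(\<lambda>i. \<integral>\<^sup>+z. ennreal (norm (\<phi> z - s i z)) \<partial>N) \<longlonglongrightarrow> 0"
  shows "approximable N \<phi>"
  unfolding approximable_def
proof (intro allI impI)
  fix \<epsilon> :: real assume \<epsilon>: "\<epsilon> > 0"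
  have "eventually (\<lambda>i. (\<integral>\<^sup>+z. ennreal (norm (\<phi> z - s i z)) \<partial>N) < ennreal (\<epsilon> / 2)) sequentially"
    using order_tendstoD(2)[OF lim] \<epsilon> by simp
  then obtain i where i: "(\<integral>\<^sup>+z. ennreal (norm (\<phi> z - s i z)) \<partial>N) < ennreal (\<epsilon> / 2)"
    by (auto simp: eventually_sequentially)
  obtain k h where h [measurable]: "h \<in> borel_measurable M" "depends_from k h"
    "(\<integral>\<^sup>+z. ennreal (norm (s i z - h z)) \<partial>N) < ennreal (\<epsilon> / 2)"
    using appr[of i] \<epsilon> unfolding approximable_def by (meson half_gt_zero)
  have "(\<integral>\<^sup>+z. ennreal (norm (\<phi> z - h z)) \<partial>N)
      \<le> (\<integral>\<^sup>+z. ennreal (norm (\<phi> z - s i z)) + ennreal (norm (s i z - h z)) \<partial>N)"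
  proof (rule nn_integral_mono)
    fix z
    have "norm (\<phi> z - h z) \<le> norm (\<phi> z - s i z) + norm (s i z - h z)"
      using norm_triangle_ineq[of "\<phi> z - s i z" "s i z - h z"] by simp
    then show "ennreal (norm (\<phi> z - h z)) \<le> ennreal (norm (\<phi> z - s i z)) + ennreal (norm (s i z - h z))"
      by (simp add: ennreal_plus[symmetric] del: ennreal_plus)
  qed
  also have "\<dots> = (\<integral>\<^sup>+z. ennreal (norm (\<phi> z - s i z)) \<partial>N) + (\<integral>\<^sup>+z. ennreal (norm (s i z - h z)) \<partial>N)"
    by (rule nn_integral_add) measurable
  also have "\<dots> < ennreal (\<epsilon> / 2) + ennreal (\<epsilon> / 2)"
    by (rule add_strict_mono[OF i h(3)])
  also have "\<dots> = ennreal \<epsilon>"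
    using \<epsilon> by (simp add: ennreal_plus[symmetric] del: ennreal_plus)
  finally show "\<exists>k h. h \<in> borel_measurable M \<and> depends_from k h \<and>
      (\<integral>\<^sup>+z. ennreal (norm (\<phi> z - h z)) \<partial>N) < ennreal \<epsilon>"
    using h(1,2) by blast
qed

lemma approximable_UN:
  fixes c :: complex
  assumes N [measurable_cong]: "sets N = sets M" and fin: "emeasure N (space N) < \<infinity>"
    and disj: "disjoint_family A" and A [measurable]: "\<And>i::nat. A i \<in> sets M"
    and appr: "\<And>i. approximable N (\<lambda>z. indicator (A i) z *\<^sub>R c)"
  shows "approximable N (\<lambda>z. indicator (\<Union>i. A i) z *\<^sub>R c)"
proof (rule approximable_lim[OF N])
  have part: "(\<lambda>z. indicator (\<Union>i<n. A i) z *\<^sub>R c) = (\<lambda>z. \<Sum>i<n. indicator (A i) z *\<^sub>R c)" for n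
  proof
    fix z
    have "(indicator (\<Union>i<n. A i) z :: real) = (\<Sum>i<n. indicator (A i) z)"
      by (rule indicator_UN_disjoint) (use disj in \<open>auto simp: disjoint_family_on_def\<close>)
    then show "indicator (\<Union>i<n. A i) z *\<^sub>R c = (\<Sum>i<n. indicator (A i) z *\<^sub>R c)"
      by (simp add: scaleR_sum_left)
  qed
  show "approximable N (\<lambda>z. indicator (\<Union>i<n. A i) z *\<^sub>R c)" for n
    unfolding part
  proof (induction n)
    case 0
    then show ?case
      by (auto intro!: approximable_refl simp: depends_from_def)
  next
    case (Suc n)
    from approximable_add[OF N _ _ Suc appr[of n], of 1] show ?case
      by simp
  qed
  show "(\<lambda>n. \<integral>\<^sup>+z. ennreal (norm (indicator (\<Union>i. A i) z *\<^sub>R c - indicator (\<Union>i<n. A i) z *\<^sub>R c)) \<partial>N) \<longlonglongrightarrow> 0"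
  proof (rule nn_integral_dominated_convergence_norm[where w = "\<lambda>_. norm c"])
    show "(\<integral>\<^sup>+z. ennreal (norm c) \<partial>N) < \<infinity>"
      using fin by (simp add: ennreal_mult_less_top)
    show "AE z in N. (\<lambda>n. indicator (\<Union>i<n. A i) z *\<^sub>R c) \<longlonglongrightarrow> indicator (\<Union>i. A i) z *\<^sub>R c"
      by (intro AE_I2 tendsto_scaleR tendsto_const LIMSEQ_indicator_UN)
  qed (auto simp: indicator_def)
qed measurable

lemma space_M: "space M = space \<nu> \<times> space \<mu>"
  by (rule space_pair_measure)

lemma approximable_indicator_compl:
  fixes c :: complex
  assumes N: "sets N = sets M" and "A \<subseteq> B" "A \<in> sets M" "B \<in> sets M"
    and "approximable N (\<lambda>z. indicator B z *\<^sub>R c)" "approximable N (\<lambda>z. indicator A z *\<^sub>R c)"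
  shows "approximable N (\<lambda>z. indicator (B - A) z *\<^sub>R c)"
proof -
  have "(\<lambda>z. indicator (B - A) z *\<^sub>R c) = (\<lambda>z. indicator B z *\<^sub>R c + (-1) * (indicator A z *\<^sub>R c))"
    using assms(2) by (auto simp: fun_eq_iff indicator_def)
  then show ?thesis
    using approximable_add[OF N _ _ assms(5,6), of "-1"] assms(3,4) by simp
qed

text \<open>Indicators of windows need no approximation. The sets with approximable indicator are
  closed under complements and countable disjoint unions, so the generators can be enlarged twice:
  from windows to all sets of paths with a fixed second factor, then from rectangles to the
  product.\<close>

lemma approximable_indicator:
  fixes c :: complex
  assumes N: "sets N = sets M" and fin: "emeasure N (space N) < \<infinity>" and A: "A \<in> sets M"
  shows "approximable N (\<lambda>z. indicator A z *\<^sub>R c)"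
proof -
  let ?P = "\<lambda>A. approximable N (\<lambda>z. indicator A z *\<^sub>R c)"
  have whole: "?P (space \<nu> \<times> b)" if "b \<in> sets \<mu>" for b
    by (rule approximable_refl[of _ 0]) (use that in \<open>auto simp: depends_from_def indicator_def\<close>)
  have none: "?P {}"
    by (rule approximable_refl[of _ 0]) (auto simp: depends_from_def)
  have rect: "?P (a \<times> b)" if a: "a \<in> sets \<nu>" and b: "b \<in> sets \<mu>" for a b
  proof -
    have a': "a \<in> sigma_sets (space paths) {window (- int n) (int n) s | n s. True}"
      using a sets_paths_eq by (simp add: sets_nu)
    have W: "{window (- int n) (int n) s | n s. True} \<subseteq> Pow (space paths)"
      by (auto simp: window_def)
    from Int_stable_windows W a' show ?thesis
    proof (induction rule: sigma_sets_induct_disjoint)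
      case (basic a)
      then obtain n s where a: "a = window (- int n) (int n) s"
        by blast
      have "depends_from n (\<lambda>z. indicator (a \<times> b) z *\<^sub>R c)"
        unfolding a depends_from_def indicator_def window_def space_nu by auto
      moreover have "a \<in> sets \<nu>"
        unfolding a sets_nu by (rule sets_window)
      ultimately show ?case
        using b by (intro approximable_refl[of _ n]) auto
    next
      case empty
      then show ?case
        using none by simp
    next
      case (compl a)
      have a: "a \<in> sets \<nu>"
        using compl(1) sets_paths_eq by (simp add: sets_nu)
      have "(space paths - a) \<times> b = space \<nu> \<times> b - a \<times> b"
        by (auto simp: space_nu)
      moreover have "?P (space \<nu> \<times> b - a \<times> b)"
        using a b sets.sets_into_space[OF a]
        by (intro approximable_indicator_compl[OF N _ _ _ whole[OF b] compl(2)]) auto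
      ultimately show ?case
        by simp
    next
      case (union A)
      have "A i \<in> sets \<nu>" for i
        using union(2) sets_paths_eq by (auto simp: sets_nu)
      then have "?P (\<Union>i. A i \<times> b)"
        using union(1,3) b by (intro approximable_UN[OF N fin]) (auto simp: disjoint_family_on_def)
      moreover have "(\<Union>i. A i \<times> b) = \<Union> (range A) \<times> b"
        by auto
      ultimately show ?case
        by simp
    qed
  qed
  have "A \<in> sigma_sets (space \<nu> \<times> space \<mu>) {a \<times> b | a b. a \<in> sets \<nu> \<and> b \<in> sets \<mu>}"
    using A by (simp add: sets_pair_measure)
  with Int_stable_pair_measure_generator pair_measure_closed show ?thesis
  proof (induction rule: sigma_sets_induct_disjoint)
    case (basic A)
    then show ?case
      using rect by blast
  next
    case empty
    show ?case
      by (rule none)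
  next
    case (compl A)
    have "A \<in> sets M"
      using compl(1) by (simp add: sets_pair_measure)
    then show ?case
      using sets.sets_into_space[of A M]
      by (intro approximable_indicator_compl[OF N _ _ _ whole[OF sets.top] compl(2)]) (auto simp: space_M)
  next
    case (union A)
    have "A i \<in> sets M" for i
      using union(2) by (auto simp: sets_pair_measure)
    then show ?case
      using union(1,3) by (intro approximable_UN[OF N fin])
  qed
qed

lemma approximable_integrable:
  assumes N: "sets N = sets M" and fin: "emeasure N (space N) < \<infinity>" and "integrable N \<phi>"
  shows "approximable N \<phi>"
  using assms(3)
proof (induction rule: integrable_induct)
  case (base A c)
  then show ?case
    using approximable_indicator[OF N fin, of A c] by (simp add: N)
next
  case (add f g)
  have "f \<in> borel_measurable M" "g \<in> borel_measurable M"
    using add.hyps[THEN borel_measurable_integrable] by (simp_all add: measurable_cong_sets[OF N refl])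
  from approximable_add[OF N this add.IH, of 1] show ?case
    by simp
next
  case (lim f s)
  have "f \<in> borel_measurable M" "s i \<in> borel_measurable M" for i
    using lim.hyps(1)[of i, THEN borel_measurable_integrable] lim.hyps(4)[THEN borel_measurable_integrable]
    by (simp_all add: measurable_cong_sets[OF N refl])
  then show ?case
  proof (rule approximable_lim[OF N _ _ lim.IH])
    show "(\<lambda>i. \<integral>\<^sup>+z. ennreal (norm (f z - s i z)) \<partial>N) \<longlonglongrightarrow> 0"
    proof (rule nn_integral_dominated_convergence_norm[where w = "\<lambda>z. 2 * norm (f z)"])
      show "AE z in N. norm (s j z) \<le> 2 * norm (f z)" for j
        using lim.hyps(3) by auto
      show "AE z in N. (\<lambda>i. s i z) \<longlonglongrightarrow> f z"
        using lim.hyps(2) by auto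
      have "(\<integral>\<^sup>+z. ennreal (2 * norm (f z)) \<partial>N) = 2 * (\<integral>\<^sup>+z. ennreal (norm (f z)) \<partial>N)"
        using lim.hyps(4) by (subst nn_integral_cmult[symmetric]) (auto simp: ennreal_mult)
      then show "(\<integral>\<^sup>+z. ennreal (2 * norm (f z)) \<partial>N) < \<infinity>"
        using lim.hyps(4) by (simp add: integrable_iff_bounded ennreal_mult_less_top)
    qed (use lim.hyps(1,4) in auto)
  qed
qed

lemma pair_sigma_finite: "pair_sigma_finite \<nu> \<mu>"
  by (rule pair_sigma_finite.intro[OF sigma_finite_nu sigma_finite_mu])

lemma preserves_R: "preserves M R"
  by (rule preserves_map_prod[OF preserves_path_shift preserves_T sigma_finite_mu])

lemma R_iter: "(R ^^ n) (y, x) = (zshift (int n) y, (T ^^ n) x)"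
  unfolding funpow_map_prod path_shift_funpow by simp

lemma measurable_R_iter [measurable]: "(R ^^ n) \<in> measurable M M"
  by (rule preserves_measurable[OF preserves_funpow[OF preserves_R]])

lemma AE_f_iter: "AE z in M. \<forall>n. f ((R ^^ n) z) = l ^ n * f z"
proof -
  have "AE z in M. f (R ((R ^^ n) z)) = l * f ((R ^^ n) z)" for n
    using preserves_AE[OF preserves_funpow[OF preserves_R] f_eigen] .
  then have "AE z in M. \<forall>n. f (R ((R ^^ n) z)) = l * f ((R ^^ n) z)"
    by (simp add: AE_all_countable)
  then show ?thesis
  proof (rule AE_mp, intro AE_I2 impI allI)
    fix z n assume "\<forall>n. f (R ((R ^^ n) z)) = l * f ((R ^^ n) z)"
    then show "f ((R ^^ n) z) = l ^ n * f z"
      by (induction n) (auto simp: mult.assoc)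
  qed
qed

section \<open>Removing the dependence on the past\<close>

text \<open>The new function is \<open>h\<close> at the first return to \<open>D\<close>, corrected
  by a power of the eigenvalue. The return time depends on \<open>x\<close> and on coordinates from
  1 on, and at least one shift has moved the remaining dependence a place to the right. The error at
  a point is the old error at its return point, and first returns do not increase integrals over
  \<open>D\<close>.\<close>

lemma approximation_step:
  assumes E [measurable]: "E \<in> sets \<mu>" and h [measurable]: "h \<in> borel_measurable M"
    and dep: "depends_from (Suc k) h"
  defines "D \<equiv> base \<times> E"
  shows "\<exists>h'. h' \<in> borel_measurable M \<and> depends_from k h' \<and>
    (\<integral>\<^sup>+z. indicator D z * ennreal (norm (f z - h' z)) \<partial>M)
      \<le> (\<integral>\<^sup>+z. indicator D z * ennreal (norm (f z - h z)) \<partial>M)"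
proof -
  have D [measurable]: "D \<in> sets M"
    unfolding D_def using sets_base by simp
  define P where "P z n \<longleftrightarrow> 1 \<le> n \<and> (R ^^ n) z \<in> D" for z n
  define ret where "ret z = (LEAST n. P z n)" for z
  define g where "g n z = inverse l ^ n * h ((R ^^ n) z)" for n z
  \<comment> \<open>By conservativity the default 0 is used only on a null part of
    \<open>D\<close>.\<close>
  define h' where "h' z = (if \<exists>n. P z n then g (ret z) z else 0)" for z
  have P [measurable]: "Measurable.pred M (\<lambda>z. P z n)" for n
    unfolding P_def by measurable
  have [measurable]: "ret \<in> measurable M (count_space UNIV)"
    unfolding ret_def by measurable
  have [measurable]: "g n \<in> borel_measurable M" for n
    unfolding g_def by measurable
  have "(\<lambda>z. g (ret z) z) \<in> borel_measurable M"
    by (rule measurable_compose_countable[where f = g]) auto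
  then have h'm: "h' \<in> borel_measurable M"
    unfolding h'_def by measurable
  have "depends_from k h'"
    unfolding depends_from_def
  proof (intro ballI allI impI)
    fix y y' x assume y: "y \<in> space \<nu>" "y' \<in> space \<nu>" and eq: "\<forall>i\<ge>- int k. y i = y' i"
    have "P (w, x) n \<longleftrightarrow> 1 \<le> n \<and> w (int n) = 1 \<and> (T ^^ n) x \<in> E" if "w \<in> space \<nu>" for w n
      using that unfolding P_def D_def R_iter by (auto simp: base_iff space_nu) (auto simp: zshift_def)
    then have P_eq: "P (y, x) = P (y', x)"
      using y eq by (auto simp: fun_eq_iff)
    show "h' (y, x) = h' (y', x)"
    proof (cases "\<exists>n. P (y, x) n")
      case True
      then have "P (y, x) (ret (y, x))"
        unfolding ret_def by (rule LeastI_ex)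
      then have r: "1 \<le> ret (y, x)"
        by (simp add: P_def)
      have "h (zshift (int n) y, x') = h (zshift (int n) y', x')" if "1 \<le> n" for n x'
      proof -
        have "\<forall>i\<ge>- int (Suc k). zshift (int n) y i = zshift (int n) y' i"
          using eq that by (auto simp: zshift_def)
        then show ?thesis
          using dep y unfolding depends_from_def by (simp add: space_nu)
      qed
      then show ?thesis
        using r True P_eq unfolding h'_def g_def R_iter ret_def by simp
    next
      case False
      then show ?thesis
        using P_eq by (simp add: h'_def)
    qed
  qed
  moreover have "(\<integral>\<^sup>+z. indicator D z * ennreal (norm (f z - h' z)) \<partial>M)
      \<le> (\<integral>\<^sup>+z. indicator D z * ennreal (norm (f z - h z)) \<partial>M)"
  proof -
    let ?G = "\<lambda>z. ennreal (norm (f z - h z))"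
    have "(\<integral>\<^sup>+z. indicator D z * ennreal (norm (f z - h' z)) \<partial>M)
        \<le> (\<integral>\<^sup>+z. (\<Sum>n. indicator (first_return R D (Suc n)) z * ?G ((R ^^ Suc n) z)) \<partial>M)"
    proof (rule nn_integral_mono_AE)
      show "AE z in M. indicator D z * ennreal (norm (f z - h' z))
          \<le> (\<Sum>n. indicator (first_return R D (Suc n)) z * ?G ((R ^^ Suc n) z))"
        using conservative_return[OF preserves_R conservative_prod D] AE_f_iter
      proof eventually_elim
        case (elim z)
        show ?case
        proof (cases "z \<in> D")
          case True
          then have ex: "\<exists>n. P z n"
            using elim(1) by (auto simp: P_def)
          then have r: "P z (ret z)"
            unfolding ret_def by (rule LeastI_ex)
          obtain m where m: "ret z = Suc m"
            using r by (cases "ret z") (auto simp: P_def)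
          have "\<not> P z i" if "i < ret z" for i
            using that not_less_Least unfolding ret_def by blast
          then have fr: "z \<in> first_return R D (Suc m)"
            using True r m unfolding first_return_def P_def by auto
          have l: "inverse l ^ n * (l ^ n * a) = a" for n a
            using norm_l by (auto simp: power_inverse field_simps)
          have "f z - h' z = inverse l ^ Suc m * (f ((R ^^ Suc m) z) - h ((R ^^ Suc m) z))"
            using ex elim(2) m unfolding h'_def g_def by (simp add: right_diff_distrib l del: power_Suc funpow.simps)
          then have "norm (f z - h' z) = norm (f ((R ^^ Suc m) z) - h ((R ^^ Suc m) z))"
            using norm_l by (simp add: norm_mult norm_power norm_inverse del: power_Suc funpow.simps)
          then have "indicator D z * ennreal (norm (f z - h' z))
              = (\<Sum>n\<in>{m}. indicator (first_return R D (Suc n)) z * ?G ((R ^^ Suc n) z))"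
            using True fr by (simp del: funpow.simps)
          also have "\<dots> \<le> (\<Sum>n. indicator (first_return R D (Suc n)) z * ?G ((R ^^ Suc n) z))"
            by (rule sum_le_suminf) auto
          finally show ?thesis .
        qed simp
      qed
    qed
    also have "\<dots> \<le> (\<integral>\<^sup>+z. indicator D z * ?G z \<partial>M)"
      by (rule nn_integral_first_return_le[OF preserves_R D]) measurable
    finally show ?thesis .
  qed
  ultimately show ?thesis
    using h'm by blast
qed

text \<open>\<open>E\<close> has finite measure, so some finite past is enough for the given error;
  its coordinates are then removed one by one without increasing the error.\<close>

lemma future_approximation:
  assumes E: "E \<in> sets \<mu>" "emeasure \<mu> E < \<infinity>" and \<epsilon>: "0 < \<epsilon>"
  shows "\<exists>h. h \<in> borel_measurable M \<and> depends_from 0 h \<and>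
    (\<integral>\<^sup>+z. indicator (base \<times> E) z * ennreal (norm (f z - h z)) \<partial>M) < ennreal \<epsilon>"
proof -
  let ?D = "base \<times> E"
  interpret \<mu>: sigma_finite_measure \<mu>
    by (rule sigma_finite_mu)
  have D: "?D \<in> sets M"
    using sets_base E(1) by simp
  define N where "N = density M (indicator ?D)"
  have N: "sets N = sets M"
    by (simp add: N_def)
  have "emeasure N (space N) = emeasure M ?D"
    unfolding N_def using D sets.sets_into_space[OF D]
    by (simp add: emeasure_restricted Int_absorb2)
  also have "\<dots> = emeasure \<nu> base * emeasure \<mu> E"
    by (rule \<mu>.emeasure_pair_measure_Times[OF sets_base E(1)])
  also have "\<dots> < \<infinity>"
    using E(2) by (simp add: emeasure_base ennreal_mult_less_top)
  finally have fin: "emeasure N (space N) < \<infinity>" .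
  have "integrable N f"
  proof (rule integrableI_bounded_set[of "space N" _ _ K])
    show "f \<in> borel_measurable N"
      by (simp add: measurable_cong_sets[OF N refl])
  qed (use fin f_bound in auto)
  then have "approximable N f"
    by (rule approximable_integrable[OF N fin])
  then obtain k h where h: "h \<in> borel_measurable M" "depends_from k h"
    "(\<integral>\<^sup>+z. ennreal (norm (f z - h z)) \<partial>N) < ennreal \<epsilon>"
    using \<epsilon> unfolding approximable_def by blast
  have "(\<integral>\<^sup>+z. ennreal (norm (f z - h z)) \<partial>N)
      = (\<integral>\<^sup>+z. indicator ?D z * ennreal (norm (f z - h z)) \<partial>M)"
    unfolding N_def by (rule nn_integral_density) (use D h(1) in measurable)
  then have "(\<integral>\<^sup>+z. indicator ?D z * ennreal (norm (f z - h z)) \<partial>M) < ennreal \<epsilon>"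
    using h(3) by simp
  with h(1,2) show ?thesis
  proof (induction k arbitrary: h)
    case (Suc k)
    obtain h' where "h' \<in> borel_measurable M" "depends_from k h'"
      "(\<integral>\<^sup>+z. indicator ?D z * ennreal (norm (f z - h' z)) \<partial>M)
         \<le> (\<integral>\<^sup>+z. indicator ?D z * ennreal (norm (f z - h z)) \<partial>M)"
      using approximation_step[OF E(1) Suc.prems(1,2)] by blast
    then show ?case
      using Suc.IH[of h'] Suc.prems(3) by (meson le_less_trans)
  qed blast
qed

lemma f_section [measurable]: "x \<in> space \<mu> \<Longrightarrow> (\<lambda>y. f (y, x)) \<in> borel_measurable \<nu>"
  by measurable

lemma integrable_section:
  assumes "x \<in> space \<mu>" "H \<in> sets \<nu>" "emeasure \<nu> H < \<infinity>"
  shows "set_integrable \<nu> H (\<lambda>y. f (y, x))"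
  unfolding set_integrable_def
proof (rule integrableI_bounded_set[of H _ _ K])
  show "(\<lambda>y. indicator H y *\<^sub>R f (y, x)) \<in> borel_measurable \<nu>"
    using assms f_section[OF assms(1)] by measurable
  show "AE y in \<nu>. y \<in> H \<longrightarrow> norm (indicator H y *\<^sub>R f (y, x)) \<le> K"
    using f_bound by auto
qed (use assms in auto)

section \<open>Averages over past events\<close>

text \<open>Not divided by the measure of \<open>H\<close>, hence additive over disjoint
  events.\<close>

definition avg :: "(int \<Rightarrow> nat) set \<Rightarrow> 'b \<Rightarrow> complex" where
  "avg H x = (LINT y:H|\<nu>. f (y, x))"

lemma measurable_avg [measurable]:
  assumes "H \<in> sets \<nu>"
  shows "avg H \<in> borel_measurable \<mu>"
proof -
  interpret \<nu>: sigma_finite_measure \<nu>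
    by (rule sigma_finite_nu)
  have "(\<lambda>z. f (snd z, fst z)) \<in> borel_measurable (\<mu> \<Otimes>\<^sub>M \<nu>)"
    by measurable
  then have "(\<lambda>(x, y). indicator H y *\<^sub>R f (y, x)) \<in> borel_measurable (\<mu> \<Otimes>\<^sub>M \<nu>)"
    using assms by (simp add: case_prod_beta)
  then show ?thesis
    unfolding avg_def[abs_def] set_lebesgue_integral_def by (rule \<nu>.borel_measurable_lebesgue_integral)
qed

text \<open>For \<open>h\<close>, which sees the future only, the identity is exact by independence.
  Replacing \<open>f\<close> by \<open>h\<close> costs at most the error on \<open>base\<close> in
  each of the two averages, and these carry the factors \<open>\<rho> 1\<close> and
  \<open>measure \<nu> H\<close>; their sum is the constant.\<close>

lemma avg_defect_le:
  assumes H: "past_independent H" and x: "x \<in> space \<mu>"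
    and h: "h \<in> borel_measurable M" "depends_from 0 h"
  shows "ennreal (norm (\<rho> 1 *\<^sub>R avg H x - measure \<nu> H *\<^sub>R avg base x))
    \<le> ennreal (\<rho> 1 + measure \<nu> H) * (\<integral>\<^sup>+y. indicator base y * ennreal (norm (f (y, x) - h (y, x))) \<partial>\<nu>)"
proof -
  let ?e = "\<integral>\<^sup>+y. indicator base y * ennreal (norm (f (y, x) - h (y, x))) \<partial>\<nu>"
  have Hs: "H \<in> sets \<nu>" "H \<subseteq> base"
    using H by (auto simp: past_independent_def)
  have bfin: "emeasure \<nu> base < \<infinity>"
    by (simp add: emeasure_base)
  have Hfin: "emeasure \<nu> H < \<infinity>"
    using emeasure_mono[OF Hs(2) sets_base] bfin by (rule le_less_trans)
  have rho: "0 < \<rho> 1"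
    by (rule rho_pos) simp
  show ?thesis
  \<comment> \<open>A finite error is what makes the section of \<open>f - h\<close> integrable; an
    infinite one makes the bound trivial.\<close>
  proof (cases "?e = \<infinity>")
    case True
    have "0 < \<rho> 1 + measure \<nu> H"
      using rho by (simp add: add_pos_nonneg)
    then show ?thesis
      using True by (simp add: ennreal_mult_top)
  next
    case False
    have hx [measurable]: "(\<lambda>y. h (y, x)) \<in> borel_measurable \<nu>"
      using x h(1) by measurable
    have fx [measurable]: "(\<lambda>y. f (y, x)) \<in> borel_measurable \<nu>"
      by (rule f_section[OF x])
    have dint: "set_integrable \<nu> B (\<lambda>y. f (y, x) - h (y, x))" and
      dle: "ennreal (norm (LINT y:B|\<nu>. f (y, x) - h (y, x))) \<le> ?e"
      if B: "B \<in> sets \<nu>" "B \<subseteq> base" for B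
    proof -
      have le: "(\<integral>\<^sup>+y. ennreal (norm (indicator B y *\<^sub>R (f (y, x) - h (y, x)))) \<partial>\<nu>) \<le> ?e"
        by (rule nn_integral_mono) (use B in \<open>auto simp: indicator_def\<close>)
      then show i: "set_integrable \<nu> B (\<lambda>y. f (y, x) - h (y, x))"
        unfolding set_integrable_def using False B(1)
        by (intro integrableI_bounded) (auto simp: less_top[symmetric] top_unique)
      show "ennreal (norm (LINT y:B|\<nu>. f (y, x) - h (y, x))) \<le> ?e"
        using integral_norm_bound_ennreal[OF i[unfolded set_integrable_def]] le
        unfolding set_lebesgue_integral_def by (rule order_trans)
    qed
    have hint: "(LINT y:B|\<nu>. h (y, x)) = avg B x - (LINT y:B|\<nu>. f (y, x) - h (y, x))"
      if B: "B \<in> sets \<nu>" "B \<subseteq> base" for B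
    proof -
      have Bfin: "emeasure \<nu> B < \<infinity>"
        using emeasure_mono[OF B(2) sets_base] bfin by (rule le_less_trans)
      show ?thesis
        unfolding avg_def
        by (subst set_integral_diff(2)[OF integrable_section[OF x B(1) Bfin] dint[OF B], symmetric]) simp
    qed
    have hfut: "(LINT y:B|\<nu>. h (y, x)) = (LINT y:B|\<nu>. h (future y, x))" if "B \<in> sets \<nu>" for B
    proof (rule set_lebesgue_integral_cong[OF that], intro allI impI)
      fix y assume "y \<in> B"
      then have y: "y \<in> space \<nu>"
        using sets.sets_into_space[OF that] by blast
      moreover have "future y \<in> space \<nu>"
        using measurable_space[OF measurable_future_nu y] by (simp add: space_nu)
      moreover have "\<forall>i\<ge>- int 0. y i = future y i"
        by (simp add: future_def)
      ultimately show "h (y, x) = h (future y, x)"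
        using h(2) unfolding depends_from_def by blast
    qed
    have "(\<lambda>y. h (y, x)) \<in> borel_measurable paths"
      using hx by (simp add: measurable_cong_sets[OF sets_nu refl])
    then have "\<rho> 1 *\<^sub>R (LINT y:H|\<nu>. h (y, x)) = measure \<nu> H *\<^sub>R (LINT y:base|\<nu>. h (y, x))"
      unfolding hfut[OF Hs(1)] hfut[OF sets_base] by (rule integral_future[OF H _ Hfin])
    then have eq: "\<rho> 1 *\<^sub>R avg H x - measure \<nu> H *\<^sub>R avg base x
        = \<rho> 1 *\<^sub>R (LINT y:H|\<nu>. f (y, x) - h (y, x)) - measure \<nu> H *\<^sub>R (LINT y:base|\<nu>. f (y, x) - h (y, x))"
      unfolding hint[OF Hs] hint[OF sets_base order_refl] by (simp add: algebra_simps)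
    have "norm (\<rho> 1 *\<^sub>R avg H x - measure \<nu> H *\<^sub>R avg base x)
        \<le> \<rho> 1 * norm (LINT y:H|\<nu>. f (y, x) - h (y, x)) + measure \<nu> H * norm (LINT y:base|\<nu>. f (y, x) - h (y, x))"
      unfolding eq by (rule order_trans[OF norm_triangle_ineq4]) (use rho in simp)
    then have "ennreal (norm (\<rho> 1 *\<^sub>R avg H x - measure \<nu> H *\<^sub>R avg base x))
        \<le> ennreal (\<rho> 1) * ennreal (norm (LINT y:H|\<nu>. f (y, x) - h (y, x)))
          + ennreal (measure \<nu> H) * ennreal (norm (LINT y:base|\<nu>. f (y, x) - h (y, x)))"
      using rho by (simp add: ennreal_mult[symmetric] ennreal_plus[symmetric] del: ennreal_plus)
    also have "\<dots> \<le> ennreal (\<rho> 1) * ?e + ennreal (measure \<nu> H) * ?e"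
      by (intro add_mono mult_left_mono dle Hs sets_base order_refl) auto
    also have "\<dots> = ennreal (\<rho> 1 + measure \<nu> H) * ?e"
      using rho by (simp add: distrib_right)
    finally show ?thesis .
  qed
qed

text \<open>By conservativity an eigenfunction does not see the past.\<close>

lemma AE_avg_past:
  assumes H: "past_independent H"
  shows "AE x in \<mu>. \<rho> 1 *\<^sub>R avg H x = measure \<nu> H *\<^sub>R avg base x"
proof -
  interpret pair_sigma_finite \<nu> \<mu>
    by (rule pair_sigma_finite)
  let ?u = "\<lambda>x. \<rho> 1 *\<^sub>R avg H x - measure \<nu> H *\<^sub>R avg base x"
  have Hs [measurable]: "H \<in> sets \<nu>"
    using H by (simp add: past_independent_def)
  note [measurable] = sets_base
  have rho: "0 < \<rho> 1"
    by (rule rho_pos) simp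
  have um [measurable]: "?u \<in> borel_measurable \<mu>"
    by measurable
  obtain A where A: "range A \<subseteq> sets \<mu>" "(\<Union>i::nat. A i) = space \<mu>" "\<And>i. emeasure \<mu> (A i) \<noteq> \<infinity>"
    using sigma_finite_measure.sigma_finite[OF sigma_finite_mu] by blast
  have "AE x in \<mu>. x \<in> A i \<longrightarrow> ?u x = 0" for i
  proof -
    have E [measurable]: "A i \<in> sets \<mu>"
      using A(1) by auto
    have Efin: "emeasure \<mu> (A i) < \<infinity>"
      using A(3)[of i] by (simp add: less_top)
    let ?c = "\<rho> 1 + measure \<nu> H"
    have c: "0 < ?c"
      using rho by (simp add: add_pos_nonneg)
    have small: "(\<integral>\<^sup>+x. indicator (A i) x * ennreal (norm (?u x)) \<partial>\<mu>) \<le> ennreal \<epsilon>" if \<epsilon>: "\<epsilon> > 0" for \<epsilon>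
    proof -
      obtain h where h [measurable]: "h \<in> borel_measurable M" "depends_from 0 h"
        "(\<integral>\<^sup>+z. indicator (base \<times> A i) z * ennreal (norm (f z - h z)) \<partial>M) < ennreal (\<epsilon> / ?c)"
        using future_approximation[OF E Efin, of "\<epsilon> / ?c"] \<epsilon> c by auto
      have "(\<integral>\<^sup>+x. indicator (A i) x * ennreal (norm (?u x)) \<partial>\<mu>)
          \<le> (\<integral>\<^sup>+x. ennreal ?c * (\<integral>\<^sup>+y. indicator (base \<times> A i) (y, x) * ennreal (norm (f (y, x) - h (y, x))) \<partial>\<nu>) \<partial>\<mu>)"
      proof (rule nn_integral_mono)
        fix x assume x: "x \<in> space \<mu>"
        show "indicator (A i) x * ennreal (norm (?u x))
            \<le> ennreal ?c * (\<integral>\<^sup>+y. indicator (base \<times> A i) (y, x) * ennreal (norm (f (y, x) - h (y, x))) \<partial>\<nu>)"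
        proof (cases "x \<in> A i")
          case True
          then have "indicator (base \<times> A i) (y, x) = (indicator base y :: ennreal)" for y
            by (simp add: indicator_def)
          then show ?thesis
            using avg_defect_le[OF H x h(1,2)] True by simp
        qed simp
      qed
      also have "\<dots> = ennreal ?c * (\<integral>\<^sup>+x. (\<integral>\<^sup>+y. indicator (base \<times> A i) (y, x) * ennreal (norm (f (y, x) - h (y, x))) \<partial>\<nu>) \<partial>\<mu>)"
        by (rule nn_integral_cmult) measurable
      also have "\<dots> = ennreal ?c * (\<integral>\<^sup>+z. indicator (base \<times> A i) z * ennreal (norm (f z - h z)) \<partial>M)"
        by (subst nn_integral_snd[where f = "\<lambda>z. indicator (base \<times> A i) z * ennreal (norm (f z - h z))"])
           measurable
      also have "\<dots> \<le> ennreal ?c * ennreal (\<epsilon> / ?c)"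
        by (rule mult_left_mono) (use h(3) in auto)
      also have "\<dots> = ennreal \<epsilon>"
        using c \<epsilon> by (simp add: ennreal_mult[symmetric])
      finally show ?thesis .
    qed
    have "(\<integral>\<^sup>+x. indicator (A i) x * ennreal (norm (?u x)) \<partial>\<mu>) \<le> 0"
    proof (rule ennreal_le_epsilon)
      fix e :: real assume "0 < e"
      from small[OF this]
      show "(\<integral>\<^sup>+x. indicator (A i) x * ennreal (norm (?u x)) \<partial>\<mu>) \<le> 0 + ennreal e"
        by (simp only: add_0_left)
    qed
    then have "(\<integral>\<^sup>+x. indicator (A i) x * ennreal (norm (?u x)) \<partial>\<mu>) = 0"
      by (simp only: le_zero_eq)
    moreover have "(\<lambda>x. indicator (A i) x * ennreal (norm (?u x))) \<in> borel_measurable \<mu>"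
      by measurable
    ultimately have "AE x in \<mu>. indicator (A i) x * ennreal (norm (?u x)) = 0"
      by (simp only: nn_integral_0_iff_AE)
    then show ?thesis
    proof eventually_elim
      case (elim x)
      show ?case
      proof
        assume "x \<in> A i"
        then have "ennreal (norm (?u x)) = 0"
          using elim by (simp only: indicator_simps mult_1_left)
        then show "?u x = 0"
          by (simp only: ennreal_eq_0_iff norm_le_zero_iff)
      qed
    qed
  qed
  then have "AE x in \<mu>. \<forall>i. x \<in> A i \<longrightarrow> ?u x = 0"
    by (subst AE_all_countable) (rule allI)
  then show ?thesis
    using AE_space
  proof eventually_elim
    case (elim x)
    then obtain i where "x \<in> A i"
      using A(2) by blast
    then show ?case
      using elim(1) by auto
  qed
qed

section \<open>Decomposition at the next visit to state 1\<close>

text \<open>Waiting from time m for the next visit to 1 turns an event about the coordinates from -m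
  to m into a past event as seen from time r.\<close>

definition cut :: "(int \<Rightarrow> nat) set \<Rightarrow> nat \<Rightarrow> nat \<Rightarrow> (int \<Rightarrow> nat) set" where
  "cut C m r = {y \<in> C. m \<le> r \<and> y (int r) = 1 \<and> (\<forall>i. m \<le> i \<and> i < r \<longrightarrow> y (int i) \<noteq> 1)}"

lemma sets_cut:
  assumes "C \<in> sets \<nu>"
  shows "cut C m r \<in> sets \<nu>"
proof -
  have meas: "{y \<in> space \<nu>. P (y i)} \<in> sets \<nu>" for i and P :: "nat \<Rightarrow> bool"
    using sets_coordinate[of P i] by (simp add: sets_nu space_nu)
  have "cut C m r = C \<inter> {y \<in> space \<nu>. m \<le> r \<and> y (int r) = 1 \<and> (\<forall>i. m \<le> i \<and> i < r \<longrightarrow> y (int i) \<noteq> 1)}"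
    using sets.sets_into_space[OF assms] by (auto simp: cut_def)
  also have "\<dots> \<in> sets \<nu>"
    by (intro sets.Int assms sets.sets_Collect_conj sets.sets_Collect_countable_All sets.sets_Collect_imp
        sets.sets_Collect_const meas)
  finally show ?thesis .
qed

lemma AE_section: "AE x in \<mu>. AE y in \<nu>. \<forall>n. f (zshift (int n) y, (T ^^ n) x) = l ^ n * f (y, x)"
proof -
  interpret pair_sigma_finite \<nu> \<mu>
    by (rule pair_sigma_finite)
  let ?P = "\<lambda>y x. \<forall>n. f ((R ^^ n) (y, x)) = l ^ n * f (y, x)"
  have "{z \<in> space M. \<forall>n. f ((R ^^ n) z) = l ^ n * f z} \<in> sets M"
    by measurable
  then have m: "{z \<in> space M. ?P (fst z) (snd z)} \<in> sets M"
    by simp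
  have "AE y in \<nu>. AE x in \<mu>. ?P y x"
    using AE_pair[OF AE_f_iter] by simp
  then have "AE x in \<mu>. AE y in \<nu>. ?P y x"
    by (rule AE_commute[where P = ?P, OF m, THEN iffD1])
  then show ?thesis
    unfolding R_iter .
qed

text \<open>Shifted by r, the cut becomes a past event inside \<open>base\<close>, so its average is
  proportional to that of \<open>base\<close>. The eigenvalue equation trades the shift of the path
  for \<open>T ^^ r\<close> on the tower point and the factor \<open>inverse l ^ r\<close>.\<close>

lemma avg_cut_shift:
  assumes C: "C \<in> sets \<nu>" "emeasure \<nu> C < \<infinity>"
    and det: "\<And>y y'. y \<in> C \<Longrightarrow> y' \<in> space \<nu> \<Longrightarrow> (\<And>i. i \<in> {- int m..int m} \<Longrightarrow> y' i = y i) \<Longrightarrow> y' \<in> C"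
  shows "AE x in \<mu>. \<rho> 1 *\<^sub>R avg (cut C m r) x = measure \<nu> (cut C m r) *\<^sub>R (inverse l ^ r * avg base ((T ^^ r) x))"
proof (cases "m \<le> r")
  case False
  then have "cut C m r = {}"
    by (auto simp: cut_def)
  then show ?thesis
    by (simp add: avg_def set_lebesgue_integral_def)
next
  case mr: True
  define H where "H = zshift (- int r) -` cut C m r \<inter> space \<nu>"
  note cut = sets_cut[OF C(1), of m r]
  have zm: "zshift k \<in> measurable \<nu> \<nu>" for k
    by (rule preserves_measurable[OF preserves_zshift])
  have H: "H \<in> sets \<nu>"
    unfolding H_def by (rule measurable_sets[OF zm cut])
  have "emeasure \<nu> H = emeasure \<nu> (cut C m r)"
    unfolding H_def by (rule preserves_emeasure[OF preserves_zshift cut])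
  then have mH: "measure \<nu> H = measure \<nu> (cut C m r)"
    by (simp add: measure_def)
  have "past_independent H"
  \<comment> \<open>Seen from time r, the coordinates from -m to r lie between -m - r and 0. As m is
    at most r, they include all those that decide membership in \<open>C\<close>.\<close>
  proof (rule past_determined_independent[of "- int m - int r"])
    show "H \<subseteq> base"
      by (auto simp: H_def cut_def base_iff zshift_def)
    fix y y' assume y: "y \<in> H" and y': "y' \<in> space \<nu>"
      and eq: "\<And>i. i \<in> {- int m - int r..0} \<Longrightarrow> y' i = y i"
    have eq': "zshift (- int r) y' i = zshift (- int r) y i" if "i \<in> {- int m..int r}" for i
      using eq[of "i - int r"] that by (simp add: zshift_def)
    have cy: "zshift (- int r) y \<in> cut C m r"
      using y by (simp add: H_def)
    moreover have "zshift (- int r) y' \<in> C"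
    proof (rule det)
      show "zshift (- int r) y \<in> C"
        using cy by (simp add: cut_def)
      show "zshift (- int r) y' \<in> space \<nu>"
        using y' by (simp add: space_nu)
      show "zshift (- int r) y' i = zshift (- int r) y i" if "i \<in> {- int m..int m}" for i
        using that mr by (intro eq') auto
    qed
    ultimately have "zshift (- int r) y' \<in> cut C m r"
      using eq' by (auto simp: cut_def)
    then show "y' \<in> H"
      using y' by (simp add: H_def)
  qed (use H in auto)
  then have "AE x in \<mu>. \<rho> 1 *\<^sub>R avg H x = measure \<nu> H *\<^sub>R avg base x"
    by (rule AE_avg_past)
  then have "AE x in \<mu>. \<rho> 1 *\<^sub>R avg H ((T ^^ r) x) = measure \<nu> H *\<^sub>R avg base ((T ^^ r) x)"
    by (rule preserves_AE[OF preserves_funpow[OF preserves_T]])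
  then show ?thesis
    using AE_section AE_space
  proof eventually_elim
    case (elim x)
    have Tx: "(T ^^ r) x \<in> space \<mu>"
      using measurable_space[OF preserves_measurable[OF preserves_funpow[OF preserves_T]] elim(3)] .
    let ?g = "\<lambda>y. indicator H y *\<^sub>R (inverse l ^ r * f (y, (T ^^ r) x))"
    have gm: "?g \<in> borel_measurable \<nu>"
      using H f_section[OF Tx] by measurable
    have "avg (cut C m r) x = (\<integral>y. ?g (zshift (int r) y) \<partial>\<nu>)"
      unfolding avg_def set_lebesgue_integral_def
    proof (rule integral_cong_AE)
      show "(\<lambda>y. indicator (cut C m r) y *\<^sub>R f (y, x)) \<in> borel_measurable \<nu>"
        using cut f_section[OF elim(3)] by measurable
      show "(\<lambda>y. ?g (zshift (int r) y)) \<in> borel_measurable \<nu>"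
        by (rule measurable_compose[OF zm gm])
      show "AE y in \<nu>. indicator (cut C m r) y *\<^sub>R f (y, x) = ?g (zshift (int r) y)"
        using elim(2) AE_space
      proof eventually_elim
        case (elim y)
        have "zshift (int r) y \<in> H \<longleftrightarrow> y \<in> cut C m r"
          using elim(2) by (simp add: H_def zshift_zshift space_nu) (simp add: zshift_def)
        moreover have "inverse l ^ r * (l ^ r * f (y, x)) = f (y, x)"
          using norm_l by (auto simp: power_inverse field_simps)
        ultimately show ?case
          using elim(1) by (simp add: indicator_def)
      qed
    qed
    also have "\<dots> = (\<integral>y. ?g y \<partial>distr \<nu> \<nu> (zshift (int r)))"
      by (rule integral_distr[OF zm gm, symmetric])
    also have "distr \<nu> \<nu> (zshift (int r)) = \<nu>"
      using preserves_zshift by (simp add: preserves_def)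
    also have "(\<integral>y. ?g y \<partial>\<nu>) = inverse l ^ r * avg H ((T ^^ r) x)"
      unfolding avg_def set_lebesgue_integral_def
      by (subst integral_mult_right_zero[symmetric]) (simp add: mult.commute)
    finally have "\<rho> 1 *\<^sub>R avg (cut C m r) x = inverse l ^ r * (\<rho> 1 *\<^sub>R avg H ((T ^^ r) x))"
      by simp
    then show ?case
      unfolding elim(1) mH by simp
  qed
qed

lemma norm_avg_le:
  assumes "x \<in> space \<mu>" "C \<in> sets \<nu>" "emeasure \<nu> C < \<infinity>"
  shows "norm (avg C x) \<le> K * measure \<nu> C"
proof -
  have "norm (avg C x) \<le> (\<integral>y. norm (indicator C y *\<^sub>R f (y, x)) \<partial>\<nu>)"
    unfolding avg_def set_lebesgue_integral_def by (rule integral_norm_bound)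
  also have "\<dots> \<le> (\<integral>y. indicator C y *\<^sub>R K \<partial>\<nu>)"
  proof (rule integral_mono)
    show "integrable \<nu> (\<lambda>y. norm (indicator C y *\<^sub>R f (y, x)))"
      by (rule integrable_norm[OF integrable_section[OF assms, unfolded set_integrable_def]])
    show "integrable \<nu> (\<lambda>y. indicator C y *\<^sub>R K)"
      using assms by (intro integrable_scaleR_left integrable_real_indicator)
    show "norm (indicator C y *\<^sub>R f (y, x)) \<le> indicator C y *\<^sub>R K" for y
      using f_bound by (simp add: indicator_def)
  qed
  also have "\<dots> = K * measure \<nu> C"
    using assms by simp
  finally show ?thesis .
qed

end

section \<open>Harmonicity along orbits and constancy of eigenfunctions\<close>

locale product_recurrent = product_eigenfunction +
  assumes conservative_nu: "conservative \<nu> path_shift" and ergodic_nu: "ergodic \<nu> path_shift"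
begin

text \<open>Almost every path visits 1 at or after time m, so the cuts partition \<open>C\<close> up
  to a null set.\<close>

lemma measure_cut_sums:
  assumes C: "C \<in> sets \<nu>" "emeasure \<nu> C < \<infinity>"
  shows "(\<lambda>r. measure \<nu> (cut C m r)) sums measure \<nu> C"
    and "x \<in> space \<mu> \<Longrightarrow> (\<lambda>r. avg (cut C m r) x) sums avg C x"
proof -
  have sub: "cut C m r \<subseteq> C" for r
    by (auto simp: cut_def)
  have cutm: "cut C m r \<in> sets \<nu>" for r
    by (rule sets_cut[OF C(1)])
  have disj: "cut C m r \<inter> cut C m s = {}" if "r < s" for r s
    using that by (auto simp: cut_def)
  then have disj': "cut C m r \<inter> cut C m s = {}" if "r \<noteq> s" for r s
    using that by (metis Int_commute linorder_neqE_nat)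
  then have df: "disjoint_family (cut C m)"
    by (auto simp: disjoint_family_on_def)
  have U: "(\<Union>r. cut C m r) \<in> sets \<nu>"
    using cutm by auto
  have ae: "AE y in \<nu>. y \<in> C \<longleftrightarrow> y \<in> (\<Union>r. cut C m r)"
    using AE_visits[OF conservative_nu ergodic_nu]
  proof eventually_elim
    case (elim y)
    then have ex: "\<exists>r. m \<le> r \<and> y (int r) = 1"
      by blast
    define r where "r = (LEAST r. m \<le> r \<and> y (int r) = 1)"
    have "m \<le> r \<and> y (int r) = 1"
      unfolding r_def by (rule LeastI_ex[OF ex])
    moreover have "y (int i) \<noteq> 1" if "m \<le> i" "i < r" for i
      using not_less_Least[of i "\<lambda>r. m \<le> r \<and> y (int r) = 1"] that by (simp add: r_def)
    ultimately have "y \<in> C \<Longrightarrow> y \<in> cut C m r"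
      by (simp add: cut_def)
    then show ?case
      using sub by blast
  qed
  have eU: "emeasure \<nu> (\<Union>r. cut C m r) = emeasure \<nu> C"
    using ae C(1) U by (intro emeasure_eq_AE) auto
  have s: "(\<lambda>r. measure \<nu> (cut C m r)) sums measure \<nu> (\<Union>r. cut C m r)"
    using C(2) by (intro measure_UNION df) (use cutm eU in auto)
  then show "(\<lambda>r. measure \<nu> (cut C m r)) sums measure \<nu> C"
    using eU by (simp add: measure_def)
  assume x: "x \<in> space \<mu>"
  have cfin: "emeasure \<nu> (cut C m r) < \<infinity>" for r
    using emeasure_mono[OF sub C(1)] C(2) by (rule le_less_trans)
  have "summable (\<lambda>r. avg (cut C m r) x)"
  proof (rule summable_comparison_test)
    show "\<exists>N. \<forall>r\<ge>N. norm (avg (cut C m r) x) \<le> K * measure \<nu> (cut C m r)"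
      using norm_avg_le[OF x cutm cfin] by blast
    show "summable (\<lambda>r. K * measure \<nu> (cut C m r))"
      using s by (intro summable_mult) (rule sums_summable)
  qed
  moreover have "(\<Sum>r. avg (cut C m r) x) = avg (\<Union>r. cut C m r) x"
    unfolding avg_def using U C(2) eU x cutm disj'
    by (intro lebesgue_integral_countable_add[symmetric] integrable_section) auto
  moreover have "avg (\<Union>r. cut C m r) x = avg C x"
    unfolding avg_def set_lebesgue_integral_def
  proof (rule integral_cong_AE)
    show "(\<lambda>y. indicator (\<Union>r. cut C m r) y *\<^sub>R f (y, x)) \<in> borel_measurable \<nu>"
      "(\<lambda>y. indicator C y *\<^sub>R f (y, x)) \<in> borel_measurable \<nu>"
      using U C(1) f_section[OF x] by measurable
    show "AE y in \<nu>. indicator (\<Union>r. cut C m r) y *\<^sub>R f (y, x) = indicator C y *\<^sub>R f (y, x)"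
      using ae by eventually_elim (simp add: indicator_def)
  qed
  ultimately show "(\<lambda>r. avg (cut C m r) x) sums avg C x"
    by (simp add: sums_iff)
qed

text \<open>Every average over an event with bounded window is a mixture of the values, along the
  orbit of \<open>x\<close>, of the one function \<open>avg base\<close>.\<close>

lemma AE_avg_sums:
  assumes C: "C \<in> sets \<nu>" "emeasure \<nu> C < \<infinity>"
    and det: "\<And>y y'. y \<in> C \<Longrightarrow> y' \<in> space \<nu> \<Longrightarrow> (\<And>i. i \<in> {- int m..int m} \<Longrightarrow> y' i = y i) \<Longrightarrow> y' \<in> C"
  shows "AE x in \<mu>. (\<lambda>r. measure \<nu> (cut C m r) *\<^sub>R (inverse l ^ r * avg base ((T ^^ r) x))) sums (\<rho> 1 *\<^sub>R avg C x)"
proof -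
  have "AE x in \<mu>. \<forall>r. \<rho> 1 *\<^sub>R avg (cut C m r) x
      = measure \<nu> (cut C m r) *\<^sub>R (inverse l ^ r * avg base ((T ^^ r) x))"
    unfolding AE_all_countable by (intro allI avg_cut_shift[OF C]) (rule det)
  then show ?thesis
    using AE_space
  proof eventually_elim
    case (elim x)
    have "(\<lambda>r. \<rho> 1 *\<^sub>R avg (cut C m r) x) sums (\<rho> 1 *\<^sub>R avg C x)"
      by (rule sums_scaleR_right[OF measure_cut_sums(2)[OF C elim(2)]])
    then show ?case
      using elim(1) by simp
  qed
qed

lemma emeasure_base_finite: "emeasure \<nu> base < \<infinity>"
  by (simp add: emeasure_base)

text \<open>With \<open>C = base\<close> and \<open>m = a\<close> the mixture relates
  \<open>avg base\<close> to itself: the twisted sequence \<open>h\<close> along the orbit is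
  harmonic for \<open>w\<close>, the law of the first visit at or after time \<open>a\<close> given
  a start in 1. This law charges \<open>a\<close> because the chain can be in 1 at that time, so
  \<open>a\<close> is a period.\<close>

lemma AE_avg_base_shift:
  assumes "1 \<le> a" "0 < nstep p a 1 1"
  shows "AE x in \<mu>. \<forall>n. inverse l ^ (n + a) * avg base ((T ^^ (n + a)) x) = inverse l ^ n * avg base ((T ^^ n) x)"
proof -
  have rho: "0 < \<rho> 1"
    by (rule rho_pos) simp
  have mb: "measure \<nu> base = \<rho> 1"
    using rho by (simp add: measure_def emeasure_base)
  define w where "w r = measure \<nu> (cut base a r) / \<rho> 1" for r
  have w: "0 \<le> w r" for r
    using rho by (simp add: w_def)
  have ws: "w sums 1"
    using sums_divide[OF measure_cut_sums(1)[OF sets_base emeasure_base_finite, of a], of "\<rho> 1"] rho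
    unfolding w_def mb by simp
  have wa: "0 < w a"
  proof -
    have "cut base a a = base \<inter> {y \<in> space \<nu>. y (int a) = 1}"
      by (auto simp: cut_def base_iff)
    then have pos: "0 < emeasure \<nu> (cut base a a)"
      using emeasure_return_pos[OF assms(2)] by simp
    have "emeasure \<nu> (cut base a a) < \<infinity>"
      by (rule le_less_trans[OF emeasure_mono[OF _ sets_base] emeasure_base_finite]) (auto simp: cut_def)
    then have "0 < measure \<nu> (cut base a a)"
      using pos by (simp add: measure_def enn2real_positive_iff)
    then show ?thesis
      using rho by (simp add: w_def)
  qed
  have "AE x in \<mu>. (\<lambda>r. measure \<nu> (cut base a r) *\<^sub>R (inverse l ^ r * avg base ((T ^^ r) x))) sums (\<rho> 1 *\<^sub>R avg base x)"
    by (rule AE_avg_sums[OF sets_base emeasure_base_finite]) (auto simp: base_iff)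
  then have "AE x in \<mu>. (\<lambda>r. measure \<nu> (cut base a r) *\<^sub>R (inverse l ^ r * avg base ((T ^^ r) ((T ^^ n) x))))
      sums (\<rho> 1 *\<^sub>R avg base ((T ^^ n) x))" for n
    by (rule preserves_AE[OF preserves_funpow[OF preserves_T]])
  then have "AE x in \<mu>. \<forall>n. (\<lambda>r. measure \<nu> (cut base a r) *\<^sub>R (inverse l ^ r * avg base ((T ^^ r) ((T ^^ n) x))))
      sums (\<rho> 1 *\<^sub>R avg base ((T ^^ n) x))"
    by (subst AE_all_countable) (rule allI)
  then show ?thesis
    using AE_space
  proof eventually_elim
    case (elim x)
    define h where "h n = inverse l ^ n * avg base ((T ^^ n) x)" for n
    have nl: "norm (inverse l ^ n) = 1" for n
      using norm_l by (simp add: norm_power norm_inverse)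
    have "norm (h n) \<le> K * measure \<nu> base" for n
    proof -
      have "(T ^^ n) x \<in> space \<mu>"
        using measurable_space[OF preserves_measurable[OF preserves_funpow[OF preserves_T]] elim(2)] .
      from norm_avg_le[OF this sets_base emeasure_base_finite] show ?thesis
        by (simp add: h_def norm_mult nl)
    qed
    moreover have "(\<lambda>r. w r *\<^sub>R h (n + r)) sums h n" for n
    proof -
      have "(\<lambda>r. (inverse l ^ n) * (measure \<nu> (cut base a r) *\<^sub>R (inverse l ^ r * avg base ((T ^^ r) ((T ^^ n) x)))))
        sums ((inverse l ^ n) * (\<rho> 1 *\<^sub>R avg base ((T ^^ n) x)))"
        using elim(1) by (intro sums_mult) blast
      then have "(\<lambda>r. (1 / \<rho> 1) *\<^sub>R ((inverse l ^ n) * (measure \<nu> (cut base a r) *\<^sub>R (inverse l ^ r * avg base ((T ^^ r) ((T ^^ n) x))))))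
        sums ((1 / \<rho> 1) *\<^sub>R ((inverse l ^ n) * (\<rho> 1 *\<^sub>R avg base ((T ^^ n) x))))"
        by (rule sums_scaleR_right)
      moreover have "(T ^^ r) ((T ^^ n) x) = (T ^^ (n + r)) x" for r
        by (simp add: funpow_add add.commute[of n r])
      ultimately show ?thesis
        using rho by (simp add: h_def w_def power_add mult.assoc)
    qed
    ultimately have "h (n + a) = h n" for n
      by (rule harmonic_periodic[OF w ws wa])
    then show ?case
      unfolding h_def by blast
  qed
qed

lemma emeasure_symmetric_window_finite: "emeasure \<nu> (window (- int n) (int n) s) < \<infinity>"
proof -
  have "emeasure \<nu> (window (- int n) (int n) s) \<le> emeasure \<nu> (window 0 0 s)"
  proof (rule emeasure_mono)
    show "window 0 0 s \<in> sets \<nu>"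
      by (simp add: sets_nu sets_window)
  qed (auto simp: window_def)
  then show ?thesis
    using emeasure_window_finite[of s] by (simp add: less_top le_less_trans)
qed

text \<open>Averages over all windows determine the function. To compare positive measures instead
  of complex ones, the real and imaginary parts of \<open>f - c\<close> are lifted by
  \<open>B\<close>, a bound for its norm, and the result is compared with the density
  \<open>B\<close>.\<close>

lemma section_constant:
  assumes x: "x \<in> space \<mu>"
    and eq: "\<And>n s. avg (window (- int n) (int n) s) x = measure \<nu> (window (- int n) (int n) s) *\<^sub>R c"
  shows "AE y in \<nu>. f (y, x) = c"
proof -
  interpret \<nu>: sigma_finite_measure \<nu>
    by (rule sigma_finite_nu)
  define B where "B = K + norm c"
  have wm: "window a b s \<in> sets \<nu>" for a b s
    by (simp add: sets_nu sets_window)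
  note wfin = emeasure_symmetric_window_finite
  have fm: "(\<lambda>y. f (y, x)) \<in> borel_measurable \<nu>"
    by (rule f_section[OF x])
  have main: "AE y in \<nu>. L (f (y, x) - c) = 0" if L: "bounded_linear L" "\<And>z. \<bar>L z\<bar> \<le> norm z" for L :: "complex \<Rightarrow> real"
  proof -
    interpret L: bounded_linear L by (rule L(1))
    let ?\<phi> = "\<lambda>y. L (f (y, x) - c) + B"
    have \<phi>m: "?\<phi> \<in> borel_measurable \<nu>"
      using fm measurable_compose[OF _ borel_measurable_continuous_onI[OF linear_continuous_on[OF L(1)]], of "\<lambda>y. f (y, x) - c"]
      by (intro borel_measurable_add borel_measurable_const) auto
    have \<phi>0: "0 \<le> ?\<phi> y" for y
      using L(2)[of "f (y, x) - c"] norm_triangle_ineq4[of "f (y, x)" c] f_bound[of "(y, x)"]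
      unfolding B_def abs_le_iff by linarith
    have "0 \<le> norm (f (undefined, x))"
      by simp
    then have B0: "0 \<le> B"
      using f_bound[of "(undefined, x)"] unfolding B_def by (smt (verit) norm_ge_zero)
    have "density \<nu> (\<lambda>_. ennreal B) = density \<nu> (\<lambda>y. ennreal (?\<phi> y))"
    proof (rule measure_eqI_windows)
      show "emeasure (density \<nu> (\<lambda>_. ennreal B)) (window 0 0 s) \<noteq> \<infinity>" for s
        using wfin[of 0 s] wm[of 0 0 s] by (simp add: emeasure_density_const ennreal_mult_eq_top_iff)
      fix n s
      let ?Z = "window (- int n) (int n) s"
      have fi: "set_integrable \<nu> ?Z (\<lambda>y. f (y, x))"
        by (rule integrable_section[OF x wm wfin])
      have ci: "set_integrable \<nu> ?Z (\<lambda>_. d)" for d :: "'z :: {banach, second_countable_topology}"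
        unfolding set_integrable_def using wm wfin by (intro integrable_scaleR_left integrable_real_indicator)
      have di: "set_integrable \<nu> ?Z (\<lambda>y. f (y, x) - c)"
        by (rule set_integral_diff(1)[OF fi ci])
      have Li: "integrable \<nu> (\<lambda>y. L (indicator ?Z y *\<^sub>R (f (y, x) - c)))"
        using integrable_bounded_linear[OF L(1) di[unfolded set_integrable_def]] .
      have Ri: "integrable \<nu> (\<lambda>y. indicator ?Z y * B)"
        using ci[of B] by (simp add: set_integrable_def)
      have sp: "indicator ?Z y * ?\<phi> y = L (indicator ?Z y *\<^sub>R (f (y, x) - c)) + indicator ?Z y * B" for y
        by (cases "y \<in> ?Z") (simp_all add: L.zero)
      have "(\<integral>y. L (indicator ?Z y *\<^sub>R (f (y, x) - c)) \<partial>\<nu>) = L (LINT y:?Z|\<nu>. f (y, x) - c)"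
        unfolding set_lebesgue_integral_def using integral_bounded_linear[OF L(1) di[unfolded set_integrable_def]] .
      also have "(LINT y:?Z|\<nu>. f (y, x) - c) = avg ?Z x - measure \<nu> ?Z *\<^sub>R c"
        using set_integral_diff(2)[OF fi ci, of c] set_integral_const[OF wm, of _ _ s c] wfin[of n s]
        by (simp add: avg_def less_top)
      also have "\<dots> = 0"
        by (simp add: eq)
      finally have z: "(\<integral>y. L (indicator ?Z y *\<^sub>R (f (y, x) - c)) \<partial>\<nu>) = 0"
        by (simp add: L.zero)
      have "emeasure (density \<nu> (\<lambda>y. ennreal (?\<phi> y))) ?Z = (\<integral>\<^sup>+y. ennreal (?\<phi> y) * indicator ?Z y \<partial>\<nu>)"
        by (rule emeasure_density[OF _ wm]) (use \<phi>m in measurable)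
      also have "\<dots> = (\<integral>\<^sup>+y. ennreal (indicator ?Z y * ?\<phi> y) \<partial>\<nu>)"
        by (intro nn_integral_cong) (simp add: indicator_def)
      also have "\<dots> = ennreal (\<integral>y. indicator ?Z y * ?\<phi> y \<partial>\<nu>)"
      proof (rule nn_integral_eq_integral)
        show "integrable \<nu> (\<lambda>y. indicator ?Z y * ?\<phi> y)"
          unfolding sp by (rule Bochner_Integration.integrable_add[OF Li Ri])
        show "AE y in \<nu>. 0 \<le> indicator ?Z y * ?\<phi> y"
          using \<phi>0 by (intro AE_I2 mult_nonneg_nonneg) auto
      qed
      also have "(\<integral>y. indicator ?Z y * ?\<phi> y \<partial>\<nu>) = B * measure \<nu> ?Z"
        unfolding sp using Bochner_Integration.integral_add[OF Li Ri] z wm by simp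
      also have "ennreal (B * measure \<nu> ?Z) = ennreal B * emeasure \<nu> ?Z"
        using B0 wfin[of n s] by (simp add: ennreal_mult emeasure_eq_ennreal_measure less_top)
      finally show "emeasure (density \<nu> (\<lambda>_. ennreal B)) ?Z = emeasure (density \<nu> (\<lambda>y. ennreal (?\<phi> y))) ?Z"
        using wm by (simp add: emeasure_density_const)
    qed (simp_all add: sets_nu)
    then have "AE y in \<nu>. ennreal B = ennreal (?\<phi> y)"
      by (subst (asm) \<nu>.density_unique_iff) (use \<phi>m in measurable)
    then show ?thesis
      by eventually_elim (use B0 \<phi>0 in simp)
  qed
  have "AE y in \<nu>. Re (f (y, x) - c) = 0" "AE y in \<nu>. Im (f (y, x) - c) = 0"
    by (intro main bounded_linear_Re bounded_linear_Im abs_Re_le_cmod abs_Im_le_cmod)+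
  then show ?thesis
    by eventually_elim (simp add: complex_eq_iff)
qed

text \<open>Aperiodicity joins the periods into period 1, so \<open>avg base\<close> is an
  eigenfunction of \<open>T\<close> and therefore constant. Fed back into the mixture formula for an
  arbitrary window, this fixes the average of \<open>f\<close> over that window.\<close>

lemma eigenfunction_constant:
  assumes swm: "spectrally_weakly_mixing \<mu> T" and aper: "Gcd {n. 1 \<le> n \<and> 0 < nstep p n 1 1} = 1"
  shows "\<exists>c. AE z in M. f z = c"
proof -
  interpret pair_sigma_finite \<nu> \<mu>
    by (rule pair_sigma_finite)
  let ?V = "{n. 1 \<le> n \<and> 0 < nstep p n 1 1}"
  have rho: "0 < \<rho> 1"
    by (rule rho_pos) simp
  have l0: "l \<noteq> 0"
    using norm_l by auto
  have "AE x in \<mu>. a \<in> ?V \<longrightarrow> (\<forall>n. inverse l ^ (n + a) * avg base ((T ^^ (n + a)) x) = inverse l ^ n * avg base ((T ^^ n) x))" for a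
    using AE_avg_base_shift[of a] by (cases "a \<in> ?V") auto
  then have "AE x in \<mu>. \<forall>a. a \<in> ?V \<longrightarrow> (\<forall>n. inverse l ^ (n + a) * avg base ((T ^^ (n + a)) x) = inverse l ^ n * avg base ((T ^^ n) x))"
    by (subst AE_all_countable) (rule allI)
  then have const: "AE x in \<mu>. \<forall>n. inverse l ^ n * avg base ((T ^^ n) x) = avg base x"
  proof eventually_elim
    case (elim x)
    have "inverse l ^ n * avg base ((T ^^ n) x) = inverse l ^ 0 * avg base ((T ^^ 0) x)" for n
      using periods_Gcd[OF _ aper, of "\<lambda>n. inverse l ^ n * avg base ((T ^^ n) x)" n] elim by blast
    then show ?case
      by simp
  qed
  then have "AE x in \<mu>. avg base (T x) = l * avg base x"
  proof eventually_elim
    case (elim x)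
    then have "inverse l ^ 1 * avg base ((T ^^ 1) x) = avg base x"
      by blast
    then show ?case
      using l0 by (simp add: field_simps)
  qed
  moreover have "AE x in \<mu>. norm (avg base x) \<le> K * measure \<nu> base"
    using norm_avg_le[OF _ sets_base emeasure_base_finite] by (intro AE_I2)
  ultimately obtain d where d: "AE x in \<mu>. avg base x = d"
    using swm norm_l measurable_avg[OF sets_base] unfolding spectrally_weakly_mixing_def by blast
  \<comment> \<open>\<open>d\<close> is an unnormalised average over \<open>base\<close>, whose
    measure is \<open>\<rho> 1\<close>.\<close>
  define c where "c = (1 / \<rho> 1) *\<^sub>R d"
  note wfin = emeasure_symmetric_window_finite
  have win: "AE x in \<mu>. avg (window (- int n) (int n) s) x = measure \<nu> (window (- int n) (int n) s) *\<^sub>R c" for n s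
  proof -
    let ?C = "window (- int n) (int n) s"
    have C: "?C \<in> sets \<nu>"
      by (simp add: sets_nu sets_window)
    have "AE x in \<mu>. (\<lambda>r. measure \<nu> (cut ?C n r) *\<^sub>R (inverse l ^ r * avg base ((T ^^ r) x))) sums (\<rho> 1 *\<^sub>R avg ?C x)"
      by (rule AE_avg_sums[OF C wfin]) (simp add: window_def space_nu)
    then show ?thesis
      using const d
    proof eventually_elim
      case (elim x)
      have "(\<lambda>r. measure \<nu> (cut ?C n r) *\<^sub>R d) sums (\<rho> 1 *\<^sub>R avg ?C x)"
        using elim by simp
      moreover have "(\<lambda>r. measure \<nu> (cut ?C n r) *\<^sub>R d) sums (measure \<nu> ?C *\<^sub>R d)"
        by (rule sums_scaleR_left[OF measure_cut_sums(1)[OF C wfin]])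
      ultimately have "\<rho> 1 *\<^sub>R avg ?C x = measure \<nu> ?C *\<^sub>R d"
        by (rule sums_unique2)
      then have "(1 / \<rho> 1) *\<^sub>R (\<rho> 1 *\<^sub>R avg ?C x) = (1 / \<rho> 1) *\<^sub>R (measure \<nu> ?C *\<^sub>R d)"
        by simp
      then show ?case
        using rho by (simp add: c_def)
    qed
  qed
  \<comment> \<open>An enumeration of the words, so that one null set of \<open>x\<close> serves all
    windows.\<close>
  have "\<exists>W :: nat \<Rightarrow> int \<Rightarrow> nat. \<forall>y. \<exists>m. \<forall>i\<in>{- int n..int n}. y i = W m i" for n
    by (rule countable_windows[of "- int n" "int n"]) blast
  then have "\<forall>n. \<exists>W :: nat \<Rightarrow> int \<Rightarrow> nat. \<forall>y. \<exists>m. \<forall>i\<in>{- int n..int n}. y i = W m i"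
    by (rule allI)
  from choice[OF this] obtain W :: "nat \<Rightarrow> nat \<Rightarrow> int \<Rightarrow> nat" where
    W: "\<forall>n y. \<exists>m. \<forall>i\<in>{- int n..int n}. y i = W n m i"
    by (elim exE)
  have "AE x in \<mu>. \<forall>n m. avg (window (- int n) (int n) (W n m)) x = measure \<nu> (window (- int n) (int n) (W n m)) *\<^sub>R c"
    unfolding AE_all_countable using win by blast
  then have "AE x in \<mu>. AE y in \<nu>. f (y, x) = c"
    using AE_space
  proof eventually_elim
    case (elim x)
    show ?case
    proof (rule section_constant[OF elim(2)])
      fix n s
      obtain m where m: "\<forall>i\<in>{- int n..int n}. s i = W n m i"
        using W[rule_format, of n s] by (elim exE)
      then have "window (- int n) (int n) s = window (- int n) (int n) (W n m)"
        by (simp add: window_def)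
      then show "avg (window (- int n) (int n) s) x = measure \<nu> (window (- int n) (int n) s) *\<^sub>R c"
        using elim(1) by simp
    qed
  qed
  then have "AE y in \<nu>. AE x in \<mu>. f (y, x) = c"
    by (subst AE_commute[where P = "\<lambda>y x. f (y, x) = c"]) simp_all
  then have "AE z in M. f z = c"
    by (intro AE_pair_measure) simp_all
  then show ?thesis ..
qed

end

section \<open>Zero type\<close>

lemma measure_pair_Times:
  assumes "sigma_finite_measure N" "A \<in> sets M" "B \<in> sets N"
  shows "measure (M \<Otimes>\<^sub>M N) (A \<times> B) = measure M A * measure N B"
  using sigma_finite_measure.emeasure_pair_measure_Times[OF assms]
  by (simp add: measure_def enn2real_mult)

lemma preim_map_prod: "preim (M \<Otimes>\<^sub>M N) (map_prod S T) n (A \<times> B) = preim M S n A \<times> preim N T n B"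
  unfolding preim_def funpow_map_prod by (auto simp: space_pair_measure)

context markov_shift
begin

text \<open>By invariance the correlation of two translates of \<open>A\<close> at time n is that of
  \<open>A\<close> with itself at time n + m - k, which is a legitimate time once n is
  large.\<close>

lemma measure_shifted_event_tendsto_0:
  assumes A: "A \<in> fin_pos_sets \<nu>" and lim: "event_seq \<nu> path_shift A \<longlonglongrightarrow> 0"
  defines "B \<equiv> \<lambda>k. zshift k -` A \<inter> space \<nu>"
  shows "(\<lambda>n. measure \<nu> (B k \<inter> preim \<nu> path_shift n (B m))) \<longlonglongrightarrow> 0"
proof -
  have As: "A \<in> sets \<nu>" and Apos: "measure \<nu> A \<noteq> 0"
    using A by (auto simp: fin_pos_sets_def measure_def enn2real_eq_0_iff)
  have zm: "zshift j \<in> measurable \<nu> \<nu>" for j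
    by (rule preserves_measurable[OF preserves_zshift])
  have lim0: "(\<lambda>n. measure \<nu> (A \<inter> preim \<nu> path_shift n A)) \<longlonglongrightarrow> 0"
    using tendsto_mult_right_zero[OF lim, of "measure \<nu> A"] Apos by (simp add: event_seq_def)
  have "\<exists>d::nat. \<forall>n\<ge>d. nat (int n + m - k) \<ge> n - d \<and> int n + m - k \<ge> 0"
    by (intro exI[of _ "nat \<bar>m - k\<bar>"]) auto
  then obtain d :: nat where d: "\<And>n. n \<ge> d \<Longrightarrow> nat (int n + m - k) \<ge> n - d" "\<And>n. n \<ge> d \<Longrightarrow> int n + m - k \<ge> 0"
    by blast
  have fl: "filterlim (\<lambda>n. nat (int n + m - k)) at_top sequentially"
    unfolding filterlim_at_top
  proof
    fix Z
    show "eventually (\<lambda>n. Z \<le> nat (int n + m - k)) sequentially"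
      using eventually_ge_at_top[of "Z + d"] by eventually_elim (use d in fastforce)
  qed
  have "eventually (\<lambda>n. measure \<nu> (A \<inter> preim \<nu> path_shift (nat (int n + m - k)) A)
      = measure \<nu> (B k \<inter> preim \<nu> path_shift n (B m))) sequentially"
    using eventually_ge_at_top[of d]
  proof eventually_elim
    case (elim n)
    let ?S = "A \<inter> preim \<nu> path_shift (nat (int n + m - k)) A"
    have S: "?S \<in> sets \<nu>"
      using As sets_preim[OF preserves_path_shift As] by auto
    have "B k \<inter> preim \<nu> path_shift n (B m) = zshift k -` ?S \<inter> space \<nu>"
      using d(2)[OF elim] unfolding B_def preim_def path_shift_funpow
      by (auto simp: zshift_zshift space_nu add.commute)
    then show ?case
      using preserves_emeasure[OF preserves_zshift S, of k] by (simp add: measure_def)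
  qed
  then show ?thesis
    by (rule Lim_transform_eventually[OF filterlim_compose[OF lim0 fl]])
qed

text \<open>The union of all two-sided translates of \<open>A\<close> is exactly invariant and
  contains \<open>A\<close>.\<close>

lemma AE_some_shift:
  assumes erg: "ergodic \<nu> path_shift" and A: "A \<in> fin_pos_sets \<nu>"
  shows "AE y in \<nu>. \<exists>k::int. zshift k y \<in> A"
proof -
  have As: "A \<in> sets \<nu>" and Apos: "0 < emeasure \<nu> A"
    using A by (auto simp: fin_pos_sets_def)
  define U where "U = (\<Union>k::int. zshift k -` A \<inter> space \<nu>)"
  have zm: "zshift j \<in> measurable \<nu> \<nu>" for j
    by (rule preserves_measurable[OF preserves_zshift])
  have U: "U \<in> sets \<nu>"
    unfolding U_def by (rule sets.countable_UN') (use measurable_sets[OF zm As] in auto)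
  have inv: "preim \<nu> path_shift 1 U = U"
  proof -
    have "y \<in> preim \<nu> path_shift 1 U \<longleftrightarrow> y \<in> space \<nu> \<and> (\<exists>k::int. zshift (k + 1) y \<in> A)" for y
      unfolding preim_def path_shift_funpow U_def by (auto simp: zshift_zshift space_nu)
    moreover have "(\<exists>k::int. zshift (k + 1) y \<in> A) \<longleftrightarrow> (\<exists>k. zshift k y \<in> A)" for y
      by (metis diff_add_cancel)
    ultimately show ?thesis
      by (auto simp: U_def)
  qed
  have "zshift 0 -` A \<inter> space \<nu> = A"
    using sets.sets_into_space[OF As] by (auto simp: zshift_def)
  then have "A \<subseteq> U"
    unfolding U_def by blast
  then have "emeasure \<nu> U \<noteq> 0"
    using emeasure_mono[OF _ U, of A] Apos by auto
  then have "emeasure \<nu> (space \<nu> - U) = 0"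
    using erg U inv unfolding ergodic_def by blast
  then have "AE y in \<nu>. y \<notin> space \<nu> - U"
    using U by (intro AE_not_in) (auto simp: null_sets_def)
  then show ?thesis
    using AE_space by eventually_elim (auto simp: U_def)
qed

text \<open>Finitely many translates of \<open>A\<close> times sets of finite measure exhaust the
  product up to a null set. On such a rectangle the correlations of the first factor tend to 0,
  while those of the second are only bounded by the measure of \<open>X N\<close>.\<close>

lemma zero_type_product:
  assumes erg: "ergodic \<nu> path_shift" and A: "A \<in> fin_pos_sets \<nu>"
    and lim: "event_seq \<nu> path_shift A \<longlonglongrightarrow> 0"
    and sf: "sigma_finite_measure \<mu>" and T: "preserves \<mu> T"
  shows "zero_type (\<nu> \<Otimes>\<^sub>M \<mu>) (map_prod path_shift T)"
  unfolding zero_type_def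
proof (intro ballI)
  let ?M = "\<nu> \<Otimes>\<^sub>M \<mu>" and ?R = "map_prod path_shift T"
  fix E F assume EF: "E \<in> fin_pos_sets ?M" "F \<in> fin_pos_sets ?M"
  have R: "preserves ?M ?R"
    by (rule preserves_map_prod[OF preserves_path_shift T sf])
  have As: "A \<in> sets \<nu>" and Afin: "emeasure \<nu> A < \<infinity>"
    using A by (auto simp: fin_pos_sets_def)
  have zm: "zshift j \<in> measurable \<nu> \<nu>" for j
    by (rule preserves_measurable[OF preserves_zshift])
  define B where "B k = zshift k -` A \<inter> space \<nu>" for k :: int
  have B: "B k \<in> sets \<nu>" for k
    unfolding B_def by (rule measurable_sets[OF zm As])
  have eB: "emeasure \<nu> (B k) < \<infinity>" for k
    using preserves_emeasure[OF preserves_zshift As] Afin by (simp add: B_def)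
  obtain X :: "nat \<Rightarrow> _ set" where X: "range X \<subseteq> sets \<mu>" "(\<Union>i. X i) = space \<mu>" "\<And>i. emeasure \<mu> (X i) \<noteq> \<infinity>" "incseq X"
    using sigma_finite_measure.sigma_finite_incseq[OF sf] by blast
  have Xs: "X N \<in> sets \<mu>" for N
    using X(1) by auto
  define C where "C N = (\<Union>k\<in>{- int N..int N}. B k)" for N
  have C: "C N \<in> sets \<nu>" for N
    unfolding C_def using B by auto
  have Cinc: "C N \<subseteq> C N'" if "N \<le> N'" for N N'
    using that unfolding C_def by force
  define Z where "Z N = C N \<times> X N" for N
  have Z: "Z N \<in> sets ?M" for N
    unfolding Z_def using C Xs by simp
  have Zinc: "Z N \<subseteq> Z N'" if "N \<le> N'" for N N'
    using Cinc[OF that] incseqD[OF X(4) that] by (auto simp: Z_def)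
  have cover: "AE z in ?M. \<exists>N. z \<in> Z N"
    using AE_pair_fst[OF sf AE_some_shift[OF erg A]] AE_space
  proof eventually_elim
    case (elim z)
    then obtain k where k: "zshift k (fst z) \<in> A"
      by blast
    have sp: "fst z \<in> space \<nu>" "snd z \<in> space \<mu>"
      using elim(2) by (auto simp: space_pair_measure)
    then obtain i where i: "snd z \<in> X i"
      using X(2) by blast
    define N where "N = max i (nat \<bar>k\<bar>)"
    have "k \<in> {- int N..int N}"
      by (auto simp: N_def)
    then have "fst z \<in> C N"
      unfolding C_def B_def using k sp by blast
    moreover have "snd z \<in> X N"
      using incseqD[OF X(4), of i N] i by (auto simp: N_def)
    ultimately show ?case
      by (auto simp: Z_def mem_Times_iff)
  qed
  have rest: "(\<lambda>N. measure ?M (G - Z N)) \<longlonglongrightarrow> 0" if G: "G \<in> fin_pos_sets ?M" for G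
  proof -
    have Gs: "G \<in> sets ?M" and Gfin: "emeasure ?M G < \<infinity>"
      using G by (auto simp: fin_pos_sets_def)
    have "(\<lambda>N. measure ?M (G - Z N)) \<longlonglongrightarrow> measure ?M (\<Inter>N. G - Z N)"
    proof (rule Lim_measure_decseq)
      show "range (\<lambda>N. G - Z N) \<subseteq> sets ?M"
        using Gs Z by auto
      show "decseq (\<lambda>N. G - Z N)"
        using Zinc unfolding decseq_def by blast
      show "emeasure ?M (G - Z N) \<noteq> \<infinity>" for N
        using emeasure_mono[of "G - Z N" G ?M] Gs Gfin by (auto simp: top_unique)
    qed
    moreover have "emeasure ?M (\<Inter>N. G - Z N) = emeasure ?M {}"
    proof (rule emeasure_eq_AE)
      show "AE z in ?M. z \<in> (\<Inter>N. G - Z N) \<longleftrightarrow> z \<in> {}"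
        using cover by eventually_elim auto
    qed (use Gs Z in auto)
    ultimately show ?thesis
      by (simp add: measure_def)
  qed
  have main: "(\<lambda>n. measure ?M (Z N \<inter> preim ?M ?R n (Z N))) \<longlonglongrightarrow> 0" for N
  proof -
    have pB: "preim \<nu> path_shift n (B l) \<in> sets \<nu>" for n l
      by (rule sets_preim[OF preserves_path_shift B])
    have le: "measure ?M (Z N \<inter> preim ?M ?R n (Z N))
        \<le> (\<Sum>k\<in>{- int N..int N}. \<Sum>l\<in>{- int N..int N}. measure \<nu> (B k \<inter> preim \<nu> path_shift n (B l))) * measure \<mu> (X N)" for n
    proof -
      have pC: "preim \<nu> path_shift n (C N) \<in> sets \<nu>" and pX: "preim \<mu> T n (X N) \<in> sets \<mu>"
        using sets_preim[OF preserves_path_shift C] sets_preim[OF T Xs] by auto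
      have ZZ: "Z N \<inter> preim ?M ?R n (Z N) = (C N \<inter> preim \<nu> path_shift n (C N)) \<times> (X N \<inter> preim \<mu> T n (X N))"
        unfolding Z_def preim_map_prod by blast
      have "measure ?M (Z N \<inter> preim ?M ?R n (Z N))
          = measure \<nu> (C N \<inter> preim \<nu> path_shift n (C N)) * measure \<mu> (X N \<inter> preim \<mu> T n (X N))"
        unfolding ZZ by (rule measure_pair_Times[OF sf]) (use C pC Xs pX in auto)
      also have "\<dots> \<le> (\<Sum>k\<in>{- int N..int N}. \<Sum>l\<in>{- int N..int N}. measure \<nu> (B k \<inter> preim \<nu> path_shift n (B l))) * measure \<mu> (X N)"
      proof (intro mult_mono)
        have Cu: "C N \<inter> preim \<nu> path_shift n (C N)
            = (\<Union>k\<in>{- int N..int N}. \<Union>l\<in>{- int N..int N}. B k \<inter> preim \<nu> path_shift n (B l))"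
          unfolding C_def preim_def by blast
        have "emeasure \<nu> (B k \<inter> preim \<nu> path_shift n (B l)) < \<infinity>" for k l
          by (rule le_less_trans[OF emeasure_mono[OF _ B] eB]) auto
        then have fm: "B k \<inter> preim \<nu> path_shift n (B l) \<in> fmeasurable \<nu>" for k l
          using B pB by (auto simp: fmeasurable_def)
        have "measure \<nu> (C N \<inter> preim \<nu> path_shift n (C N))
            \<le> (\<Sum>k\<in>{- int N..int N}. measure \<nu> (\<Union>l\<in>{- int N..int N}. B k \<inter> preim \<nu> path_shift n (B l)))"
          unfolding Cu
        proof (rule measure_UNION_le)
          fix k
          show "(\<Union>l\<in>{- int N..int N}. B k \<inter> preim \<nu> path_shift n (B l)) \<in> sets \<nu>"
            by (intro sets.finite_UN) (use B pB in auto)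
        qed simp
        also have "\<dots> \<le> (\<Sum>k\<in>{- int N..int N}. \<Sum>l\<in>{- int N..int N}. measure \<nu> (B k \<inter> preim \<nu> path_shift n (B l)))"
          by (intro sum_mono measure_UNION_le) (use fm in auto)
        finally show "measure \<nu> (C N \<inter> preim \<nu> path_shift n (C N))
            \<le> (\<Sum>k\<in>{- int N..int N}. \<Sum>l\<in>{- int N..int N}. measure \<nu> (B k \<inter> preim \<nu> path_shift n (B l)))" .
        show "measure \<mu> (X N \<inter> preim \<mu> T n (X N)) \<le> measure \<mu> (X N)"
          by (rule measure_mono_fmeasurable) (use Xs pX X(3) in \<open>auto simp: fmeasurable_def less_top\<close>)
      qed (auto intro!: sum_nonneg)
      finally show ?thesis .
    qed
    have "(\<lambda>n. (\<Sum>k\<in>{- int N..int N}. \<Sum>l\<in>{- int N..int N}. measure \<nu> (B k \<inter> preim \<nu> path_shift n (B l))) * measure \<mu> (X N))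
        \<longlonglongrightarrow> (\<Sum>k\<in>{- int N..int N}. \<Sum>l\<in>{- int N..int N}. 0) * measure \<mu> (X N)"
      using measure_shifted_event_tendsto_0[OF A lim] unfolding B_def
      by (intro tendsto_mult tendsto_sum tendsto_const)
    then have h0: "(\<lambda>n. (\<Sum>k\<in>{- int N..int N}. \<Sum>l\<in>{- int N..int N}. measure \<nu> (B k \<inter> preim \<nu> path_shift n (B l))) * measure \<mu> (X N)) \<longlonglongrightarrow> 0"
      by (simp only: sum.neutral_const mult_zero_left)
    show ?thesis
    proof (rule tendsto_sandwich[OF always_eventually always_eventually tendsto_const h0]; intro allI)
      show "0 \<le> measure ?M (Z N \<inter> preim ?M ?R n (Z N))" for n
        by (rule measure_nonneg)
    qed (rule le)
  qed
  show "(\<lambda>n. measure ?M (E \<inter> preim ?M ?R n F)) \<longlonglongrightarrow> 0"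
  proof (rule LIMSEQ_I)
    fix e :: real assume e: "0 < e"
    have "eventually (\<lambda>N. measure ?M (E - Z N) < e / 3 \<and> measure ?M (F - Z N) < e / 3) sequentially"
      using order_tendstoD(2)[OF rest[OF EF(1)], of "e / 3"] order_tendstoD(2)[OF rest[OF EF(2)], of "e / 3"] e
      by (intro eventually_conj) auto
    then obtain N where N: "measure ?M (E - Z N) < e / 3" "measure ?M (F - Z N) < e / 3"
      by (auto simp: eventually_sequentially)
    have "eventually (\<lambda>n. measure ?M (Z N \<inter> preim ?M ?R n (Z N)) < e / 3) sequentially"
      using order_tendstoD(2)[OF main[of N], of "e / 3"] e by simp
    then obtain n0 where n0: "\<And>n. n \<ge> n0 \<Longrightarrow> measure ?M (Z N \<inter> preim ?M ?R n (Z N)) < e / 3"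
      by (auto simp: eventually_sequentially)
    have Es: "E \<in> sets ?M" "emeasure ?M E < \<infinity>" and Fs: "F \<in> sets ?M" "emeasure ?M F < \<infinity>"
      using EF by (auto simp: fin_pos_sets_def)
    have "measure ?M (E \<inter> preim ?M ?R n F) < e" if "n \<ge> n0" for n
    proof -
      have FZ: "F - Z N \<in> sets ?M"
        using Fs Z by auto
      have pF: "preim ?M ?R n (F - Z N) \<in> sets ?M" "preim ?M ?R n F \<in> sets ?M" "preim ?M ?R n (Z N) \<in> sets ?M"
        using sets_preim[OF R] FZ Fs Z by auto
      have ep: "emeasure ?M (preim ?M ?R n (F - Z N)) = emeasure ?M (F - Z N)"
        by (rule emeasure_preim[OF R FZ])
      have fin: "emeasure ?M (F - Z N) < \<infinity>"
        using emeasure_mono[of "F - Z N" F ?M] Fs by (auto intro: le_less_trans)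
      have f1: "E - Z N \<in> fmeasurable ?M" "E \<in> fmeasurable ?M"
        using Es Z emeasure_mono[of "E - Z N" E ?M] by (auto simp: fmeasurable_def intro: le_less_trans)
      have f2: "preim ?M ?R n (F - Z N) \<in> fmeasurable ?M"
        using pF(1) fin ep by (simp add: fmeasurable_def)
      have f3: "Z N \<inter> preim ?M ?R n (Z N) \<in> fmeasurable ?M"
      proof -
        have "emeasure ?M (Z N) = emeasure \<nu> (C N) * emeasure \<mu> (X N)"
          unfolding Z_def by (rule sigma_finite_measure.emeasure_pair_measure_Times[OF sf C Xs])
        moreover have "emeasure \<nu> (C N) \<le> (\<Sum>k\<in>{- int N..int N}. emeasure \<nu> (B k))"
          unfolding C_def by (rule emeasure_subadditive_finite) (use B in auto)
        moreover have "(\<Sum>k\<in>{- int N..int N}. emeasure \<nu> (B k)) < \<infinity>"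
          using eB by simp
        ultimately have "emeasure ?M (Z N) < \<infinity>"
          using X(3)[of N] by (auto simp: ennreal_mult_less_top less_top intro: le_less_trans)
        then show ?thesis
          using Z pF(3) emeasure_mono[of "Z N \<inter> preim ?M ?R n (Z N)" "Z N" ?M]
          by (auto simp: fmeasurable_def intro: le_less_trans)
      qed
      have "measure ?M (E \<inter> preim ?M ?R n F)
          \<le> measure ?M ((E - Z N) \<union> preim ?M ?R n (F - Z N) \<union> (Z N \<inter> preim ?M ?R n (Z N)))"
      proof (rule measure_mono_fmeasurable)
        \<comment> \<open>Either the starting point leaves \<open>Z N\<close>, or the end point
          does, or both lie in it.\<close>
        show "E \<inter> preim ?M ?R n F \<subseteq> (E - Z N) \<union> preim ?M ?R n (F - Z N) \<union> (Z N \<inter> preim ?M ?R n (Z N))"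
          by (auto simp: preim_def)
        show "E \<inter> preim ?M ?R n F \<in> sets ?M"
          using Es pF by auto
        show "(E - Z N) \<union> preim ?M ?R n (F - Z N) \<union> (Z N \<inter> preim ?M ?R n (Z N)) \<in> fmeasurable ?M"
          by (intro fmeasurable.Un f1 f2 f3)
      qed
      also have "\<dots> \<le> measure ?M ((E - Z N) \<union> preim ?M ?R n (F - Z N)) + measure ?M (Z N \<inter> preim ?M ?R n (Z N))"
        by (rule measure_Un_le) (use f1 f2 f3 in \<open>auto simp: fmeasurable_def\<close>)
      also have "\<dots> \<le> measure ?M (E - Z N) + measure ?M (preim ?M ?R n (F - Z N)) + measure ?M (Z N \<inter> preim ?M ?R n (Z N))"
        by (intro add_right_mono measure_Un_le) (use f1 f2 in \<open>auto simp: fmeasurable_def\<close>)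
      also have "measure ?M (preim ?M ?R n (F - Z N)) = measure ?M (F - Z N)"
        using ep by (simp add: measure_def)
      finally show ?thesis
        using N n0[OF that] by linarith
    qed
    then show "\<exists>n0. \<forall>n\<ge>n0. norm (measure ?M (E \<inter> preim ?M ?R n F) - 0) < e"
      by (intro exI[of _ n0]) simp
  qed
qed

end

section \<open>Rational ergodicity\<close>

text \<open>A ratio above 1 would remain above 1 for ever, and the sequence could not tend to
  0.\<close>

lemma kaluza_seq_antimono:
  assumes "kaluza_seq u" "u \<longlonglongrightarrow> 0" "m \<le> n"
  shows "u n \<le> u m"
proof -
  have pos: "0 < u n" for n
    using assms(1) by (simp add: kaluza_seq_def)
  have ratio: "u (Suc i) / u i \<le> u (Suc j) / u j" if "i \<le> j" for i j
    using assms(1) that by (auto simp: kaluza_seq_def mono_def)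
  have step: "u (Suc n) \<le> u n" for n
  proof (rule ccontr)
    assume "\<not> u (Suc n) \<le> u n"
    then have "1 < u (Suc n) / u n"
      using pos[of n] by simp
    then have inc: "u k \<le> u (Suc k)" if "n \<le> k" for k
    proof -
      have "1 < u (Suc k) / u k"
        using \<open>1 < u (Suc n) / u n\<close> ratio[OF that] by (rule less_le_trans)
      then show ?thesis
        using pos[of k] by simp
    qed
    have "u n \<le> u k" if "n \<le> k" for k
      using that by (induction k rule: dec_induct) (auto intro: order_trans inc)
    then have "u n \<le> 0"
      by (intro LIMSEQ_le_const[OF assms(2)]) blast
    then show False
      using pos[of n] by simp
  qed
  show ?thesis
    by (rule lift_Suc_antimono_le[where f = u]) (use step assms(3) in auto)
qed

section \<open>Return times as digit displacements\<close>

text \<open>Takes only the values 0 and 1 under growth, but the form of a sum allows sums over times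
  to be exchanged with sums over blocks.\<close>

definition displacements :: "(nat \<Rightarrow> nat) \<Rightarrow> nat \<Rightarrow> nat set \<Rightarrow> nat \<Rightarrow> real" where
  "displacements q n I k = (\<Sum>J\<in>Pow {1..n}. of_bool (qsum q J - qsum q I = int k))"

lemma displacements_eq:
  assumes "growth_seq q"
  shows "displacements q n I k = of_bool (\<exists>J\<in>Pow {1..n}. qsum q J - qsum q I = int k)"
proof (cases "\<exists>J\<in>Pow {1..n}. qsum q J - qsum q I = int k")
  case True
  then obtain J where J: "J \<in> Pow {1..n}" "qsum q J - qsum q I = int k"
    by blast
  have "qsum q J' - qsum q I = int k \<longleftrightarrow> J' = J" if "J' \<in> Pow {1..n}" for J'
    using inj_onD[OF qsum_inj[OF assms] _ that J(1)] J(2) by fastforce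
  then have "displacements q n I k = (\<Sum>J'\<in>Pow {1..n}. of_bool (J' = J))"
    unfolding displacements_def by (intro sum.cong) auto
  also have "\<dots> = 1"
    using J(1) by (simp add: of_bool_def)
  finally show ?thesis
    using True by simp
next
  case False
  then show ?thesis
    unfolding displacements_def by (auto intro!: sum.neutral)
qed

text \<open>Up to time n all returns are decided by the block of the first n digits, which is
  uniform on the subsets of \<open>{1..n}\<close>; simultaneous returns become a product of factors
  0 or 1.\<close>

lemma measure_tower_return:
  assumes sg: "super_growth_seq q" and L: "L \<subseteq> {..n}" "finite L"
  defines "B \<equiv> tower_level q 1"
  shows "measure (tower_measure q) (B \<inter> (\<Inter>k\<in>L. preim (tower_measure q) (tower_map q) k B))
    = (\<Sum>I\<in>Pow {1..n}. \<Prod>k\<in>L. displacements q n I k) / 2 ^ n"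
proof -
  let ?X = "tower_measure q" and ?T = "tower_map q"
  have gr: "growth_seq q"
    using sg by (simp add: super_growth_seq_def)
  let ?Q = "\<lambda>I. \<forall>k\<in>L. \<exists>J\<in>Pow {1..n}. qsum q J - qsum q I = int k"
  let ?S = "B \<inter> (\<Inter>k\<in>L. preim ?X ?T k B)"
  have B: "B \<in> sets ?X"
    unfolding B_def by (rule sets_tower_level)
  have S: "?S \<in> sets ?X"
  proof -
    have "?S = {x \<in> B. \<forall>k\<in>L. x \<in> preim ?X ?T k B}"
      by auto
    also have "\<dots> = B \<inter> {x \<in> space ?X. \<forall>k\<in>L. x \<in> preim ?X ?T k B}"
      using sets.sets_into_space[OF B] by blast
    also have "\<dots> \<in> sets ?X"
    proof (intro sets.Int B sets.sets_Collect_finite_All L(2))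
      fix k assume "k \<in> L"
      have "{x \<in> space ?X. x \<in> preim ?X ?T k B} = preim ?X ?T k B"
        by (auto simp: preim_def)
      then show "{x \<in> space ?X. x \<in> preim ?X ?T k B} \<in> sets ?X"
        using sets_preim[OF preserves_tower_map[OF gr] B] by simp
    qed
    finally show ?thesis .
  qed
  have Qs: "{\<omega> \<in> space dyadic_measure. ?Q (ones n \<omega>)} \<in> sets dyadic_measure"
    by (rule sets_ones_Collect)
  note base = emeasure_tower_base_Collect[OF gr Qs]
  have "emeasure ?X ?S = emeasure ?X {x \<in> tower_level q 1. ?Q (ones n (fst x))}"
  proof (rule emeasure_eq_AE[OF _ S base(1)])
    show "AE x in ?X. x \<in> ?S \<longleftrightarrow> x \<in> {x \<in> tower_level q 1. ?Q (ones n (fst x))}"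
      using AE_tower_fst[OF AE_inf_zeros] AE_space
    proof eventually_elim
      case (elim x)
      show ?case
      proof (cases "x \<in> B")
        case True
        then obtain \<omega> where x: "x = (\<omega>, 1)"
          by (cases x) (auto simp: B_def tower_level_def)
        have \<omega>: "\<omega> \<in> inf_zeros"
          using elim(1) x by simp
        have "x \<in> preim ?X ?T k B \<longleftrightarrow> (\<exists>J\<in>Pow {1..n}. qsum q J - qsum q (ones n \<omega>) = int k)" if "k \<in> L" for k
        proof -
          have "(?T ^^ k) x \<in> space ?X"
            using measurable_space[OF preserves_measurable[OF preserves_funpow[OF preserves_tower_map[OF gr]]] elim(2)] .
          then have "x \<in> preim ?X ?T k B \<longleftrightarrow> snd ((?T ^^ k) (\<omega>, 1)) = 1"
            using elim(2) by (simp add: preim_def B_def tower_level_def x)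
          also have "\<dots> \<longleftrightarrow> (\<exists>J\<in>Pow {1..n}. qsum q J - qsum q (ones n \<omega>) = int k)"
            by (rule tower_return_iff[OF sg \<omega>]) (use L(1) that in auto)
          finally show ?thesis .
        qed
        then have "x \<in> ?S \<longleftrightarrow> ?Q (ones n \<omega>)"
          using True by simp
        then show ?thesis
          using True by (simp add: x B_def)
      qed (simp add: B_def)
    qed
  qed
  also have "\<dots> = emeasure dyadic_measure {\<omega> \<in> space dyadic_measure. ?Q (ones n \<omega>)}"
    by (rule base(2))
  finally have "measure ?X ?S = measure dyadic_measure {\<omega> \<in> space dyadic_measure. ?Q (ones n \<omega>)}"
    by (simp add: measure_def)
  also have "\<dots> = (\<Sum>I\<in>Pow {1..n}. of_bool (?Q I)) / 2 ^ n"
    by (rule measure_dyadic_ones_Collect)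
  also have "(\<Sum>I\<in>Pow {1..n}. of_bool (?Q I)) = (\<Sum>I\<in>Pow {1..n}. \<Prod>k\<in>L. displacements q n I k)"
  proof (rule sum.cong[OF refl])
    fix I
    have "(\<Prod>k\<in>L. displacements q n I k) = (\<Prod>k\<in>L. of_bool (\<exists>J\<in>Pow {1..n}. qsum q J - qsum q I = int k))"
      using displacements_eq[OF gr] by simp
    also have "\<dots> = of_bool (?Q I)"
      using L(2) by (induction L rule: finite_induct) auto
    finally show "of_bool (?Q I) = (\<Prod>k\<in>L. displacements q n I k)" ..
  qed
  finally show ?thesis .
qed

lemma rationally_ergodicI_correlations:
  assumes R: "preserves m R" and F: "F \<in> fin_pos_sets m" and C: "0 < C"
    and le: "\<And>n. 1 \<le> n \<Longrightarrow> (\<Sum>i<n. \<Sum>j<n. measure m (F \<inter> preim m R i F \<inter> preim m R j F))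
      \<le> C * (\<Sum>k<n. measure m (F \<inter> preim m R k F))\<^sup>2"
  shows "rationally_ergodic m R"
proof -
  have Fs: "F \<in> sets m" and Ffin: "emeasure m F < \<infinity>"
    using F by (auto simp: fin_pos_sets_def)
  have p: "preim m R k F \<in> sets m" for k
    by (rule sets_preim[OF R Fs])
  have fin1: "emeasure m (F \<inter> preim m R i F) < \<infinity>" for i
    by (rule le_less_trans[OF emeasure_mono[OF _ Fs] Ffin]) auto
  have fin2: "emeasure m (F \<inter> preim m R i F \<inter> preim m R j F) < \<infinity>" for i j
    by (rule le_less_trans[OF emeasure_mono[OF _ Fs] Ffin]) auto
  have first: "(LINT x:F|m. visits R F n x) = (\<Sum>k<n. measure m (F \<inter> preim m R k F))" for n
  proof -
    have "(LINT x:F|m. visits R F n x) = (\<integral>x. (\<Sum>k<n. indicator (F \<inter> preim m R k F) x) \<partial>m)"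
      unfolding set_lebesgue_integral_def
      by (intro Bochner_Integration.integral_cong refl) (auto simp: visits_def preim_def indicator_def)
    also have "\<dots> = (\<Sum>k<n. measure m (F \<inter> preim m R k F))"
      using Fs p fin1 by (subst Bochner_Integration.integral_sum) (auto simp: Int_assoc)
    finally show ?thesis .
  qed
  have second: "(LINT x:F|m. (visits R F n x)\<^sup>2)
      = (\<Sum>i<n. \<Sum>j<n. measure m (F \<inter> preim m R i F \<inter> preim m R j F))" for n
  proof -
    have "(LINT x:F|m. (visits R F n x)\<^sup>2)
        = (\<integral>x. (\<Sum>i<n. \<Sum>j<n. indicator (F \<inter> preim m R i F \<inter> preim m R j F) x) \<partial>m)"
      unfolding set_lebesgue_integral_def
    proof (intro Bochner_Integration.integral_cong refl)
      fix x assume x: "x \<in> space m"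
      have sq: "(visits R F n x)\<^sup>2 = (\<Sum>i<n. \<Sum>j<n. indicator F ((R ^^ i) x) * indicator F ((R ^^ j) x))"
        by (simp add: visits_def power2_eq_square sum_product)
      have "indicator F x *\<^sub>R (visits R F n x)\<^sup>2
          = (\<Sum>i<n. \<Sum>j<n. indicator F x * (indicator F ((R ^^ i) x) * indicator F ((R ^^ j) x)))"
        unfolding sq real_scaleR_def sum_distrib_left ..
      also have "\<dots> = (\<Sum>i<n. \<Sum>j<n. indicator (F \<inter> preim m R i F \<inter> preim m R j F) x)"
        by (intro sum.cong refl) (use x in \<open>auto simp: preim_def indicator_def\<close>)
      finally show "indicator F x *\<^sub>R (visits R F n x)\<^sup>2
          = (\<Sum>i<n. \<Sum>j<n. indicator (F \<inter> preim m R i F \<inter> preim m R j F) x)" .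
    qed
    also have "\<dots> = (\<Sum>i<n. \<Sum>j<n. measure m (F \<inter> preim m R i F \<inter> preim m R j F))"
      using Fs p fin2 by (subst Bochner_Integration.integral_sum) (auto simp: Bochner_Integration.integral_sum Int_assoc)
    finally show ?thesis .
  qed
  show ?thesis
    unfolding rationally_ergodic_def using F C le by (intro bexI[of _ F] exI[of _ C]) (auto simp: first second)
qed

text \<open>Summing over digits, the first moment is a pair average and the second one is dominated by
  a triple average of the truncated renewal sequence.\<close>

lemma rationally_ergodic_product:
  assumes sg: "super_growth_seq q" and S: "preserves \<nu> S"
    and A: "recurrent_event \<nu> S A" and kal: "kaluza_seq (event_seq \<nu> S A)" and lim: "event_seq \<nu> S A \<longlonglongrightarrow> 0"
  shows "rationally_ergodic (\<nu> \<Otimes>\<^sub>M tower_measure q) (map_prod S (tower_map q))"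
proof -
  let ?X = "tower_measure q" and ?T = "tower_map q"
  let ?M = "\<nu> \<Otimes>\<^sub>M ?X" and ?R = "map_prod S ?T"
  define u where "u = event_seq \<nu> S A"
  define \<alpha> where "\<alpha> = measure \<nu> A"
  define B where "B = tower_level q 1"
  define F where "F = A \<times> B"
  have gr: "growth_seq q"
    using sg by (simp add: super_growth_seq_def)
  have T: "preserves ?X ?T"
    by (rule preserves_tower_map[OF gr])
  have R: "preserves ?M ?R"
    by (rule preserves_map_prod[OF S T sigma_finite_tower])
  have As: "A \<in> sets \<nu>" and Apos: "0 < emeasure \<nu> A" and Afin: "emeasure \<nu> A < \<infinity>"
    using A by (auto simp: recurrent_event_def fin_pos_sets_def)
  have \<alpha>: "0 < \<alpha>"
    using Apos Afin by (simp add: \<alpha>_def measure_def enn2real_positive_iff)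
  have Bs: "B \<in> sets ?X"
    unfolding B_def by (rule sets_tower_level)
  have eB: "emeasure ?X B = 1"
  proof -
    have "{x \<in> tower_level q 1. True} = B" "{\<omega> \<in> space dyadic_measure. True} = space dyadic_measure"
      by (auto simp: B_def)
    then show ?thesis
      using emeasure_tower_base_Collect(2)[OF gr, of "\<lambda>_. True"] prob_space.emeasure_space_1[OF prob_space_dyadic]
      by simp
  qed
  have F: "F \<in> fin_pos_sets ?M"
    using sigma_finite_measure.emeasure_pair_measure_Times[OF sigma_finite_tower As Bs] As Bs Apos Afin
    by (simp add: fin_pos_sets_def F_def eB)
  have pA: "preim \<nu> S k A \<in> sets \<nu>" and pB: "preim ?X ?T k B \<in> sets ?X" for k
    using sets_preim[OF S As] sets_preim[OF T Bs] by auto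
  have u0: "0 \<le> u k" for k
    by (simp add: u_def event_seq_def)
  have udec: "u j \<le> u i" if "i \<le> j" for i j
    unfolding u_def by (rule kaluza_seq_antimono[OF kal lim that])
  have preim0: "preim \<nu> S 0 A = A"
    using sets.sets_into_space[OF As] by (auto simp: preim_def)
  have A2: "measure \<nu> (A \<inter> preim \<nu> S i A) = \<alpha> * u i" for i
    using \<alpha> by (simp add: u_def event_seq_def \<alpha>_def)
  have A3: "measure \<nu> (A \<inter> preim \<nu> S i A \<inter> preim \<nu> S j A) = \<alpha> * (u i * u (j - i))" if "i \<le> j" for i j
  proof -
    \<comment> \<open>The times 0, i, j: the product formula of the recurrent event with two
      increments.\<close>
    define t where "t = (\<lambda>l::nat. if l = 0 then 0 else if l = 1 then i else j)"
    have "mono_on {..2} t"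
      using that by (auto simp: mono_on_def t_def)
    moreover have "t 0 = 0"
      by (simp add: t_def)
    ultimately have "measure \<nu> (\<Inter>l\<le>2. preim \<nu> S (t l) A) = \<alpha> * (\<Prod>l=1..2. u (t l - t (l - 1)))"
      using A unfolding recurrent_event_def u_def \<alpha>_def by blast
    moreover have "(\<Inter>l\<le>2. preim \<nu> S (t l) A) = A \<inter> preim \<nu> S i A \<inter> preim \<nu> S j A"
    proof -
      have "{..2::nat} = {0, 1, 2}"
        by auto
      then show ?thesis
        by (simp add: t_def preim0 Int_assoc)
    qed
    moreover have "(\<Prod>l=1..2. u (t l - t (l - 1))) = u i * u (j - i)"
      by (simp add: t_def numeral_2_eq_2)
    ultimately show ?thesis
      by simp
  qed
  define D where "D n I k = displacements q n I k" for n I k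
  have B2: "measure ?X (B \<inter> preim ?X ?T i B) = (\<Sum>I\<in>Pow {1..n}. D n I i) / 2 ^ n" if "i < n" for i n
    using measure_tower_return[OF sg, of "{i}" n] that by (simp add: B_def D_def)
  have B3: "measure ?X (B \<inter> preim ?X ?T i B \<inter> preim ?X ?T j B) = (\<Sum>I\<in>Pow {1..n}. D n I i * D n I j) / 2 ^ n"
    if "i < n" "j < n" for i j n
  proof (cases "i = j")
    case True
    have dd: "D n I j * D n I j = D n I j" for I
      unfolding D_def displacements_eq[OF gr] of_bool_conj[symmetric] conj_absorb ..
    show ?thesis
      unfolding True dd Int_assoc Int_absorb by (rule B2[OF that(2)])
  next
    case False
    then show ?thesis
      using measure_tower_return[OF sg, of "{i, j}" n] that by (simp add: B_def D_def Int_assoc)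
  qed
  have M2: "measure ?M (F \<inter> preim ?M ?R i F) = \<alpha> * (u i * measure ?X (B \<inter> preim ?X ?T i B))" for i
  proof -
    have "F \<inter> preim ?M ?R i F = (A \<inter> preim \<nu> S i A) \<times> (B \<inter> preim ?X ?T i B)"
      unfolding F_def preim_map_prod by blast
    then have "measure ?M (F \<inter> preim ?M ?R i F)
        = measure \<nu> (A \<inter> preim \<nu> S i A) * measure ?X (B \<inter> preim ?X ?T i B)"
      by (simp only:) (rule measure_pair_Times[OF sigma_finite_tower], use As Bs pA pB in auto)
    then show ?thesis
      by (simp add: A2)
  qed
  have M3: "measure ?M (F \<inter> preim ?M ?R i F \<inter> preim ?M ?R j F)
      = \<alpha> * (u i * u (j - i) * measure ?X (B \<inter> preim ?X ?T i B \<inter> preim ?X ?T j B))" if "i \<le> j" for i j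
  proof -
    have "F \<inter> preim ?M ?R i F \<inter> preim ?M ?R j F
        = (A \<inter> preim \<nu> S i A \<inter> preim \<nu> S j A) \<times> (B \<inter> preim ?X ?T i B \<inter> preim ?X ?T j B)"
      unfolding F_def preim_map_prod by blast
    then have "measure ?M (F \<inter> preim ?M ?R i F \<inter> preim ?M ?R j F)
        = measure \<nu> (A \<inter> preim \<nu> S i A \<inter> preim \<nu> S j A) * measure ?X (B \<inter> preim ?X ?T i B \<inter> preim ?X ?T j B)"
      by (simp only:) (rule measure_pair_Times[OF sigma_finite_tower], use As Bs pA pB in auto)
    then show ?thesis
      by (simp add: A3[OF that] mult.assoc)
  qed
  show ?thesis
  proof (rule rationally_ergodicI_correlations[OF R F])
    \<comment> \<open>One factor 2 comes from \<open>triple_avg_le_square\<close> and one from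
      ordering the two visit times; \<open>1 / \<alpha>\<close> appears since the second moment is
      linear in \<open>\<alpha>\<close> and the square of the first moment is quadratic.\<close>
    show "0 < 4 / \<alpha>"
      using \<alpha> by simp
    fix n :: nat assume n: "1 \<le> n"
    \<comment> \<open>Cut off at n as well as below 0, because displacements of n digits can exceed
      the range of times; \<open>U\<close> stays decreasing on the nonnegative integers.\<close>
    define U where "U x = (if 0 \<le> x \<and> x < int n then u (nat x) else 0)" for x
    have U0: "0 \<le> U x" for x
      by (simp add: U_def u0)
    have "(\<Sum>k<n. u k * measure ?X (B \<inter> preim ?X ?T k B)) = (\<Sum>k<n. \<Sum>I\<in>Pow {1..n}. u k * D n I k) / 2 ^ n"
      by (simp add: B2 sum_distrib_left sum_divide_distrib)
    also have "(\<Sum>k<n. \<Sum>I\<in>Pow {1..n}. u k * D n I k)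
        = (\<Sum>I\<in>Pow {1..n}. \<Sum>k<n. \<Sum>J\<in>Pow {1..n}. u k * of_bool (qsum q J - qsum q I = int k))"
      unfolding D_def displacements_def sum_distrib_left by (rule sum.swap)
    also have "\<dots> = (\<Sum>I\<in>Pow {1..n}. \<Sum>J\<in>Pow {1..n}. U (qsum q J - qsum q I))"
    proof (intro sum.cong refl, subst sum.swap, intro sum.cong refl)
      fix I J
      let ?d = "qsum q J - qsum q I"
      have "(\<Sum>k<n. u k * of_bool (?d = int k)) = (\<Sum>k<n. if k = nat ?d then U ?d else 0)"
        by (intro sum.cong refl) (auto simp: U_def)
      also have "\<dots> = U ?d"
        by (auto simp: U_def)
      finally show "(\<Sum>k<n. u k * of_bool (?d = int k)) = U ?d" .
    qed
    finally have pair: "(\<Sum>k<n. u k * measure ?X (B \<inter> preim ?X ?T k B)) = pair_avg q n U"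
      by (simp add: pair_avg_def)
    define P where "P = {(i, j). i \<le> j \<and> j < n}"
    have Pfin: "finite P"
      by (rule finite_subset[of _ "{..<n} \<times> {..<n}"]) (auto simp: P_def)
    define c where "c i j = u i * u (j - i) * measure ?X (B \<inter> preim ?X ?T i B \<inter> preim ?X ?T j B)" for i j
    have c0: "0 \<le> c i j" for i j
      by (simp add: c_def u0)
    have avg: "(\<Sum>(i, j)\<in>P. c i j) = (\<Sum>(i, j)\<in>P. \<Sum>I\<in>Pow {1..n}. u i * u (j - i) * (D n I i * D n I j)) / 2 ^ n"
    proof (subst sum_divide_distrib, intro sum.cong refl)
      fix x assume "x \<in> P"
      then obtain i j where ij: "x = (i, j)" "i < n" "j < n"
        by (auto simp: P_def)
      show "(case x of (i, j) \<Rightarrow> c i j)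
          = (case x of (i, j) \<Rightarrow> \<Sum>I\<in>Pow {1..n}. u i * u (j - i) * (D n I i * D n I j)) / 2 ^ n"
        unfolding ij(1) prod.case c_def B3[OF ij(2,3)] times_divide_eq_right sum_distrib_left ..
    qed
    have "(\<Sum>(i, j)\<in>P. \<Sum>I\<in>Pow {1..n}. u i * u (j - i) * (D n I i * D n I j))
        = (\<Sum>I\<in>Pow {1..n}. \<Sum>(i, j)\<in>P. u i * u (j - i) * (D n I i * D n I j))"
      unfolding case_prod_beta by (rule sum.swap)
    also have "\<dots> = (\<Sum>I\<in>Pow {1..n}. \<Sum>(i, j)\<in>P. \<Sum>J\<in>Pow {1..n}. \<Sum>K\<in>Pow {1..n}.
        u i * u (j - i) * (of_bool (qsum q J - qsum q I = int i) * of_bool (qsum q K - qsum q I = int j)))"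
      unfolding D_def displacements_def sum_product unfolding sum_distrib_left ..
    also have "\<dots> = (\<Sum>I\<in>Pow {1..n}. \<Sum>J\<in>Pow {1..n}. \<Sum>K\<in>Pow {1..n}. \<Sum>(i, j)\<in>P.
        u i * u (j - i) * (of_bool (qsum q J - qsum q I = int i) * of_bool (qsum q K - qsum q I = int j)))"
      unfolding case_prod_beta
      by (intro sum.cong refl, subst sum.swap, intro sum.cong refl, rule sum.swap)
    \<comment> \<open>For given blocks at most one pair of times contributes. The right side also
      counts triples whose second visit comes at time n or later, hence no equality.\<close>
    also have "\<dots> \<le> (\<Sum>I\<in>Pow {1..n}. \<Sum>J\<in>Pow {1..n}. \<Sum>K\<in>Pow {1..n}.
        U (qsum q J - qsum q I) * U (qsum q K - qsum q J))"
    proof (intro sum_mono)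
      fix I J K
      let ?d = "qsum q J - qsum q I" and ?e = "qsum q K - qsum q I"
      let ?p = "(nat ?d, nat ?e)" and ?v = "U ?d * U (qsum q K - qsum q J)"
      have "(\<Sum>(i, j)\<in>P. u i * u (j - i) * (of_bool (?d = int i) * of_bool (?e = int j)))
          \<le> (\<Sum>x\<in>P. if x = ?p then ?v else 0)"
      proof (rule sum_mono)
        fix x assume x: "x \<in> P"
        obtain i j where ij: "x = (i, j)"
          by (cases x)
        then have P: "i \<le> j" "j < n"
          using x by (auto simp: P_def)
        show "(case x of (i, j) \<Rightarrow> u i * u (j - i) * (of_bool (?d = int i) * of_bool (?e = int j)))
            \<le> (if x = ?p then ?v else 0)"
        proof (cases "?d = int i \<and> ?e = int j")
          case True
          then have e: "qsum q K - qsum q J = int (j - i)"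
            using P by (simp add: of_nat_diff)
          have "U (int k) = u k" if "k < n" for k
            using that by (simp add: U_def)
          then have "?v = u i * u (j - i)"
            unfolding e True[THEN conjunct1] using P by (simp del: of_nat_diff)
          then show ?thesis
            using True ij by simp
        next
          case False
          then show ?thesis
            using U0 ij by auto
        qed
      qed
      also have "\<dots> \<le> ?v"
        using Pfin U0 by simp
      finally show "(\<Sum>(i, j)\<in>P. u i * u (j - i) * (of_bool (?d = int i) * of_bool (?e = int j))) \<le> ?v" .
    qed
    finally have "(\<Sum>(i, j)\<in>P. c i j) \<le> triple_avg q n U U"
      unfolding avg triple_avg_def by (rule divide_right_mono) simp
    also have "\<dots> \<le> 2 * (pair_avg q n U)\<^sup>2"
    proof (rule triple_avg_le_square[OF _ U0])
      show "qsum q {1..<k} < int (q k)" if "k \<ge> 1" for k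
        by (rule growth_seq_qsum[OF gr that])
      show "U y \<le> U x" if "0 \<le> x" "x \<le> y" for x y
        using that udec[of "nat x" "nat y"] u0 by (auto simp: U_def)
    qed (simp add: U_def)
    finally have triple: "(\<Sum>(i, j)\<in>P. c i j) \<le> 2 * (pair_avg q n U)\<^sup>2" .
    let ?m = "\<lambda>i j. measure ?M (F \<inter> preim ?M ?R i F \<inter> preim ?M ?R j F)"
    \<comment> \<open>For i = j both summands are present, so the diagonal is counted twice.\<close>
    have m: "?m i j \<le> \<alpha> * ((if i \<le> j then c i j else 0) + (if j \<le> i then c j i else 0))" for i j
    proof (cases "i \<le> j")
      case True
      then show ?thesis
        using M3[OF True] c0[of j i] \<alpha> by (auto simp: c_def algebra_simps)
    next
      case False
      have "?m i j = ?m j i"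
        by (simp add: Int_ac)
      then show ?thesis
        using M3[of j i] False by (simp add: c_def)
    qed
    have half: "(\<Sum>i<n. \<Sum>j<n. if i \<le> j then c i j else 0) = (\<Sum>(i, j)\<in>P. c i j)"
    proof -
      have "(\<Sum>i<n. \<Sum>j<n. if i \<le> j then c i j else 0)
          = (\<Sum>x\<in>{..<n} \<times> {..<n}. if fst x \<le> snd x then c (fst x) (snd x) else 0)"
        by (simp add: sum.cartesian_product case_prod_beta)
      also have "\<dots> = (\<Sum>x\<in>{x \<in> {..<n} \<times> {..<n}. fst x \<le> snd x}. c (fst x) (snd x))"
        by (rule sum.inter_filter[symmetric]) simp
      also have "{x \<in> {..<n} \<times> {..<n}. fst x \<le> snd x} = P"
        by (auto simp: P_def)
      finally show ?thesis
        by (simp add: case_prod_beta)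
    qed
    have "(\<Sum>i<n. \<Sum>j<n. ?m i j)
        \<le> (\<Sum>i<n. \<Sum>j<n. \<alpha> * ((if i \<le> j then c i j else 0) + (if j \<le> i then c j i else 0)))"
      by (intro sum_mono m)
    also have "\<dots> = \<alpha> * ((\<Sum>i<n. \<Sum>j<n. if i \<le> j then c i j else 0) + (\<Sum>i<n. \<Sum>j<n. if j \<le> i then c j i else 0))"
      unfolding sum_distrib_left[symmetric] sum.distrib ..
    also have "(\<Sum>i<n. \<Sum>j<n. if j \<le> i then c j i else 0) = (\<Sum>j<n. \<Sum>i<n. if j \<le> i then c j i else 0)"
      by (rule sum.swap)
    also have "\<alpha> * ((\<Sum>i<n. \<Sum>j<n. if i \<le> j then c i j else 0) + \<dots>) = \<alpha> * (2 * (\<Sum>(i, j)\<in>P. c i j))"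
      by (simp only: half mult_2)
    also have "\<dots> \<le> \<alpha> * (2 * (2 * (pair_avg q n U)\<^sup>2))"
      using triple \<alpha> by (intro mult_left_mono) auto
    also have "\<dots> = 4 / \<alpha> * (\<alpha> * pair_avg q n U)\<^sup>2"
      using \<alpha> by (simp add: power2_eq_square)
    also have "\<alpha> * pair_avg q n U = (\<Sum>k<n. measure ?M (F \<inter> preim ?M ?R k F))"
      unfolding pair[symmetric] M2 by (simp add: sum_distrib_left)
    finally show "(\<Sum>i<n. \<Sum>j<n. ?m i j) \<le> 4 / \<alpha> * (\<Sum>k<n. measure ?M (F \<inter> preim ?M ?R k F))\<^sup>2" .
  qed
qed

section \<open>The theorem\<close>

lemma spectrally_weakly_mixing_product:
  assumes "markov_shift p \<rho> \<nu>" "Gcd {n. 1 \<le> n \<and> 0 < nstep p n 1 1} = 1"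
    and "conservative \<nu> path_shift" "ergodic \<nu> path_shift"
    and sf: "sigma_finite_measure \<mu>" and T: "preserves \<mu> T" and swm: "spectrally_weakly_mixing \<mu> T"
    and cons: "conservative (\<nu> \<Otimes>\<^sub>M \<mu>) (map_prod path_shift T)"
  shows "spectrally_weakly_mixing (\<nu> \<Otimes>\<^sub>M \<mu>) (map_prod path_shift T)"
  unfolding spectrally_weakly_mixing_def
proof (intro allI impI)
  let ?M = "\<nu> \<Otimes>\<^sub>M \<mu>" and ?R = "map_prod path_shift T"
  interpret markov_shift p \<rho> \<nu> by fact
  fix f :: "_ \<Rightarrow> complex" and l :: complex
  assume f [measurable]: "f \<in> borel_measurable ?M" and "\<exists>C. AE x in ?M. norm (f x) \<le> C"
    and l: "norm l = 1" and eig: "AE x in ?M. f (?R x) = l * f x"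
  then obtain C where C: "AE x in ?M. norm (f x) \<le> C"
    by blast
  \<comment> \<open>The locale asks for a bound at every point, so that all sections are integrable
    on sets of finite measure.\<close>
  define g where "g x = (if norm (f x) \<le> C then f x else 0)" for x
  have R: "preserves ?M ?R"
    by (rule preserves_map_prod[OF preserves_path_shift T sf])
  have fg: "AE x in ?M. f x = g x"
    using C by eventually_elim (simp add: g_def)
  \<comment> \<open>The absolute value covers the points where \<open>g\<close> is set to 0, as
    \<open>C\<close> is not known to be nonnegative.\<close>
  interpret product_recurrent p \<rho> \<nu> \<mu> T g l "\<bar>C\<bar>"
  proof (intro product_recurrent.intro product_eigenfunction.intro product_eigenfunction_axioms.intro
      product_recurrent_axioms.intro)
    show "g \<in> borel_measurable ?M"
      unfolding g_def by measurable
    show "AE z in ?M. g (?R z) = l * g z"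
      using eig fg preserves_AE[OF R fg] by eventually_elim simp
    show "norm (g z) \<le> \<bar>C\<bar>" for z
      using abs_ge_self[of C] unfolding g_def by (auto intro: order_trans)
  qed (rule assms(1) sf T cons l assms(3,4))+
  obtain c where "AE z in ?M. g z = c"
    using eigenfunction_constant[OF swm assms(2)] by blast
  with fg have "AE z in ?M. f z = c"
    by eventually_elim simp
  then show "\<exists>c. AE x in ?M. f x = c" ..
qed

theorem mainTheorem2:
  fixes q :: "nat \<Rightarrow> nat"
    and v :: "nat \<Rightarrow> real"
    and \<nu> :: "(int \<Rightarrow> nat) measure"
    and A :: "(int \<Rightarrow> nat) set"
  assumes "super_growth_seq q"
    and "spectrally_weakly_mixing (tower_measure q) (tower_map q)"
    and "renewal_process v \<nu>"
    and "aperiodic_seq v"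
    and "conservative \<nu> path_shift"
    and "ergodic \<nu> path_shift"
    and "recurrent_event \<nu> path_shift A"
    and "null_recurrent_seq (event_seq \<nu> path_shift A)"
    and "kaluza_seq (event_seq \<nu> path_shift A)"
    and "conservative (\<nu> \<Otimes>\<^sub>M tower_measure q) (map_prod path_shift (tower_map q))"
  shows "zero_type (\<nu> \<Otimes>\<^sub>M tower_measure q) (map_prod path_shift (tower_map q))
    \<and> rationally_ergodic (\<nu> \<Otimes>\<^sub>M tower_measure q) (map_prod path_shift (tower_map q))
    \<and> spectrally_weakly_mixing (\<nu> \<Otimes>\<^sub>M tower_measure q) (map_prod path_shift (tower_map q))
    \<and> \<not> subsequence_rationally_weakly_mixing (\<nu> \<Otimes>\<^sub>M tower_measure q)
          (map_prod path_shift (tower_map q))"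
proof -
  obtain p \<rho> where p: "stochastic_matrix p" "\<And>n. nstep p n 1 1 = v n" "stationary_markov_measure p \<rho> \<nu>"
    using assms(3) unfolding renewal_process_def by blast
  then have ms: "markov_shift p \<rho> \<nu>"
    by (intro markov_shift.intro)
  interpret markov_shift p \<rho> \<nu> by (rule ms)
  have T: "preserves (tower_measure q) (tower_map q)"
    using assms(1) by (intro preserves_tower_map) (simp add: super_growth_seq_def)
  have lim: "event_seq \<nu> path_shift A \<longlonglongrightarrow> 0"
    using assms(8) by (simp add: null_recurrent_seq_def)
  have A: "A \<in> fin_pos_sets \<nu>"
    using assms(7) by (simp add: recurrent_event_def)
  have aper: "Gcd {n. 1 \<le> n \<and> 0 < nstep p n 1 1} = 1"
    using assms(4) by (simp only: aperiodic_seq_def p(2))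
  show ?thesis
    using zero_type_product[OF assms(6) A lim sigma_finite_tower T]
      rationally_ergodic_product[OF assms(1) preserves_path_shift assms(7,9) lim]
      spectrally_weakly_mixing_product[OF ms aper assms(5,6) sigma_finite_tower T assms(2,10)]
      not_subsequence_rationally_weakly_mixing[OF assms(1) preserves_path_shift sigma_finite_nu]
    by blast
qed

end
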